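(* Let $N\ge 2$ be an integer and let $\lambda$ be real with $\lambda\in(0,N)$ and $\lambda\le 2$. Let $$m_* = \Big( \frac{2^{1/N}-1}{1-2^{(\lambda-N)/N}} \cdot \frac{\operatorname{Per} B_1 }{D(B_1)}\Big)^{N/(N+1-\lambda)} |B_1|,$$ where $B_1$ is the unit ball in $\mathbb{R}^N$. Then there exists a constant $m_{c_2}\ge m_*$ (finite) such that for every $m>m_{c_2}$ the variational problem $E(m)$ does not have a minimizer.
   Context: For $N\ge2$, $\lambda\in(0,N)$ and a measurable set $\Omega\subset\mathbb{R}^N$, $|\Omega|$ denotes its Lebesgue measure. The perimeter (in the sense of De Giorgi) is $$\operatorname{Per}\Omega=\sup\Big\{\int_\Omega \operatorname{div}F(x)\,dx \;:\; F\in C_0^1(\mathbb{R}^N,\mathbb{R}^N),\ |F|\le 1\Big\},$$ where $C^1_0$ denotes compactly supported $C^1$ vector fields (the value $+\infty$ is allowed). Set $$D(\Omega)=\frac12\iint_{\Omega\times\Omega}\frac{dx\,dy}{|x-y|^\lambda},\qquad \mathcal{E}(\Omega)=\operatorname{Per}\Omega+D(\Omega).$$ For $m>0$ let $E(m)=\inf\{\mathcal{E}(\Omega): \Omega\subset\mathbb{R}^N \text{ measurable},\ |\Omega|=m\}$. A minimizer for $E(m)$ is a measurable set $\Omega$ with $|\Omega|=m$ and $\mathcal{E}(\Omega)=E(m)$. *)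

theory Defs
  imports "HOL-Analysis.Analysis"
begin

definition divergence :: "('a::euclidean_space \<Rightarrow> 'a) \<Rightarrow> 'a \<Rightarrow> real" where
  "divergence F x = (\<Sum>b\<in>Basis. frechet_derivative F (at x) b \<bullet> b)"

definition C1_compact_support :: "('a::euclidean_space \<Rightarrow> 'a) set" where
  "C1_compact_support =
     {F. (\<exists>F' :: 'a \<Rightarrow> 'a \<Rightarrow>\<^sub>L 'a.
            (\<forall>x. (F has_derivative blinfun_apply (F' x)) (at x)) \<and> continuous_on UNIV F') \<and>
         compact (closure {x. F x \<noteq> 0})}"

(* The coercion from real to ennreal truncates negative values to 0. This does not change the
   supremum, since F = 0 is admissible. *)
definition perimeter :: "'a::euclidean_space set \<Rightarrow> ennreal" where
  "perimeter \<Omega> =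
     (SUP F\<in>{F \<in> C1_compact_support. \<forall>x. norm (F x) \<le> 1}.
        ennreal (LINT x:\<Omega>|lebesgue. divergence F x))"

(* On the diagonal the integrand is 1 / 0 = 0, which is harmless: the diagonal is a null set. *)
definition riesz_energy :: "real \<Rightarrow> 'a::euclidean_space set \<Rightarrow> ennreal" where
  "riesz_energy lam \<Omega> =
     (\<integral>\<^sup>+z\<in>\<Omega> \<times> \<Omega>. ennreal (1 / norm (fst z - snd z) powr lam) \<partial>(lebesgue \<Otimes>\<^sub>M lebesgue)) / 2"

definition energy :: "real \<Rightarrow> 'a::euclidean_space set \<Rightarrow> ennreal" where
  "energy lam \<Omega> = perimeter \<Omega> + riesz_energy lam \<Omega>"

definition sets_of_mass :: "real \<Rightarrow> 'a::euclidean_space set set" where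
  "sets_of_mass m = {\<Omega> \<in> sets lebesgue. emeasure lebesgue \<Omega> = ennreal m}"

(* The type argument fixes the ambient space over which the infimum is taken. *)
definition min_energy :: "'a::euclidean_space itself \<Rightarrow> real \<Rightarrow> real \<Rightarrow> ennreal" where
  "min_energy _ lam m = (INF \<Omega>\<in>(sets_of_mass m :: 'a set set). energy lam \<Omega>)"

definition is_minimizer :: "real \<Rightarrow> real \<Rightarrow> 'a::euclidean_space set \<Rightarrow> bool" where
  "is_minimizer lam m \<Omega> \<longleftrightarrow> \<Omega> \<in> sets_of_mass m \<and> energy lam \<Omega> = min_energy TYPE('a) lam m"

(* Perimeter and Riesz energy of the unit ball are finite and positive for 0 < lam < N (N the dimension), so the
   conversions by enn2real lose nothing in that range. *)
definition m_star :: "'a::euclidean_space itself \<Rightarrow> real \<Rightarrow> real" where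
  "m_star _ lam =
     (let N = real DIM('a); B = ball (0::'a) 1 in
       ((2 powr (1 / N) - 1) / (1 - 2 powr ((lam - N) / N)) *
        (enn2real (perimeter B) / enn2real (riesz_energy lam B))) powr (N / (N + 1 - lam))
       * measure lebesgue B)"

end

theory Submission
  imports Defs
begin

text \<open>If a minimizer \<open>\<Omega>\<close> is cut along a level set and the two parts are moved far apart, the energy cannot drop, so
  the interaction of the two parts is at most twice the area of the cut. Integrating this over all hyperplanes
  orthogonal to the coordinate axes bounds the integral of \<open>norm (x - y) powr (1 - lam)\<close> over \<open>\<Omega> \<times> \<Omega>\<close>
  by a constant multiple of \<open>m\<close>.
  Conversely, removing the part of \<open>\<Omega>\<close> in a thin spherical shell and restoring the mass by a dilation shows,
  with the isoperimetric inequality and the linear growth of the minimal energy, that each shell of bounded width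
  around a point of \<open>\<Omega>\<close> contains mass at least \<open>c\<close>, as long as there is mass outside of it. As \<open>lam \<le> 2\<close>,
  the double integral is therefore at least \<open>c * m\<close> times a harmonic sum over the shells, whose number is unbounded
  in \<open>m\<close>.

  Areas of cuts are only ever used after integration over the level, so lower limits of mollified areas suffice.
  Averaging over spheres of directions is avoided by using the coordinate directions and
  \<open>norm z \<le> (\<Sum>b\<in>Basis. \<bar>z \<bullet> b\<bar>)\<close>.\<close>

section \<open>Lebesgue measure\<close>

text \<open>A minimizer is only known to be a measurable set, so neither boundary regularity nor
  connectedness is at hand; every cut is made with test fields, at levels found by averaging. A cut
  creates two faces, hence the recurring factor 2.

  The shell estimate works because the surgery is cheap: taking away a small mass v and dilating the
  rest back to mass m multiplies the energy by 1 + O(v/m), and as the energy is O(m) this costs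
  O(v). The isoperimetric inequality saves a multiple of v powr ((N - 1) / N), which is larger for
  small v, so the cut must have an area of that order. Read as a differential inequality for the
  mass of a growing slab, this forces mass c within bounded width. Such an inequality also has the
  solution 0; it is excluded by the other surgery, because an empty slab would allow a free cut
  between two parts with positive interaction.

  Only positivity of the constants matters, which is why crude exponents for dilations and a
  non-sharp isoperimetric constant are enough.\<close>

lemma sigma_finite_lebesgue: "sigma_finite_measure (lebesgue :: 'a::euclidean_space measure)"
proof
  show "\<exists>A::'a set set. countable A \<and> A \<subseteq> sets lebesgue \<and> \<Union> A = space lebesgue
      \<and> (\<forall>a\<in>A. emeasure lebesgue a \<noteq> \<infinity>)"
  proof (intro exI[of _ "range (\<lambda>n::nat. cball 0 (real n))"] conjI ballI)
    show "\<Union> (range (\<lambda>n::nat. cball 0 (real n))) = space (lebesgue :: 'a measure)"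
      by (auto simp: real_arch_simple)
  next
    fix a :: "'a set" assume "a \<in> range (\<lambda>n::nat. cball 0 (real n))"
    then show "emeasure lebesgue a \<noteq> \<infinity>"
      by (auto simp: emeasure_cball)
  qed auto
qed

lemma pair_sigma_finite_lebesgue:
  "pair_sigma_finite (lebesgue :: 'a::euclidean_space measure) (lebesgue :: 'b::euclidean_space measure)"
  by (simp add: pair_sigma_finite_def sigma_finite_lebesgue)

lemma borel_measurable_lebesgueI: "f \<in> borel_measurable borel \<Longrightarrow> f \<in> borel_measurable lebesgue"
  by (simp add: measurable_completion)

lemma ident_measurable_lebesgue [measurable]: "(\<lambda>x. x) \<in> lebesgue \<rightarrow>\<^sub>M borel"
  by (rule borel_measurable_lebesgueI) simp

text \<open>The general substitution rule has one factor per coordinate; equal factors collapse it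
  to a dilation followed by a translation.\<close>

lemma affine_eq:
  fixes a :: "'a::euclidean_space"
  shows "(\<lambda>x. a + (\<Sum>j\<in>Basis. (c * (x \<bullet> j)) *\<^sub>R j)) = (\<lambda>x. a + c *\<^sub>R x)"
  unfolding scaleR_scaleR[symmetric] scaleR_sum_right[symmetric]
  by (simp add: euclidean_representation)

lemma measurable_lebesgue_affine:
  fixes a :: "'a::euclidean_space"
  assumes "c \<noteq> 0"
  shows "(\<lambda>x. a + c *\<^sub>R x) \<in> lebesgue \<rightarrow>\<^sub>M lebesgue"
  using lebesgue_affine_measurable[of "\<lambda>_. c" a] assms by (simp add: affine_eq)

lemma lebesgue_affine:
  fixes a :: "'a::euclidean_space"
  assumes "c \<noteq> 0"
  shows "lebesgue = density (distr lebesgue lebesgue (\<lambda>x. a + c *\<^sub>R x)) (\<lambda>_. ennreal (\<bar>c\<bar> ^ DIM('a)))"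
  using lebesgue_affine_euclidean[of "\<lambda>_. c" a] assms by (simp add: affine_eq)

lemma nn_integral_lebesgue_affine:
  fixes a :: "'a::euclidean_space"
  assumes [measurable]: "f \<in> borel_measurable lebesgue" and c: "c > 0"
  shows "(\<integral>\<^sup>+x. f x \<partial>lebesgue) = ennreal (c ^ DIM('a)) * (\<integral>\<^sup>+x. f (a + c *\<^sub>R x) \<partial>lebesgue)"
proof -
  have c0: "c \<noteq> 0" using c by simp
  note [measurable] = measurable_lebesgue_affine[OF c0, of a]
  have "(\<integral>\<^sup>+x. f x \<partial>lebesgue) = (\<integral>\<^sup>+x. f x \<partial>density (distr lebesgue lebesgue (\<lambda>x. a + c *\<^sub>R x)) (\<lambda>_. ennreal (\<bar>c\<bar> ^ DIM('a))))"
    using lebesgue_affine[OF c0, of a] by simp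
  also have "\<dots> = \<integral>\<^sup>+x. ennreal (\<bar>c\<bar> ^ DIM('a)) * f x \<partial>distr lebesgue lebesgue (\<lambda>x. a + c *\<^sub>R x)"
    by (subst nn_integral_density) auto
  also have "\<dots> = \<integral>\<^sup>+x. ennreal (\<bar>c\<bar> ^ DIM('a)) * f (a + c *\<^sub>R x) \<partial>lebesgue"
    by (subst nn_integral_distr) auto
  also have "\<dots> = ennreal (c ^ DIM('a)) * (\<integral>\<^sup>+x. f (a + c *\<^sub>R x) \<partial>lebesgue)"
    using c by (subst nn_integral_cmult) auto
  finally show ?thesis .
qed

lemma integral_lebesgue_affine:
  fixes a :: "'a::euclidean_space" and f :: "'a \<Rightarrow> real"
  assumes [measurable]: "f \<in> borel_measurable lebesgue" and c: "c > 0"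
  shows "(\<integral>x. f x \<partial>lebesgue) = c ^ DIM('a) * (\<integral>x. f (a + c *\<^sub>R x) \<partial>lebesgue)"
proof -
  have c0: "c \<noteq> 0" using c by simp
  note [measurable] = measurable_lebesgue_affine[OF c0, of a]
  have "(\<integral>x. f x \<partial>lebesgue) = (\<integral>x. f x \<partial>density (distr lebesgue lebesgue (\<lambda>x. a + c *\<^sub>R x)) (\<lambda>_. ennreal (\<bar>c\<bar> ^ DIM('a))))"
    using lebesgue_affine[OF c0, of a] by simp
  also have "\<dots> = (\<integral>x. \<bar>c\<bar> ^ DIM('a) * f x \<partial>distr lebesgue lebesgue (\<lambda>x. a + c *\<^sub>R x))"
    by (subst integral_density) auto
  also have "\<dots> = (\<integral>x. \<bar>c\<bar> ^ DIM('a) * f (a + c *\<^sub>R x) \<partial>lebesgue)"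
    by (subst integral_distr) auto
  also have "\<dots> = c ^ DIM('a) * (\<integral>x. f (a + c *\<^sub>R x) \<partial>lebesgue)"
    using c by simp
  finally show ?thesis .
qed

lemma affine_image_eq_vimage:
  fixes a :: "'a::euclidean_space"
  assumes "c \<noteq> 0"
  shows "(\<lambda>x. a + c *\<^sub>R x) ` A = (\<lambda>x. - (1/c) *\<^sub>R a + (1/c) *\<^sub>R x) -` A"
proof (intro equalityI subsetI)
  fix y assume "y \<in> (\<lambda>x. - (1/c) *\<^sub>R a + (1/c) *\<^sub>R x) -` A"
  moreover have "y = a + c *\<^sub>R (- (1/c) *\<^sub>R a + (1/c) *\<^sub>R y)"
    using assms by (simp add: algebra_simps)
  ultimately show "y \<in> (\<lambda>x. a + c *\<^sub>R x) ` A" by blast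
qed (use assms in \<open>auto simp: algebra_simps\<close>)

lemma sets_lebesgue_affine_image:
  fixes a :: "'a::euclidean_space"
  assumes "A \<in> sets lebesgue" "c \<noteq> 0"
  shows "(\<lambda>x. a + c *\<^sub>R x) ` A \<in> sets lebesgue"
proof -
  have "(\<lambda>x. - (1/c) *\<^sub>R a + (1/c) *\<^sub>R x) -` A \<inter> space lebesgue \<in> sets lebesgue"
    by (rule measurable_sets[OF measurable_lebesgue_affine assms(1)]) (use assms in auto)
  then show ?thesis by (simp only: affine_image_eq_vimage[OF assms(2)] space_completion space_lborel space_borel Int_UNIV_right)
qed

lemma emeasure_lebesgue_affine_image:
  fixes a :: "'a::euclidean_space"
  assumes "c > 0"
  shows "emeasure lebesgue ((\<lambda>x. a + c *\<^sub>R x) ` A) = ennreal (c ^ DIM('a)) * emeasure lebesgue A"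
  using emeasure_lebesgue_affine[of c a A] assms by (simp add: add.commute)

lemma indicator_affine_image:
  fixes a :: "'a::euclidean_space"
  assumes "c \<noteq> 0"
  shows "indicator ((\<lambda>x. a + c *\<^sub>R x) ` A) (a + c *\<^sub>R x) = indicator A x"
  using assms by (auto simp: indicator_def)

section \<open>Continuously differentiable functions\<close>

text \<open>Continuity of the derivative is asked direction by direction. In finite dimension this
  agrees with continuity in operator norm (\<open>C1_blinfun\<close>), and it keeps the closure
  rules free of bundled linear maps.\<close>

definition C1 :: "('a::euclidean_space \<Rightarrow> 'b::euclidean_space) \<Rightarrow> bool" where
  "C1 f \<longleftrightarrow> (\<exists>f'. (\<forall>x. (f has_derivative f' x) (at x)) \<and> (\<forall>v. continuous_on UNIV (\<lambda>x. f' x v)))"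

lemma C1I:
  assumes "\<And>x. (f has_derivative f' x) (at x)" "\<And>v. continuous_on UNIV (\<lambda>x. f' x v)"
  shows "C1 f"
  using assms unfolding C1_def by blast

lemma C1E:
  assumes "C1 f"
  obtains f' where "\<And>x. (f has_derivative f' x) (at x)" "\<And>v. continuous_on UNIV (\<lambda>x. f' x v)"
  using assms unfolding C1_def by blast

lemma C1_blinfun:
  fixes f :: "'a::euclidean_space \<Rightarrow> 'b::euclidean_space"
  assumes "\<And>x. (f has_derivative f' x) (at x)" "\<And>v. continuous_on UNIV (\<lambda>x. f' x v)"
  shows "\<exists>F'. (\<forall>x. f' x = blinfun_apply (F' x)) \<and> continuous_on UNIV F'"
proof (intro exI[of _ "\<lambda>x. Blinfun (f' x)"] conjI allI)
  have bl: "bounded_linear (f' x)" for x using assms(1) has_derivative_bounded_linear by blast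
  then show "f' x = blinfun_apply (Blinfun (f' x))" for x by (simp add: bounded_linear_Blinfun_apply)
  show "continuous_on UNIV (\<lambda>x. Blinfun (f' x))"
    by (rule continuous_on_blinfun_componentwise) (simp add: bounded_linear_Blinfun_apply bl assms(2))
qed

lemma C1_has_derivative:
  assumes "C1 f" shows "\<exists>f'. \<forall>x. (f has_derivative f' x) (at x)"
  using assms unfolding C1_def by blast

lemma C1_continuous: "C1 f \<Longrightarrow> continuous_on S f"
  by (metis C1E continuous_at_imp_continuous_on has_derivative_continuous)

lemma C1_measurable: "C1 f \<Longrightarrow> f \<in> borel_measurable lebesgue"
  by (intro borel_measurable_lebesgueI borel_measurable_continuous_onI C1_continuous)

lemma C1_const [simp]: "C1 (\<lambda>x. c)"
  by (rule C1I[where f' = "\<lambda>x v. 0"]) (auto intro!: derivative_eq_intros)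

lemma C1_bounded_linear: "bounded_linear f \<Longrightarrow> C1 f"
  by (rule C1I[where f' = "\<lambda>x. f"]) (auto intro: bounded_linear_imp_has_derivative)

lemma C1_add: assumes "C1 f" "C1 g" shows "C1 (\<lambda>x. f x + g x)"
proof -
  obtain f' where f: "\<And>x. (f has_derivative f' x) (at x)" "\<And>v. continuous_on UNIV (\<lambda>x. f' x v)"
    using C1E[OF assms(1)] by blast
  obtain g' where g: "\<And>x. (g has_derivative g' x) (at x)" "\<And>v. continuous_on UNIV (\<lambda>x. g' x v)"
    using C1E[OF assms(2)] by blast
  show ?thesis
    by (rule C1I[where f' = "\<lambda>x v. f' x v + g' x v"]) (auto intro!: derivative_eq_intros continuous_intros f g)
qed

lemma C1_bilinear:
  assumes "bounded_bilinear pr" "C1 f" "C1 g"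
  shows "C1 (\<lambda>x. pr (f x) (g x))"
proof -
  obtain f' where f: "\<And>x. (f has_derivative f' x) (at x)" "\<And>v. continuous_on UNIV (\<lambda>x. f' x v)"
    using C1E[OF assms(2)] by blast
  obtain g' where g: "\<And>x. (g has_derivative g' x) (at x)" "\<And>v. continuous_on UNIV (\<lambda>x. g' x v)"
    using C1E[OF assms(3)] by blast
  show ?thesis
  proof (rule C1I[where f' = "\<lambda>x v. pr (f x) (g' x v) + pr (f' x v) (g x)"])
    show "((\<lambda>x. pr (f x) (g x)) has_derivative (\<lambda>v. pr (f x) (g' x v) + pr (f' x v) (g x))) (at x)" for x
      by (rule bounded_bilinear.FDERIV[OF assms(1) f(1) g(1)])
    show "continuous_on UNIV (\<lambda>x. pr (f x) (g' x v) + pr (f' x v) (g x))" for v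
      by (intro continuous_on_add bounded_bilinear.continuous_on[OF assms(1)] f g C1_continuous assms)
  qed
qed

lemmas C1_scaleR = C1_bilinear[OF bounded_bilinear_scaleR]
lemmas C1_mult = C1_bilinear[OF bounded_bilinear_mult]
lemmas C1_inner = C1_bilinear[OF bounded_bilinear_inner]

lemma C1_diff: assumes "C1 f" "C1 g" shows "C1 (\<lambda>x. f x - g x)"
  using C1_add[OF assms(1) C1_scaleR[OF C1_const[of "-1"] assms(2)]] by simp

lemma C1_sum: "(\<And>i. i \<in> I \<Longrightarrow> C1 (f i)) \<Longrightarrow> C1 (\<lambda>x. \<Sum>i\<in>I. f i x)"
  by (induction I rule: infinite_finite_induct) (auto intro: C1_add)

lemma C1_affine: "C1 (\<lambda>x. a + c *\<^sub>R x)"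
  by (intro C1_add C1_const C1_bounded_linear bounded_linear_scaleR_right)

lemma C1_compose: assumes "C1 f" "C1 g" shows "C1 (\<lambda>x. g (f x))"
proof -
  obtain f' where f: "\<And>x. (f has_derivative f' x) (at x)" "\<And>v. continuous_on UNIV (\<lambda>x. f' x v)"
    using C1E[OF assms(1)] by blast
  obtain g' where g: "\<And>x. (g has_derivative g' x) (at x)" "\<And>v. continuous_on UNIV (\<lambda>x. g' x v)"
    using C1E[OF assms(2)] by blast
  obtain G where G: "\<forall>x. g' x = blinfun_apply (G x)" "continuous_on UNIV G"
    using C1_blinfun[OF g] by blast
  show ?thesis
  proof (rule C1I[where f' = "\<lambda>x v. g' (f x) (f' x v)"])
    show "((\<lambda>x. g (f x)) has_derivative (\<lambda>v. g' (f x) (f' x v))) (at x)" for x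
      using has_derivative_compose[OF f(1) g(1)] .
    show "continuous_on UNIV (\<lambda>x. g' (f x) (f' x v))" for v
      using G(1) f(2) continuous_on_compose2[OF G(2) C1_continuous[OF assms(1)]]
      by (auto intro!: continuous_intros)
  qed
qed

lemma C1_real:
  assumes "\<And>x. (f has_real_derivative f' x) (at x)" "continuous_on UNIV f'"
  shows "C1 f"
  by (rule C1I[where f' = "\<lambda>x v. f' x * v"])
    (use assms in \<open>auto simp: has_field_derivative_def intro!: continuous_intros\<close>)

abbreviation supp :: "('a::topological_space \<Rightarrow> 'b::zero) \<Rightarrow> 'a set" where
  "supp f \<equiv> closure {x. f x \<noteq> 0}"

lemma C1_compact_support_iff:
  "F \<in> C1_compact_support \<longleftrightarrow> C1 F \<and> compact (supp F)"
proof
  assume F: "C1 F \<and> compact (supp F)"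
  then obtain f' where f: "\<And>x. (F has_derivative f' x) (at x)" "\<And>v. continuous_on UNIV (\<lambda>x. f' x v)"
    using C1E by blast
  obtain G where "\<forall>x. f' x = blinfun_apply (G x)" "continuous_on UNIV G"
    using C1_blinfun[OF f] by blast
  with F f show "F \<in> C1_compact_support" unfolding C1_compact_support_def by auto
next
  assume "F \<in> C1_compact_support"
  then obtain F' :: "'a \<Rightarrow> 'a \<Rightarrow>\<^sub>L 'a" where "\<forall>x. (F has_derivative blinfun_apply (F' x)) (at x)"
     "continuous_on UNIV F'" "compact (supp F)"
    unfolding C1_compact_support_def by blast
  then show "C1 F \<and> compact (supp F)"
    by (auto intro!: C1I[where f' = "\<lambda>x. blinfun_apply (F' x)"] continuous_intros)
qed

section \<open>Divergence of compactly supported fields\<close>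

lemma divergence_eq:
  assumes "(F has_derivative F') (at x)"
  shows "divergence F x = (\<Sum>b\<in>Basis. F' b \<bullet> b)"
  unfolding divergence_def frechet_derivative_at[OF assms, symmetric] ..

lemma divergence_continuous:
  assumes "C1 F" shows "continuous_on S (divergence F)"
proof -
  obtain F' where F: "\<And>x. (F has_derivative F' x) (at x)" "\<And>v. continuous_on UNIV (\<lambda>x. F' x v)"
    using C1E[OF assms] by blast
  have "continuous_on UNIV (\<lambda>x. \<Sum>b\<in>Basis. F' x b \<bullet> b)"
    by (intro continuous_intros F)
  moreover have "divergence F = (\<lambda>x. \<Sum>b\<in>Basis. F' x b \<bullet> b)"
    by (rule ext) (rule divergence_eq[OF F(1)])
  ultimately show ?thesis using continuous_on_subset by auto
qed

lemma zero_off_support: "x \<notin> supp F \<Longrightarrow> F x = 0"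
  using closure_subset[of "{x. F x \<noteq> 0}"] by blast

lemma has_derivative_zero_off_support:
  assumes "(F has_derivative F') (at x)" "x \<notin> supp F"
  shows "F' = (\<lambda>v. 0)"
proof -
  have "((\<lambda>x. 0) has_derivative (\<lambda>v. 0)) (at x)" by simp
  then have "(F has_derivative (\<lambda>v. 0)) (at x)"
    by (rule has_derivative_transform_within_open[of _ _ _ _ "- supp F"])
      (use assms(2) closure_subset[of "{x. F x \<noteq> 0}"] in auto)
  then show ?thesis using assms(1) has_derivative_unique by blast
qed

lemma integrable_compact_support:
  fixes f :: "'a::euclidean_space \<Rightarrow> 'b::euclidean_space"
  assumes "continuous_on UNIV f" "compact K" "\<And>x. x \<notin> K \<Longrightarrow> f x = 0"
  shows "integrable lebesgue f"
proof -
  have "integrable lborel (\<lambda>x. indicator K x *\<^sub>R f x)"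
    by (rule borel_integrable_compact) (use assms continuous_on_subset[OF assms(1)] in auto)
  moreover have "(\<lambda>x. indicator K x *\<^sub>R f x) = f" using assms(3) by (auto simp: indicator_def)
  ultimately have "integrable lborel f" by simp
  moreover have "f \<in> borel_measurable lborel" using assms(1) borel_measurable_continuous_onI by auto
  ultimately show ?thesis by (simp add: integrable_completion)
qed

lemma bounded_compact_support:
  fixes f :: "'a::euclidean_space \<Rightarrow> 'b::real_normed_vector"
  assumes "continuous_on UNIV f" "compact K" "\<And>x. x \<notin> K \<Longrightarrow> f x = 0"
  shows "\<exists>M>0. \<forall>x. norm (f x) \<le> M"
proof -
  have "compact (f ` K)" using assms compact_continuous_image continuous_on_subset by blast
  then obtain M where M: "M > 0" "\<forall>y\<in>f ` K. norm y \<le> M" using compact_imp_bounded bounded_pos by blast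
  have "norm (f x) \<le> M" for x by (cases "x \<in> K") (use M assms in auto)
  then show ?thesis using M by blast
qed

lemma divergence_compact_support:
  assumes "F \<in> C1_compact_support"
  shows "continuous_on UNIV (divergence F)" "\<And>x. x \<notin> supp F \<Longrightarrow> divergence F x = 0"
    "compact (supp F)" "integrable lebesgue (divergence F)"
proof -
  have F: "C1 F" "compact (supp F)" using assms C1_compact_support_iff by auto
  show 1: "continuous_on UNIV (divergence F)" using F by (intro divergence_continuous) 
  show 2: "divergence F x = 0" if "x \<notin> supp F" for x
  proof -
    obtain F' where F': "\<And>x. (F has_derivative F' x) (at x)" using C1_has_derivative[OF F(1)] by blast
    show ?thesis using has_derivative_zero_off_support[OF F' that] divergence_eq[OF F'] by simp
  qed
  show "compact (supp F)" by (rule F)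
  then show "integrable lebesgue (divergence F)"
    using integrable_compact_support[OF 1] 2 by blast
qed

lemma set_integrable_divergence:
  assumes "F \<in> C1_compact_support" "\<Omega> \<in> sets lebesgue"
  shows "set_integrable lebesgue \<Omega> (divergence F)"
  using divergence_compact_support(4)[OF assms(1)] assms(2)
  unfolding set_integrable_def by (intro integrable_mult_indicator) auto

lemma C1_compact_supportI:
  assumes "C1 F" "compact K" "\<And>x. x \<notin> K \<Longrightarrow> F x = 0"
  shows "F \<in> C1_compact_support"
proof -
  have "supp F \<subseteq> K"
    by (rule closure_minimal) (use assms compact_imp_closed in auto)
  then show ?thesis using assms C1_compact_support_iff by (metis closed_closure compact_Int_closed inf.absorb_iff2)
qed

lemma divergence_scaleR_left:
  assumes "(\<phi> has_derivative \<phi>') (at x)" "(F has_derivative F') (at x)"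
  shows "divergence (\<lambda>x. \<phi> x *\<^sub>R F x) x = \<phi> x * divergence F x + \<phi>' (F x)"
proof -
  have "((\<lambda>x. \<phi> x *\<^sub>R F x) has_derivative (\<lambda>v. \<phi> x *\<^sub>R F' v + \<phi>' v *\<^sub>R F x)) (at x)"
    by (rule has_derivative_scaleR[OF assms])
  then have "divergence (\<lambda>x. \<phi> x *\<^sub>R F x) x = (\<Sum>b\<in>Basis. (\<phi> x *\<^sub>R F' b + \<phi>' b *\<^sub>R F x) \<bullet> b)"
    by (rule divergence_eq)
  also have "\<dots> = \<phi> x * (\<Sum>b\<in>Basis. F' b \<bullet> b) + (\<Sum>b\<in>Basis. (F x \<bullet> b) * \<phi>' b)"
    by (simp add: inner_add_left sum.distrib sum_distrib_left mult.commute)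
  also have "(\<Sum>b\<in>Basis. (F x \<bullet> b) * \<phi>' b) = \<phi>' (\<Sum>b\<in>Basis. (F x \<bullet> b) *\<^sub>R b)"
    using has_derivative_linear[OF assms(1)] by (simp add: linear_sum linear_scale)
  also have "\<dots> = \<phi>' (F x)" by (simp add: euclidean_representation)
  finally show ?thesis using divergence_eq[OF assms(2)] by simp
qed

lemma divergence_add:
  assumes "(F has_derivative F') (at x)" "(G has_derivative G') (at x)"
  shows "divergence (\<lambda>x. F x + G x) x = divergence F x + divergence G x"
  using divergence_eq[OF has_derivative_add[OF assms]] divergence_eq[OF assms(1)] divergence_eq[OF assms(2)]
  by (simp add: inner_add_left sum.distrib)

section \<open>Perimeter\<close>

lemma perimeter_upper:
  assumes "F \<in> C1_compact_support" "\<And>x. norm (F x) \<le> 1"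
  shows "ennreal (LINT x:\<Omega>|lebesgue. divergence F x) \<le> perimeter \<Omega>"
  unfolding perimeter_def by (rule SUP_upper) (use assms in auto)

lemma perimeter_least:
  assumes "\<And>F. F \<in> C1_compact_support \<Longrightarrow> (\<And>x. norm (F x) \<le> 1) \<Longrightarrow> ennreal (LINT x:\<Omega>|lebesgue. divergence F x) \<le> c"
  shows "perimeter \<Omega> \<le> c"
  unfolding perimeter_def by (rule SUP_least) (use assms in auto)

lemma zero_C1_compact_support: "(\<lambda>x. 0) \<in> C1_compact_support"
  by (rule C1_compact_supportI[of _ "{}"]) auto

lemma divergence_zero: "divergence (\<lambda>x. 0) x = 0"
  by (subst divergence_eq[of _ "\<lambda>v. 0"]) auto

text \<open>Negative reals are truncated to 0, so the coercion is only subadditive when signs are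
  unknown. This is the inequality for splitting flux integrals of arbitrary sign.\<close>

lemma ennreal_add_le: "ennreal (a + b) \<le> ennreal a + ennreal b"
proof -
  have "ennreal (a + b) \<le> ennreal (max 0 a + max 0 b)" by (intro ennreal_leI) auto
  also have "\<dots> = ennreal (max 0 a) + ennreal (max 0 b)" by (intro ennreal_plus) auto
  finally show ?thesis by (simp add: max_def ennreal_neg split: if_splits)
qed

text \<open>Each field admissible for the union is admissible for both pieces. The pieces may touch;
  common boundary is then counted twice on the right.\<close>

lemma perimeter_Un_disjoint:
  assumes "A \<in> sets lebesgue" "B \<in> sets lebesgue" "A \<inter> B = {}"
  shows "perimeter (A \<union> B) \<le> perimeter A + perimeter B"
proof (rule perimeter_least)
  fix F :: "'a \<Rightarrow> 'a" assume F: "F \<in> C1_compact_support" "\<And>x. norm (F x) \<le> 1"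
  let ?i = "\<lambda>A. LINT x:A|lebesgue. divergence F x"
  have "ennreal (?i (A \<union> B))
      = ennreal ((?i A) + (?i B))"
    by (subst set_integral_Un) (use assms set_integrable_divergence F in auto)
  also have "\<dots> \<le> ennreal (?i A) + ennreal (?i B)"
    by (rule ennreal_add_le)
  also have "\<dots> \<le> perimeter A + perimeter B"
    by (intro add_mono perimeter_upper F)
  finally show "ennreal (?i (A \<union> B)) \<le> perimeter A + perimeter B" .
qed

text \<open>Pulling a field back along the dilation multiplies its divergence by \<open>c\<close>,
  so the sharp factor is c to the power N - 1. For c \<ge> 1 it is rounded up to the volume
  factor.\<close>

lemma perimeter_affine_image:
  fixes a :: "'a::euclidean_space"
  assumes A: "A \<in> sets lebesgue" and c: "c \<ge> 1"
  shows "perimeter ((\<lambda>x. a + c *\<^sub>R x) ` A) \<le> ennreal (c ^ DIM('a)) * perimeter A"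
proof (rule perimeter_least)
  fix F :: "'a \<Rightarrow> 'a" assume F: "F \<in> C1_compact_support" "\<And>x. norm (F x) \<le> 1"
  let ?T = "\<lambda>x. a + c *\<^sub>R x"
  define G where "G = (\<lambda>x. F (?T x))"
  have c0: "c > 0" using c by simp
  have C1F: "C1 F" using F C1_compact_support_iff by auto
  obtain F' where F': "\<And>x. (F has_derivative F' x) (at x)" using C1_has_derivative[OF C1F] by blast
  have G': "(G has_derivative (\<lambda>v. F' (?T x) (c *\<^sub>R v))) (at x)" for x
    unfolding G_def
    by (rule has_derivative_compose[OF _ F', where f = "?T"]) (auto intro!: derivative_eq_intros)
  have lin: "F' y (c *\<^sub>R v) = c *\<^sub>R F' y v" for y v
    using has_derivative_linear[OF F'] linear_scale by blast
  have divG: "divergence G x = c * divergence F (?T x)" for x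
    unfolding divergence_eq[OF G'] divergence_eq[OF F'] lin by (simp add: sum_distrib_left)
  let ?K = "supp F"
  have "G \<in> C1_compact_support"
  proof (rule C1_compact_supportI)
    show "C1 G" unfolding G_def by (rule C1_compose[OF C1_affine C1F])
    show "compact ((\<lambda>y. - (1/c) *\<^sub>R a + (1/c) *\<^sub>R y) ` ?K)"
      by (rule compact_continuous_image[OF _ divergence_compact_support(3)[OF F(1)]]) (auto intro!: continuous_intros)
    fix x assume x: "x \<notin> (\<lambda>y. - (1/c) *\<^sub>R a + (1/c) *\<^sub>R y) ` ?K"
    have "x = - (1/c) *\<^sub>R a + (1/c) *\<^sub>R (?T x)" using c0 by (simp add: algebra_simps)
    with x have "?T x \<notin> ?K" by blast
    then show "G x = 0" using closure_subset[of "{x. F x \<noteq> 0}"] unfolding G_def by auto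
  qed
  moreover have "norm (G x) \<le> 1" for x unfolding G_def by (rule F)
  ultimately have G: "ennreal (LINT x:A|lebesgue. divergence G x) \<le> perimeter A"
    by (rule perimeter_upper)
  have [measurable]: "?T ` A \<in> sets lebesgue"
    by (rule sets_lebesgue_affine_image[OF A]) (use c0 in auto)
  have [measurable]: "divergence F \<in> borel_measurable lebesgue"
    using divergence_compact_support(4)[OF F(1)] by auto
  have "(LINT x:?T ` A|lebesgue. divergence F x)
     = c ^ DIM('a) * (\<integral>x. indicator (?T ` A) (?T x) *\<^sub>R divergence F (?T x) \<partial>lebesgue)"
    unfolding set_lebesgue_integral_def
    by (rule integral_lebesgue_affine) (use c0 in auto)
  also have "\<dots> = c ^ DIM('a) * (1/c) * (LINT x:A|lebesgue. divergence G x)"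
    using c0 by (simp add: indicator_affine_image set_lebesgue_integral_def divG flip: Bochner_Integration.integral_mult_right_zero)
  finally have eq: "(LINT x:?T ` A|lebesgue. divergence F x) = c ^ DIM('a) * (1/c) * (LINT x:A|lebesgue. divergence G x)" .
  have "ennreal (LINT x:?T ` A|lebesgue. divergence F x) \<le> ennreal (c ^ DIM('a)) * ennreal (LINT x:A|lebesgue. divergence G x)"
  \<comment> \<open>Dropping 1/c enlarges the right-hand side only if the integral is nonnegative;
    otherwise the left-hand side is truncated to 0.\<close>
  proof (cases "(LINT x:A|lebesgue. divergence G x) \<ge> 0")
    case True
    have "c ^ DIM('a) * (1/c) * (LINT x:A|lebesgue. divergence G x) \<le> c ^ DIM('a) * 1 * (LINT x:A|lebesgue. divergence G x)"
      by (intro mult_right_mono mult_left_mono) (use True c in auto)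
    then show ?thesis unfolding eq using True c0 by (simp add: ennreal_leI flip: ennreal_mult)
  next
    case False
    then have "c ^ DIM('a) * (1/c) * (LINT x:A|lebesgue. divergence G x) \<le> 0"
      by (intro mult_nonneg_nonpos) (use c0 in auto)
    then show ?thesis unfolding eq by (simp add: ennreal_neg)
  qed
  also have "\<dots> \<le> ennreal (c ^ DIM('a)) * perimeter A" by (intro mult_left_mono G) auto
  finally show "ennreal (LINT x:?T ` A|lebesgue. divergence F x) \<le> ennreal (c ^ DIM('a)) * perimeter A" .
qed

section \<open>Cutting a set along a level\<close>

text \<open>The hat over [0, 1] with peak 2 at 1/2, hence of unit area. Its rescalings are
  mollifiers supported on one side of 0.\<close>

definition tent :: "real \<Rightarrow> real" where
  "tent s = 4 * (max 0 s - 2 * max 0 (s - 1/2) + max 0 (s - 1))"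

text \<open>The antiderivative of \<open>tent\<close>: a cutoff from 0 to 1. Squares of positive
  parts are continuously differentiable, which is all the smoothness test fields require.\<close>

definition smooth_step :: "real \<Rightarrow> real" where
  "smooth_step s = 2 * ((max 0 s)^2 - 2 * (max 0 (s - 1/2))^2 + (max 0 (s - 1))^2)"

lemma max0_square_derivative: "((\<lambda>s::real. (max 0 s)^2) has_real_derivative 2 * max 0 s) (at s)"
proof -
  consider "s > 0" | "s < 0" | "s = 0" by linarith
  then show ?thesis
  proof cases
    case 1
    have "((\<lambda>s::real. s^2) has_real_derivative 2 * max 0 s) (at s)"
      using 1 by (auto intro!: derivative_eq_intros)
    then show ?thesis
      by (rule has_field_derivative_transform_within_open[of _ _ _ "{0<..}"]) (use 1 in auto)
  next
    case 2
    have "((\<lambda>s::real. 0) has_real_derivative 2 * max 0 s) (at s)"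
      using 2 by (auto intro!: derivative_eq_intros)
    then show ?thesis
      by (rule has_field_derivative_transform_within_open[of _ _ _ "{..<0}"]) (use 2 in auto)
  next
    case 3
    have "((\<lambda>h::real. (max 0 h)^2 / h) \<longlongrightarrow> 0) (at 0)"
    proof (rule Lim_null_comparison)
      show "\<forall>\<^sub>F h in at 0. norm ((max 0 h)^2 / h) \<le> \<bar>h::real\<bar>"
        by (intro always_eventually) (auto simp: max_def power2_eq_square)
      show "((\<lambda>h::real. \<bar>h\<bar>) \<longlongrightarrow> 0) (at 0)" by (rule tendsto_eq_intros | simp)+
    qed
    then show ?thesis using 3 by (simp add: DERIV_def)
  qed
qed

lemma smooth_step_derivative: "(smooth_step has_real_derivative tent s) (at s)"
proof -
  have *: "((\<lambda>s::real. (max 0 (s - c))^2) has_real_derivative 2 * max 0 (s - c)) (at s)" for c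
  proof -
    have "((\<lambda>s. s - c) has_real_derivative 1) (at s)" by (auto intro!: derivative_eq_intros)
    from DERIV_chain2[OF max0_square_derivative this] show ?thesis by simp
  qed
  show ?thesis
    unfolding smooth_step_def[abs_def] tent_def
    by (rule derivative_eq_intros * max0_square_derivative refl | simp)+
qed

lemma tent_nonneg: "tent s \<ge> 0" by (auto simp: tent_def max_def)
lemma tent_eq_0: "s \<le> 0 \<or> s \<ge> 1 \<Longrightarrow> tent s = 0" by (auto simp: tent_def max_def)
lemma smooth_step_eq_0: "s \<le> 0 \<Longrightarrow> smooth_step s = 0" by (auto simp: smooth_step_def max_def)
lemma smooth_step_eq_1: "s \<ge> 1 \<Longrightarrow> smooth_step s = 1"
  by (auto simp: smooth_step_def max_def power2_eq_square algebra_simps)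

lemma smooth_step_mono: "s \<le> t \<Longrightarrow> smooth_step s \<le> smooth_step t"
  using DERIV_nonneg_imp_nondecreasing smooth_step_derivative tent_nonneg by blast

lemma smooth_step_bounds: "0 \<le> smooth_step s" "smooth_step s \<le> 1"
proof -
  show "0 \<le> smooth_step s"
    using smooth_step_mono[of "min s 0" s] smooth_step_eq_0[of "min s 0"] by simp
  show "smooth_step s \<le> 1"
    using smooth_step_mono[of s "max s 1"] smooth_step_eq_1[of "max s 1"] by simp
qed

lemma tent_continuous: "continuous_on UNIV tent"
  unfolding tent_def[abs_def] by (intro continuous_intros)

lemma tent_measurable [measurable]: "tent \<in> borel_measurable borel"
  by (rule borel_measurable_continuous_onI[OF tent_continuous])

lemma nn_integral_tent: "(\<integral>\<^sup>+s. ennreal (tent s) \<partial>lborel) = 1"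
proof -
  have "(\<integral>\<^sup>+s. ennreal (tent s) \<partial>lborel) = (\<integral>\<^sup>+s. ennreal (tent s) * indicator {0..1} s \<partial>lborel)"
    by (intro nn_integral_cong) (auto simp: indicator_def tent_eq_0)
  also have "\<dots> = ennreal (smooth_step 1 - smooth_step 0)"
    by (intro nn_integral_FTC_Icc) (auto simp: tent_nonneg smooth_step_derivative has_real_derivative_iff_has_vector_derivative[symmetric] intro: DERIV_subset)
  finally show ?thesis by (simp add: smooth_step_eq_0 smooth_step_eq_1)
qed

text \<open>By the coarea formula, integrating a mollifier of \<open>k - l\<close> weights the area
  of the level set with the inverse of the length of the gradient of \<open>k\<close>. Slope at most
  1 thus makes such integrals bound the area from above.\<close>

definition C1_contraction :: "('a::euclidean_space \<Rightarrow> real) \<Rightarrow> bool" where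
  "C1_contraction k \<longleftrightarrow> (\<exists>k'. (\<forall>x. (k has_derivative k' x) (at x)) \<and>
     (\<forall>v. continuous_on UNIV (\<lambda>x. k' x v)) \<and> (\<forall>x v. \<bar>k' x v\<bar> \<le> norm v))"

lemma C1_contraction_C1: "C1_contraction k \<Longrightarrow> C1 k"
  unfolding C1_contraction_def C1_def by blast

lemma C1_contraction_measurable: "C1_contraction k \<Longrightarrow> k \<in> borel_measurable lebesgue"
  by (intro C1_measurable C1_contraction_C1)

text \<open>A generalised lower area of the slice of \<open>\<Omega>\<close> by the level set \<open>k = l\<close>, counted twice. The approximate
  delta functions are supported in \<open>s > 0\<close>, so that \<open>k = l\<close> belongs to the lower part.\<close>

abbreviation delta_approx :: "nat \<Rightarrow> real \<Rightarrow> ennreal" where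
  "delta_approx n s \<equiv> ennreal (2 * (real (Suc n) * tent (real (Suc n) * s)))"

definition slice_approx :: "('a::euclidean_space \<Rightarrow> real) \<Rightarrow> 'a set \<Rightarrow> nat \<Rightarrow> real \<Rightarrow> ennreal" where
  "slice_approx k \<Omega> n l =
     (\<integral>\<^sup>+x\<in>\<Omega>. delta_approx n (k x - l) \<partial>lebesgue)"

definition slice_area :: "('a::euclidean_space \<Rightarrow> real) \<Rightarrow> 'a set \<Rightarrow> real \<Rightarrow> ennreal" where
  "slice_area k \<Omega> l = liminf (\<lambda>n. slice_approx k \<Omega> n l)"

lemma sets_lebesgue_le:
  assumes "\<Omega> \<in> sets lebesgue" "k \<in> borel_measurable lebesgue"
  shows "{x\<in>\<Omega>. k x \<le> (l::real)} \<in> sets lebesgue" "{x\<in>\<Omega>. l < k x} \<in> sets lebesgue"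
proof -
  note [measurable] = assms
  have "{x \<in> space lebesgue. x \<in> \<Omega> \<and> k x \<le> l} \<in> sets lebesgue" by measurable
  then show "{x\<in>\<Omega>. k x \<le> l} \<in> sets lebesgue" by simp
  have "{x \<in> space lebesgue. x \<in> \<Omega> \<and> l < k x} \<in> sets lebesgue" by measurable
  then show "{x\<in>\<Omega>. l < k x} \<in> sets lebesgue" by simp
qed

text \<open>Fields \<open>F\<close> and \<open>G\<close> for the two parts are glued to
  \<open>H n\<close>, which is admissible for all of \<Omega>. Its divergence differs from the glued
  divergences by \<open>d n x * k' x (G x - F x)\<close>, at most \<open>2 * d n x\<close> because
  both fields have length at most 1 and \<open>k\<close> has slope at most 1. In the limit this
  error becomes the slice area.\<close>

lemma split_test_fields:
  fixes k :: "'a::euclidean_space \<Rightarrow> real"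
  assumes \<Omega>[measurable]: "\<Omega> \<in> sets lebesgue" and k: "C1_contraction k"
    and F: "F \<in> C1_compact_support" "\<And>x. norm (F x) \<le> 1"
    and G: "G \<in> C1_compact_support" "\<And>x. norm (G x) \<le> 1"
  shows "ennreal ((LINT x:{x\<in>\<Omega>. k x \<le> l}|lebesgue. divergence F x) + (LINT x:{x\<in>\<Omega>. l < k x}|lebesgue. divergence G x))
     \<le> perimeter \<Omega> + slice_area k \<Omega> l"
proof (cases "perimeter \<Omega> = \<infinity>")
  case False
  then obtain p where p: "perimeter \<Omega> = ennreal p" "p \<ge> 0" by (cases "perimeter \<Omega>") auto
  let ?A = "{x\<in>\<Omega>. k x \<le> l}" and ?B = "{x\<in>\<Omega>. l < k x}"
  have km[measurable]: "k \<in> borel_measurable lebesgue" by (rule C1_contraction_measurable[OF k])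
  obtain k' where k': "\<And>x. (k has_derivative k' x) (at x)" "\<And>v. continuous_on UNIV (\<lambda>x. k' x v)"
      "\<And>x v. \<bar>k' x v\<bar> \<le> norm v"
    using k unfolding C1_contraction_def by blast
  have C1F: "C1 F" "C1 G" using F G C1_compact_support_iff by auto
  obtain F' where F': "\<And>x. (F has_derivative F' x) (at x)" using C1_has_derivative[OF C1F(1)] by blast
  obtain G' where G': "\<And>x. (G has_derivative G' x) (at x)" using C1_has_derivative[OF C1F(2)] by blast
  define \<phi> where "\<phi> n x = smooth_step (real (Suc n) * (k x - l))" for n x
  define d where "d n x = real (Suc n) * tent (real (Suc n) * (k x - l))" for n x
  have d0: "d n x \<ge> 0" for n x unfolding d_def by (simp add: tent_nonneg)
  have \<phi>': "(\<phi> n has_derivative (\<lambda>v. d n x * k' x v)) (at x)" for n x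
  proof -
    have "((\<lambda>x. real (Suc n) * (k x - l)) has_derivative (\<lambda>v. real (Suc n) * k' x v)) (at x)"
      by (auto intro!: derivative_eq_intros k')
    from has_derivative_compose[OF this smooth_step_derivative[unfolded has_field_derivative_def]]
    show ?thesis unfolding \<phi>_def d_def by (simp add: mult.assoc mult.left_commute)
  qed
  have \<phi>C1: "C1 (\<phi> n)" for n
  proof -
    have "C1 (\<lambda>x. real (Suc n) * (k x - l))"
      by (rule C1_mult[OF C1_const C1_diff[OF C1_contraction_C1[OF k] C1_const]])
    from C1_compose[OF this C1_real[OF smooth_step_derivative tent_continuous]]
    show ?thesis unfolding \<phi>_def .
  qed
  define H where "H n x = (1 - \<phi> n x) *\<^sub>R F x + \<phi> n x *\<^sub>R G x" for n x
  define q where "q n x = (1 - \<phi> n x) * divergence F x + \<phi> n x * divergence G x" for n x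
  have divH: "divergence (H n) x = q n x + d n x * k' x (G x - F x)" for n x
  proof -
    have 1: "((\<lambda>x. 1 - \<phi> n x) has_derivative (\<lambda>v. - (d n x * k' x v))) (at x)"
      by (auto intro!: derivative_eq_intros \<phi>')
    have "divergence (H n) x = divergence (\<lambda>x. (1 - \<phi> n x) *\<^sub>R F x) x + divergence (\<lambda>x. \<phi> n x *\<^sub>R G x) x"
      unfolding H_def by (rule divergence_add[OF has_derivative_scaleR[OF 1 F'] has_derivative_scaleR[OF \<phi>' G']])
    also have "\<dots> = q n x + (d n x * k' x (G x) - d n x * k' x (F x))"
      unfolding divergence_scaleR_left[OF 1 F'] divergence_scaleR_left[OF \<phi>' G'] q_def by simp
    also have "k' x (G x - F x) = k' x (G x) - k' x (F x)"
      using has_derivative_linear[OF k'(1)] linear_diff by blast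
    then have "d n x * k' x (G x) - d n x * k' x (F x) = d n x * k' x (G x - F x)"
      by (simp only: right_diff_distrib)
    finally show ?thesis .
  qed
  have H: "H n \<in> C1_compact_support" for n
  proof (rule C1_compact_supportI)
    show "C1 (H n)" unfolding H_def by (intro C1_add C1_scaleR C1_diff C1_const \<phi>C1 C1F)
    show "compact (supp F \<union> supp G)"
      by (intro compact_Un divergence_compact_support(3) F G)
    show "H n x = 0" if "x \<notin> supp F \<union> supp G" for x
      using that zero_off_support[of x F] zero_off_support[of x G] unfolding H_def by simp
  qed
  have Hn: "norm (H n x) \<le> 1" for n x
  proof -
    have \<phi>b: "0 \<le> \<phi> n x" "\<phi> n x \<le> 1" unfolding \<phi>_def by (rule smooth_step_bounds)+
    have "norm (H n x) \<le> (1 - \<phi> n x) * norm (F x) + \<phi> n x * norm (G x)"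
      unfolding H_def by (rule norm_triangle_le) (use \<phi>b in simp)
    also have "\<dots> \<le> (1 - \<phi> n x) * 1 + \<phi> n x * 1"
      by (intro add_mono mult_left_mono F G) (use \<phi>b in auto)
    finally show ?thesis by simp
  qed
  have [measurable]: "\<phi> n \<in> borel_measurable lebesgue" for n by (rule C1_measurable[OF \<phi>C1])
  have iF: "integrable lebesgue (divergence F)" "integrable lebesgue (divergence G)"
    using F G divergence_compact_support(4) by auto
  then have [measurable]: "divergence F \<in> borel_measurable lebesgue" "divergence G \<in> borel_measurable lebesgue"
    by auto
  have [measurable]: "q n \<in> borel_measurable lebesgue" for n
    unfolding q_def by measurable
  have qb: "norm (q n x) \<le> \<bar>divergence F x\<bar> + \<bar>divergence G x\<bar>" for n x
  proof -
    have \<phi>b: "0 \<le> \<phi> n x" "\<phi> n x \<le> 1" unfolding \<phi>_def by (rule smooth_step_bounds)+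
    have "norm (q n x) \<le> (1 - \<phi> n x) * \<bar>divergence F x\<bar> + \<phi> n x * \<bar>divergence G x\<bar>"
      unfolding q_def using \<phi>b by (simp add: abs_triangle_ineq[THEN order_trans] abs_mult)
    also have "\<dots> \<le> 1 * \<bar>divergence F x\<bar> + 1 * \<bar>divergence G x\<bar>"
      by (intro add_mono mult_right_mono) (use \<phi>b in auto)
    finally show ?thesis by simp
  qed
  let ?w = "\<lambda>x. \<bar>divergence F x\<bar> + \<bar>divergence G x\<bar>"
  have iw: "integrable lebesgue ?w" using iF by auto
  have iq: "set_integrable lebesgue \<Omega> (q n)" for n
    unfolding set_integrable_def
    by (rule Bochner_Integration.integrable_bound[OF iw]) (use qb in \<open>auto simp: indicator_def\<close>)
  define L where "L = (LINT x:?A|lebesgue. divergence F x) + (LINT x:?B|lebesgue. divergence G x)"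
  have AB[measurable]: "?A \<in> sets lebesgue" "?B \<in> sets lebesgue" using sets_lebesgue_le[OF \<Omega> km] by auto
  let ?q = "\<lambda>n. LINT x:\<Omega>|lebesgue. q n x"
  \<comment> \<open>The cutoffs \<open>\<phi> n\<close> tend pointwise to the indicator of
    \<open>l < k x\<close>: they vanish on \<open>k x \<le> l\<close> for every \<open>n\<close> and
    are eventually 1 at each other point.\<close>
  have lim: "?q \<longlonglongrightarrow> L"
  proof -
    let ?g = "\<lambda>x. indicator ?A x *\<^sub>R divergence F x + indicator ?B x *\<^sub>R divergence G x"
    have "(\<lambda>n. \<integral>x. indicator \<Omega> x *\<^sub>R q n x \<partial>lebesgue) \<longlonglongrightarrow> (\<integral>x. ?g x \<partial>lebesgue)"
    proof (rule integral_dominated_convergence[where w = ?w])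
      show "integrable lebesgue ?w" by (rule iw)
      show "AE x in lebesgue. (\<lambda>n. indicator \<Omega> x *\<^sub>R q n x) \<longlonglongrightarrow> ?g x"
      proof (rule AE_I2)
        fix x
        consider "x \<notin> \<Omega>" | "x \<in> \<Omega>" "k x \<le> l" | "x \<in> \<Omega>" "k x > l" by linarith
        then show "(\<lambda>n. indicator \<Omega> x *\<^sub>R q n x) \<longlonglongrightarrow> ?g x"
        proof cases
          case 2
          then have "\<phi> n x = 0" for n unfolding \<phi>_def by (intro smooth_step_eq_0) (simp add: mult_nonneg_nonpos)
          then show ?thesis using 2 by (simp add: q_def)
        next
          case 3
          obtain N where N: "1 / (k x - l) < real N" using reals_Archimedean2 by blast
          have "\<phi> n x = 1" if "n \<ge> N" for n
            unfolding \<phi>_def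
          proof (rule smooth_step_eq_1)
            have "1 / (k x - l) \<le> real (Suc n)" using N that by linarith
            then show "1 \<le> real (Suc n) * (k x - l)" using 3 by (simp add: field_simps)
          qed
          then have "\<forall>\<^sub>F n in sequentially. indicator \<Omega> x *\<^sub>R q n x = ?g x"
            using 3 by (auto simp: q_def eventually_sequentially intro!: exI[of _ N])
          then show ?thesis by (rule tendsto_eventually)
        qed simp
      qed
      show "AE x in lebesgue. norm (indicator \<Omega> x *\<^sub>R q n x) \<le> ?w x" for n
        using qb by (auto simp: indicator_def)
    qed auto
    moreover have "(\<integral>x. ?g x \<partial>lebesgue) = L"
      unfolding L_def set_lebesgue_integral_def
      by (rule Bochner_Integration.integral_add)
        (use set_integrable_divergence[OF F(1) AB(1)] set_integrable_divergence[OF G(1) AB(2)] in \<open>auto simp: set_integrable_def\<close>)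
    ultimately show ?thesis unfolding set_lebesgue_integral_def by simp
  qed
  have bound: "ennreal (?q n - p) \<le> slice_approx k \<Omega> n l" for n
  proof -
    define r where "r x = divergence (H n) x - q n x" for x
    have iH: "set_integrable lebesgue \<Omega> (divergence (H n))" by (rule set_integrable_divergence[OF H \<Omega>])
    have ir: "set_integrable lebesgue \<Omega> r" unfolding r_def by (intro set_integral_diff iH iq)
    have "ennreal (LINT x:\<Omega>|lebesgue. divergence (H n) x) \<le> ennreal p"
      using perimeter_upper[OF H Hn, of \<Omega>] p by simp
    then have "(LINT x:\<Omega>|lebesgue. divergence (H n) x) \<le> p" using p(2) by (simp add: ennreal_le_iff)
    moreover have "(LINT x:\<Omega>|lebesgue. r x) = (LINT x:\<Omega>|lebesgue. divergence (H n) x) - ?q n"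
      unfolding r_def by (intro set_integral_diff iH iq)
    ultimately have "?q n - p \<le> - (LINT x:\<Omega>|lebesgue. r x)" by linarith
    also have "\<dots> \<le> norm (LINT x:\<Omega>|lebesgue. r x)" by simp
    also have "\<dots> \<le> (\<integral>x. norm (indicator \<Omega> x *\<^sub>R r x) \<partial>lebesgue)"
      unfolding set_lebesgue_integral_def by (rule integral_norm_bound)
    finally have "ennreal (?q n - p) \<le> ennreal (\<integral>x. norm (indicator \<Omega> x *\<^sub>R r x) \<partial>lebesgue)"
      by (rule ennreal_leI)
    also have "\<dots> = (\<integral>\<^sup>+x. ennreal (norm (indicator \<Omega> x *\<^sub>R r x)) \<partial>lebesgue)"
      using ir unfolding set_integrable_def by (intro nn_integral_eq_integral[symmetric]) auto
    also have "\<dots> \<le> (\<integral>\<^sup>+x\<in>\<Omega>. ennreal (2 * d n x) \<partial>lebesgue)"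
    proof (rule nn_integral_mono)
      fix x
      have "\<bar>r x\<bar> = d n x * \<bar>k' x (G x - F x)\<bar>" unfolding r_def divH using d0 by (simp add: abs_mult)
      also have "\<dots> \<le> d n x * 2"
      proof (rule mult_left_mono[OF _ d0])
        have "\<bar>k' x (G x - F x)\<bar> \<le> norm (G x - F x)" by (rule k')
        also have "\<dots> \<le> norm (G x) + norm (F x)" by (rule norm_triangle_ineq4)
        finally show "\<bar>k' x (G x - F x)\<bar> \<le> 2" using F(2)[of x] G(2)[of x] by linarith
      qed
      finally show "ennreal (norm (indicator \<Omega> x *\<^sub>R r x)) \<le> ennreal (2 * d n x) * indicator \<Omega> x"
        by (auto simp: indicator_def mult.commute intro!: ennreal_leI)
    qed
    also have "\<dots> = slice_approx k \<Omega> n l" unfolding slice_approx_def d_def ..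
    finally show ?thesis .
  qed
  \<comment> \<open>The left-hand sides converge, so a lower limit on the other side suffices; no
    convergence of the mollified areas is needed.\<close>
  have "(\<lambda>n. ennreal (?q n - p)) \<longlonglongrightarrow> ennreal (L - p)"
    by (intro tendsto_intros lim)
  then have "ennreal (L - p) = liminf (\<lambda>n. ennreal (?q n - p))"
    by (intro lim_imp_Liminf[symmetric]) auto
  also have "\<dots> \<le> slice_area k \<Omega> l"
    unfolding slice_area_def by (intro Liminf_mono always_eventually allI bound)
  finally have "ennreal p + ennreal (L - p) \<le> perimeter \<Omega> + slice_area k \<Omega> l"
    unfolding p by (intro add_mono) auto
  moreover have "ennreal L \<le> ennreal p + ennreal (L - p)"
    using ennreal_add_le[of p "L - p"] by simp
  ultimately show ?thesis unfolding L_def by (rule order_trans[rotated])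
qed simp

lemma perimeter_split:
  fixes k :: "'a::euclidean_space \<Rightarrow> real"
  assumes \<Omega>: "\<Omega> \<in> sets lebesgue" and k: "C1_contraction k"
  shows "perimeter {x\<in>\<Omega>. k x \<le> l} + perimeter {x\<in>\<Omega>. l < k x} \<le> perimeter \<Omega> + slice_area k \<Omega> l"
proof -
  let ?X = "{F \<in> (C1_compact_support :: ('a \<Rightarrow> 'a) set). \<forall>x. norm (F x) \<le> 1}"
  let ?A = "{x\<in>\<Omega>. k x \<le> l}" and ?B = "{x\<in>\<Omega>. l < k x}"
  let ?i = "\<lambda>A F. LINT x:A|lebesgue. divergence F x"
  have ne: "?X \<noteq> {}" using zero_C1_compact_support by force
  \<comment> \<open>A field with negative integral is exchanged for the zero field. This turns a sum
    of two truncated integrals into the truncation of a single sum, to which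
    \<open>split_test_fields\<close> applies.\<close>
  have pos: "\<exists>F'\<in>?X. ?i A F' = max 0 (?i A F)" if "F \<in> ?X" for F A
  proof (cases "?i A F \<ge> 0")
    case False
    moreover have "?i A (\<lambda>x. 0) = 0" by (simp add: divergence_zero)
    ultimately show ?thesis using zero_C1_compact_support by (intro bexI[of _ "\<lambda>x. 0"]) auto
  qed (use that in auto)
  have *: "ennreal (?i ?A F) + ennreal (?i ?B G) \<le> perimeter \<Omega> + slice_area k \<Omega> l"
    if FG: "F \<in> ?X" "G \<in> ?X" for F G
  proof -
    obtain F' G' where F': "F' \<in> ?X" "?i ?A F' = max 0 (?i ?A F)" and G': "G' \<in> ?X" "?i ?B G' = max 0 (?i ?B G)"
      using pos[OF FG(1), of ?A] pos[OF FG(2), of ?B] by blast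
    have "ennreal (?i ?A F) + ennreal (?i ?B G) \<le> ennreal (?i ?A F') + ennreal (?i ?B G')"
      unfolding F' G' by (intro add_mono ennreal_leI) auto
    also have "\<dots> = ennreal (?i ?A F' + ?i ?B G')"
      by (rule ennreal_plus[symmetric]) (simp_all add: F' G')
    also have "\<dots> \<le> perimeter \<Omega> + slice_area k \<Omega> l"
      by (rule split_test_fields[OF \<Omega> k]) (use F' G' in auto)
    finally show ?thesis .
  qed
  have "perimeter ?A + perimeter ?B = (SUP F\<in>?X. ennreal (?i ?A F) + perimeter ?B)"
    unfolding perimeter_def[of ?A] by (rule ennreal_SUP_add_left[OF ne, symmetric])
  also have "\<dots> = (SUP F\<in>?X. SUP G\<in>?X. ennreal (?i ?A F) + ennreal (?i ?B G))"
    unfolding perimeter_def[of ?B] by (rule SUP_cong[OF refl]) (rule ennreal_SUP_add_right[OF ne])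
  also have "\<dots> \<le> perimeter \<Omega> + slice_area k \<Omega> l"
    by (intro SUP_least *)
  finally show ?thesis .
qed

section \<open>Integrating slice areas over the level\<close>

lemma slice_pair_measurable:
  assumes [measurable]: "k \<in> borel_measurable lebesgue" "\<Omega> \<in> sets lebesgue"
  shows "(\<lambda>(l, x). delta_approx n (k x - l) * indicator \<Omega> x)
     \<in> borel_measurable ((lborel :: real measure) \<Otimes>\<^sub>M lebesgue)"
  by measurable

lemma slice_approx_measurable:
  assumes "k \<in> borel_measurable lebesgue" "\<Omega> \<in> sets lebesgue"
  shows "slice_approx k \<Omega> n \<in> borel_measurable lborel"
proof -
  interpret sigma_finite_measure "lebesgue :: 'a measure" by (rule sigma_finite_lebesgue)
  show ?thesis
    unfolding slice_approx_def[abs_def]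
    by (rule borel_measurable_nn_integral[OF slice_pair_measurable[OF assms]])
qed

text \<open>Substituting \<open>s = Suc n * (c - l)\<close> reduces this to the area of
  \<open>tent\<close>. The mass is 2 because both faces of a cut are counted.\<close>

lemma nn_integral_approx_delta:
  fixes c :: real
  shows "(\<integral>\<^sup>+l. delta_approx n (c - l) \<partial>lborel) = 2"
proof -
  let ?N = "real (Suc n)"
  have "(\<integral>\<^sup>+l. ennreal (2 * (?N * tent (?N * (c - l)))) \<partial>lborel)
     = ennreal \<bar>- 1 / ?N\<bar> * (\<integral>\<^sup>+s. ennreal (2 * (?N * tent (?N * (c - (c + (- 1 / ?N) * s))))) \<partial>lborel)"
    by (rule nn_integral_real_affine) auto
  also have "(\<lambda>s. ennreal (2 * (?N * tent (?N * (c - (c + (- 1 / ?N) * s)))))) = (\<lambda>s. ennreal (2 * ?N) * ennreal (tent s))"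
    by (rule ext) (simp add: ennreal_mult[symmetric] tent_nonneg mult.assoc del: of_nat_Suc)
  also have "(\<integral>\<^sup>+s. ennreal (2 * ?N) * ennreal (tent s) \<partial>lborel) = ennreal (2 * ?N)"
    by (subst nn_integral_cmult) (auto simp: nn_integral_tent)
  also have "ennreal \<bar>- 1 / ?N\<bar> * ennreal (2 * ?N) = 2"
    by (simp add: ennreal_mult[symmetric] del: of_nat_Suc)
  finally show ?thesis .
qed

text \<open>A coarea inequality: Fatou moves the lower limit out of the integral, Tonelli exchanges
  level and point, and each point spends mass at most 2 over all levels. \<open>S\<close> collects
  the points that levels in \<open>T\<close> can see once the mollifiers are narrow.\<close>

lemma nn_integral_slice_area_le:
  fixes k :: "'a::euclidean_space \<Rightarrow> real"
  assumes k[measurable]: "k \<in> borel_measurable lebesgue" and \<Omega>[measurable]: "\<Omega> \<in> sets lebesgue"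
    and T[measurable]: "T \<in> sets borel" and S[measurable]: "S \<in> sets lebesgue"
    and TS: "\<forall>\<^sub>F n in sequentially. \<forall>x\<in>\<Omega>. \<forall>l\<in>T. tent (real (Suc n) * (k x - l)) \<noteq> 0 \<longrightarrow> x \<in> S"
  shows "(\<integral>\<^sup>+l\<in>T. slice_area k \<Omega> l \<partial>lborel) \<le> 2 * emeasure lebesgue (\<Omega> \<inter> S)"
proof -
  interpret pair_sigma_finite "lborel :: real measure" "lebesgue :: 'a measure"
    by (simp add: pair_sigma_finite_def sigma_finite_lebesgue lborel.sigma_finite_measure_axioms)
  let ?g = "\<lambda>n l x. delta_approx n (k x - l)"
  have "(\<integral>\<^sup>+l\<in>T. slice_area k \<Omega> l \<partial>lborel) \<le> (\<integral>\<^sup>+l. liminf (\<lambda>n. slice_approx k \<Omega> n l * indicator T l) \<partial>lborel)"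
    unfolding slice_area_def by (intro nn_integral_mono) (auto simp: indicator_def)
  also have "\<dots> \<le> liminf (\<lambda>n. \<integral>\<^sup>+l. slice_approx k \<Omega> n l * indicator T l \<partial>lborel)"
    by (rule nn_integral_liminf) (use slice_approx_measurable[OF k \<Omega>] in measurable)
  also have "\<dots> \<le> liminf (\<lambda>n. 2 * emeasure lebesgue (\<Omega> \<inter> S))"
  proof (rule Liminf_mono)
    show "\<forall>\<^sub>F n in sequentially. (\<integral>\<^sup>+l. slice_approx k \<Omega> n l * indicator T l \<partial>lborel) \<le> 2 * emeasure lebesgue (\<Omega> \<inter> S)"
      using TS
    proof eventually_elim
      case (elim n)
      have "(\<integral>\<^sup>+l. slice_approx k \<Omega> n l * indicator T l \<partial>lborel)
         = (\<integral>\<^sup>+l. \<integral>\<^sup>+x. ?g n l x * indicator \<Omega> x * indicator T l \<partial>lebesgue \<partial>lborel)"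
        unfolding slice_approx_def by (subst nn_integral_multc) auto
      also have "\<dots> = (\<integral>\<^sup>+x. \<integral>\<^sup>+l. ?g n l x * indicator \<Omega> x * indicator T l \<partial>lborel \<partial>lebesgue)"
        by (rule Fubini'[symmetric]) measurable
      also have "\<dots> \<le> (\<integral>\<^sup>+x. \<integral>\<^sup>+l. indicator (\<Omega> \<inter> S) x * ?g n l x \<partial>lborel \<partial>lebesgue)"
        by (intro nn_integral_mono) (use elim in \<open>auto simp: indicator_def\<close>)
      also have "\<dots> = (\<integral>\<^sup>+x. indicator (\<Omega> \<inter> S) x * 2 \<partial>lebesgue)"
        by (subst nn_integral_cmult) (auto simp: nn_integral_approx_delta simp del: of_nat_Suc)
      also have "\<dots> = 2 * emeasure lebesgue (\<Omega> \<inter> S)"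
        by (subst nn_integral_multc) (auto simp: mult.commute)
      finally show ?case .
    qed
  qed
  also have "\<dots> = 2 * emeasure lebesgue (\<Omega> \<inter> S)" by (simp add: Liminf_const)
  finally show ?thesis .
qed

lemma nn_integral_slice_area:
  fixes k :: "'a::euclidean_space \<Rightarrow> real"
  assumes k: "k \<in> borel_measurable lebesgue" and \<Omega>: "\<Omega> \<in> sets lebesgue"
  shows "(\<integral>\<^sup>+l. slice_area k \<Omega> l \<partial>lborel) \<le> 2 * emeasure lebesgue \<Omega>"
  using nn_integral_slice_area_le[OF k \<Omega>, of UNIV UNIV] by simp

text \<open>At level l the mollifier sees values of \<open>k\<close> strictly between l and l + 1/(n
  + 1). Hence the left end is strict, and an arbitrary slack c > b absorbs the overshoot at the
  right end.\<close>

lemma nn_integral_slice_area_interval: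
  fixes k :: "'a::euclidean_space \<Rightarrow> real"
  assumes k[measurable]: "k \<in> borel_measurable lebesgue" and \<Omega>: "\<Omega> \<in> sets lebesgue" and bc: "b < c"
  shows "(\<integral>\<^sup>+l\<in>{a..b}. slice_area k \<Omega> l \<partial>lborel) \<le> 2 * emeasure lebesgue {x\<in>\<Omega>. a < k x \<and> k x \<le> c}"
proof -
  let ?S = "{x. a < k x \<and> k x \<le> c}"
  have "{x\<in>space lebesgue. a < k x \<and> k x \<le> c} \<in> sets lebesgue" by measurable
  then have S: "?S \<in> sets lebesgue" by simp
  obtain N where N: "1 / (c - b) < real N" using reals_Archimedean2 by blast
  have "\<forall>x\<in>\<Omega>. \<forall>l\<in>{a..b}. tent (real (Suc n) * (k x - l)) \<noteq> 0 \<longrightarrow> x \<in> ?S" if "n \<ge> N" for n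
  proof (intro ballI impI)
    fix x l assume l: "l \<in> {a..b}" and t: "tent (real (Suc n) * (k x - l)) \<noteq> 0"
    have s: "0 < real (Suc n) * (k x - l)" "real (Suc n) * (k x - l) < 1"
      using t tent_eq_0 by (meson not_less)+
    then have 1: "k x > l" by (simp add: zero_less_mult_iff)
    have "1 / (c - b) < real (Suc n)" using N that by linarith
    then have "1 < real (Suc n) * (c - b)" using bc by (simp add: field_simps)
    then have "real (Suc n) * (k x - l) < real (Suc n) * (c - b)" using s by linarith
    then have "k x - l < c - b" by (simp add: mult_less_cancel_left)
    then show "x \<in> ?S" using 1 l by auto
  qed
  then have "\<forall>\<^sub>F n in sequentially. \<forall>x\<in>\<Omega>. \<forall>l\<in>{a..b}. tent (real (Suc n) * (k x - l)) \<noteq> 0 \<longrightarrow> x \<in> ?S"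
    by (auto simp: eventually_sequentially)
  from nn_integral_slice_area_le[OF k \<Omega> _ S this]
  have "(\<integral>\<^sup>+l\<in>{a..b}. slice_area k \<Omega> l \<partial>lborel) \<le> 2 * emeasure lebesgue (\<Omega> \<inter> ?S)" by simp
  also have "\<Omega> \<inter> ?S = {x\<in>\<Omega>. a < k x \<and> k x \<le> c}" by auto
  finally show ?thesis .
qed

text \<open>The mollifiers are one-sided, so a gap just above \<open>l\<close> suffices. This
  supplies the free cut that excludes empty slabs.\<close>

lemma slice_area_eq_0:
  fixes k :: "'a::euclidean_space \<Rightarrow> real"
  assumes s: "s > 0" and ae: "AE x in lebesgue. x \<in> \<Omega> \<longrightarrow> \<not> (l < k x \<and> k x < l + s)"
  shows "slice_area k \<Omega> l = 0"
proof -
  obtain N where N: "1 / s < real N" using reals_Archimedean2 by blast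
  have "slice_approx k \<Omega> n l = 0" if "n \<ge> N" for n
  proof -
    have *: "tent (real (Suc n) * (k x - l)) = 0" if x: "\<not> (l < k x \<and> k x < l + s)" for x
    proof (cases "k x \<le> l")
      case True
      then show ?thesis by (intro tent_eq_0) (simp add: mult_nonneg_nonpos)
    next
      case False
      then have "k x - l \<ge> s" using x by linarith
      moreover have "1 < real (Suc n) * s"
      proof -
        have "1 / s < real (Suc n)" using N \<open>n \<ge> N\<close> by linarith
        then show ?thesis using s by (simp add: field_simps)
      qed
      ultimately have "1 \<le> real (Suc n) * (k x - l)"
        using mult_left_mono[of s "k x - l" "real (Suc n)"] by linarith
      then show ?thesis by (intro tent_eq_0) simp
    qed
    have "slice_approx k \<Omega> n l = nn_integral lebesgue (\<lambda>x::'a. 0)"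
      unfolding slice_approx_def
    proof (rule nn_integral_cong_AE)
      show "AE x in lebesgue. delta_approx n (k x - l) * indicator \<Omega> x = 0"
        using ae by (rule eventually_mono) (auto simp: indicator_def * simp del: of_nat_Suc)
    qed
    then show ?thesis by simp
  qed
  then have "(\<lambda>n. slice_approx k \<Omega> n l) \<longlonglongrightarrow> 0"
    by (intro tendsto_eventually) (auto simp: eventually_sequentially)
  then show ?thesis unfolding slice_area_def by (rule lim_imp_Liminf[rotated]) simp
qed

section \<open>Interaction energy\<close>

definition potential :: "real \<Rightarrow> 'a::euclidean_space set \<Rightarrow> 'a \<Rightarrow> ennreal" where
  "potential lam B x = (\<integral>\<^sup>+y\<in>B. ennreal (1 / norm (x - y) powr lam) \<partial>lebesgue)"

definition interaction :: "real \<Rightarrow> 'a::euclidean_space set \<Rightarrow> 'a set \<Rightarrow> ennreal" where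
  "interaction lam A B = (\<integral>\<^sup>+x\<in>A. potential lam B x \<partial>lebesgue)"

lemma kernel_measurable [measurable]:
  "(\<lambda>y. ennreal (1 / norm (x - y) powr lam)) \<in> borel_measurable (lebesgue :: 'a::euclidean_space measure)"
  "(\<lambda>(x, y). ennreal (1 / norm (x - y) powr lam)) \<in> borel_measurable ((lebesgue :: 'a measure) \<Otimes>\<^sub>M lebesgue)"
  by measurable

lemma potential_measurable [measurable]:
  assumes [measurable]: "B \<in> sets lebesgue"
  shows "potential lam B \<in> borel_measurable lebesgue"
proof -
  interpret sigma_finite_measure "lebesgue :: 'a measure" by (rule sigma_finite_lebesgue)
  show ?thesis unfolding potential_def[abs_def] by measurable
qed

lemma potential_mono: "B \<subseteq> B' \<Longrightarrow> potential lam B x \<le> potential lam B' x"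
  unfolding potential_def by (intro nn_integral_mono) (auto simp: indicator_def)

lemma interaction_mono:
  assumes "A \<subseteq> A'" "B \<subseteq> B'"
  shows "interaction lam A B \<le> interaction lam A' B'"
  unfolding interaction_def
  by (intro nn_integral_mono mult_mono potential_mono assms) (use assms in \<open>auto simp: indicator_def\<close>)

lemma riesz_energy_eq:
  fixes \<Omega> :: "'a::euclidean_space set"
  assumes [measurable]: "\<Omega> \<in> sets lebesgue"
  shows "riesz_energy lam \<Omega> = interaction lam \<Omega> \<Omega> / 2"
proof -
  interpret sigma_finite_measure "lebesgue :: 'a measure" by (rule sigma_finite_lebesgue)
  let ?f = "\<lambda>z. ennreal (1 / norm (fst z - snd z) powr lam) * indicator (\<Omega> \<times> \<Omega>) z"
  have "(\<integral>\<^sup>+z. ?f z \<partial>(lebesgue \<Otimes>\<^sub>M lebesgue)) = (\<integral>\<^sup>+x. \<integral>\<^sup>+y. ?f (x, y) \<partial>lebesgue \<partial>(lebesgue :: 'a measure))"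
    by (rule nn_integral_fst[symmetric]) measurable
  also have "\<dots> = (\<integral>\<^sup>+x. \<integral>\<^sup>+y. ennreal (1 / norm (x - y) powr lam) * indicator \<Omega> y * indicator \<Omega> x \<partial>lebesgue \<partial>lebesgue)"
    by (intro nn_integral_cong) (auto simp: indicator_def)
  also have "\<dots> = interaction lam \<Omega> \<Omega>"
    unfolding interaction_def potential_def by (subst nn_integral_multc) auto
  finally show ?thesis unfolding riesz_energy_def by simp
qed

lemma riesz_energy_mono:
  assumes "A \<in> sets lebesgue" "B \<in> sets lebesgue" "A \<subseteq> B"
  shows "riesz_energy lam A \<le> riesz_energy lam B"
  using assms by (simp add: riesz_energy_eq interaction_mono divide_right_mono_ennreal)

lemma interaction_commute:
  fixes A :: "'a::euclidean_space set"
  assumes [measurable]: "A \<in> sets lebesgue" "B \<in> sets lebesgue"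
  shows "interaction lam A B = interaction lam B A"
proof -
  interpret pair_sigma_finite "lebesgue :: 'a measure" "lebesgue :: 'a measure" by (rule pair_sigma_finite_lebesgue)
  have "interaction lam A B = (\<integral>\<^sup>+x. \<integral>\<^sup>+y. ennreal (1 / norm (x - y) powr lam) * indicator B y * indicator A x \<partial>lebesgue \<partial>lebesgue)"
    unfolding interaction_def potential_def by (subst nn_integral_multc) auto
  also have "\<dots> = (\<integral>\<^sup>+y. \<integral>\<^sup>+x. ennreal (1 / norm (x - y) powr lam) * indicator B y * indicator A x \<partial>lebesgue \<partial>lebesgue)"
    by (rule Fubini'[symmetric]) measurable
  also have "\<dots> = (\<integral>\<^sup>+y. \<integral>\<^sup>+x. ennreal (1 / norm (y - x) powr lam) * indicator A x * indicator B y \<partial>lebesgue \<partial>lebesgue)"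
    by (intro nn_integral_cong) (simp add: norm_minus_commute ac_simps)
  also have "\<dots> = interaction lam B A"
    unfolding interaction_def potential_def by (subst nn_integral_multc) auto
  finally show ?thesis .
qed

lemma interaction_Un_left:
  fixes A :: "'a::euclidean_space set"
  assumes [measurable]: "A \<in> sets lebesgue" "B \<in> sets lebesgue" "C \<in> sets lebesgue" and AB: "A \<inter> B = {}"
  shows "interaction lam (A \<union> B) C = interaction lam A C + interaction lam B C"
proof -
  have "interaction lam (A \<union> B) C = (\<integral>\<^sup>+x. potential lam C x * indicator A x + potential lam C x * indicator B x \<partial>lebesgue)"
    unfolding interaction_def by (intro nn_integral_cong) (use AB in \<open>auto simp: indicator_def\<close>)
  also have "\<dots> = interaction lam A C + interaction lam B C"
    unfolding interaction_def by (rule nn_integral_add) measurable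
  finally show ?thesis .
qed

text \<open>The two cross terms agree by symmetry, which cancels the factor 1/2 in the energy;
  \<open>interaction\<close> is normalised without that factor.\<close>

lemma riesz_energy_Un:
  fixes A :: "'a::euclidean_space set"
  assumes A: "A \<in> sets lebesgue" and B: "B \<in> sets lebesgue" and AB: "A \<inter> B = {}"
  shows "riesz_energy lam (A \<union> B) = riesz_energy lam A + riesz_energy lam B + interaction lam A B"
proof -
  let ?W = "interaction lam"
  have U: "A \<union> B \<in> sets lebesgue" using A B by auto
  have "?W (A \<union> B) (A \<union> B) = ?W A (A \<union> B) + ?W B (A \<union> B)"
    by (rule interaction_Un_left[OF A B U AB])
  also have "\<dots> = ?W (A \<union> B) A + ?W (A \<union> B) B"
    using interaction_commute A B U by metis
  also have "\<dots> = (?W A A + ?W B A) + (?W A B + ?W B B)"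
    using interaction_Un_left[OF A B A AB] interaction_Un_left[OF A B B AB] by simp
  also have "?W B A = ?W A B" by (rule interaction_commute[OF B A])
  also have "(?W A A + ?W A B) + (?W A B + ?W B B)
     = ?W A A + ?W B B + 2 * ?W A B"
    by (simp add: mult_2 ac_simps)
  finally have "riesz_energy lam (A \<union> B) = (?W A A + ?W B B + 2 * ?W A B) / 2"
    using riesz_energy_eq[OF U] by simp
  also have "\<dots> = riesz_energy lam A + riesz_energy lam B + ?W A B"
  proof -
    have "inverse (ennreal 2) * ennreal 2 = ennreal (inverse 2) * ennreal 2"
      by (simp only: inverse_ennreal zero_less_numeral)
    also have "\<dots> = ennreal (inverse 2 * 2)" by (rule ennreal_mult[symmetric]) auto
    also have "\<dots> = 1" by simp
    finally have "inverse 2 * 2 = (1::ennreal)" by simp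
    then show ?thesis
      unfolding riesz_energy_eq[OF A] riesz_energy_eq[OF B]
      by (simp add: divide_ennreal_def distrib_right mult.commute[of 2] mult.assoc)
  qed
  finally show ?thesis .
qed

lemma interaction_affine_image:
  fixes A :: "'a::euclidean_space set"
  assumes A[measurable]: "A \<in> sets lebesgue" and c: "c \<ge> 1" and lam: "lam > 0"
  shows "interaction lam ((\<lambda>x. a + c *\<^sub>R x) ` A) ((\<lambda>x. a + c *\<^sub>R x) ` A) \<le> ennreal (c ^ (2 * DIM('a))) * interaction lam A A"
proof -
  let ?T = "\<lambda>x. a + c *\<^sub>R x"
  have c0: "c > 0" "c \<noteq> 0" using c by auto
  have TA[measurable]: "?T ` A \<in> sets lebesgue" by (rule sets_lebesgue_affine_image[OF A c0(2)])
  have ker: "1 / norm (c *\<^sub>R z) powr lam \<le> 1 / norm z powr lam" for z :: 'a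
  proof (cases "z = 0")
    case False
    have "norm z powr lam \<le> norm (c *\<^sub>R z) powr lam"
      by (rule powr_mono2) (use c lam mult_right_mono[of 1 c "norm z"] in auto)
    then show ?thesis using False by (intro divide_left_mono) (use c0 in auto)
  qed simp
  have pot: "potential lam (?T ` A) (?T x) \<le> ennreal (c ^ DIM('a)) * potential lam A x" for x
  proof -
    have "potential lam (?T ` A) (?T x) = ennreal (c ^ DIM('a)) *
       (\<integral>\<^sup>+y. ennreal (1 / norm (?T x - ?T y) powr lam) * indicator (?T ` A) (?T y) \<partial>lebesgue)"
      unfolding potential_def by (rule nn_integral_lebesgue_affine[OF _ c0(1)]) measurable
    also have "\<dots> \<le> ennreal (c ^ DIM('a)) * potential lam A x"
      unfolding potential_def
    proof (intro mult_left_mono nn_integral_mono)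
      fix y
      have "?T x - ?T y = c *\<^sub>R (x - y)" by (simp add: scaleR_diff_right)
      then show "ennreal (1 / norm (?T x - ?T y) powr lam) * indicator (?T ` A) (?T y) \<le> ennreal (1 / norm (x - y) powr lam) * indicator A y"
        unfolding indicator_affine_image[OF c0(2)] using ker[of "x - y"] by (intro mult_right_mono ennreal_leI) auto
    qed auto
    finally show ?thesis .
  qed
  have "interaction lam (?T ` A) (?T ` A) = ennreal (c ^ DIM('a)) *
     (\<integral>\<^sup>+x. potential lam (?T ` A) (?T x) * indicator (?T ` A) (?T x) \<partial>lebesgue)"
    unfolding interaction_def by (rule nn_integral_lebesgue_affine[OF _ c0(1)]) measurable
  also have "\<dots> \<le> ennreal (c ^ DIM('a)) * (\<integral>\<^sup>+x. ennreal (c ^ DIM('a)) * (potential lam A x * indicator A x) \<partial>lebesgue)"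
    unfolding indicator_affine_image[OF c0(2)]
    by (intro mult_left_mono nn_integral_mono) (use pot in \<open>auto simp: mult.assoc[symmetric] intro!: mult_right_mono\<close>)
  also have "(\<integral>\<^sup>+x. ennreal (c ^ DIM('a)) * (potential lam A x * indicator A x) \<partial>lebesgue)
     = ennreal (c ^ DIM('a)) * interaction lam A A"
    unfolding interaction_def by (rule nn_integral_cmult) measurable
  also have "ennreal (c ^ DIM('a)) * (ennreal (c ^ DIM('a)) * interaction lam A A) = ennreal (c ^ (2 * DIM('a))) * interaction lam A A"
    using c0 by (simp add: mult.assoc[symmetric] ennreal_mult[symmetric] power_add[symmetric] mult_2)
  finally show ?thesis .
qed

text \<open>The sharp exponents are N - 1 for the perimeter and 2 N - \<open>lam\<close> for the
  Riesz energy. The common bound 2 N makes the factor the square of the ratio of volumes, so that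
  restoring mass m from mass a costs (m / a) squared.\<close>

lemma energy_affine_image:
  fixes A :: "'a::euclidean_space set"
  assumes A: "A \<in> sets lebesgue" and c: "c \<ge> 1" and lam: "lam > 0"
  shows "energy lam ((\<lambda>x. a + c *\<^sub>R x) ` A) \<le> ennreal (c ^ (2 * DIM('a))) * energy lam A"
proof -
  let ?TA = "(\<lambda>x. a + c *\<^sub>R x) ` A" and ?d = "ennreal (c ^ (2 * DIM('a)))"
  have c0: "c \<noteq> 0" using c by simp
  have "perimeter ?TA \<le> ennreal (c ^ DIM('a)) * perimeter A"
    by (rule perimeter_affine_image[OF A c])
  also have "\<dots> \<le> ?d * perimeter A"
    by (intro mult_right_mono ennreal_leI power_increasing c) auto
  finally have "perimeter ?TA \<le> ?d * perimeter A" .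
  moreover have "riesz_energy lam ?TA \<le> ?d * riesz_energy lam A"
    unfolding riesz_energy_eq[OF A] riesz_energy_eq[OF sets_lebesgue_affine_image[OF A c0]] ennreal_times_divide
    by (intro divide_right_mono_ennreal interaction_affine_image assms)
  ultimately show ?thesis unfolding energy_def distrib_left by (rule add_mono)
qed

lemma min_energy_le:
  fixes \<Omega> :: "'a::euclidean_space set"
  shows "\<Omega> \<in> sets lebesgue \<Longrightarrow> emeasure lebesgue \<Omega> = ennreal m \<Longrightarrow> min_energy TYPE('a) lam m \<le> energy lam \<Omega>"
  unfolding min_energy_def by (rule INF_lower) (simp add: sets_of_mass_def)

lemma min_energy_le_dilation:
  fixes A :: "'a::euclidean_space set"
  assumes A: "A \<in> sets lebesgue" "emeasure lebesgue A = ennreal a" and a: "0 < a" "a \<le> m" and lam: "lam > 0"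
  shows "min_energy TYPE('a) lam m \<le> ennreal ((m / a)\<^sup>2) * energy lam A"
proof -
  define c where "c = root DIM('a) (m / a)"
  have c1: "c \<ge> 1" unfolding c_def using a by (simp add: real_root_ge_1_iff)
  have cN: "c ^ DIM('a) = m / a" unfolding c_def using a by (intro real_root_pow_pos2) auto
  let ?A = "(\<lambda>x. 0 + c *\<^sub>R x) ` A"
  have "emeasure lebesgue ?A = ennreal (m / a) * ennreal a"
    using emeasure_lebesgue_affine_image[of c 0 A] c1 cN A by simp
  also have "\<dots> = ennreal m" using a by (simp add: ennreal_mult[symmetric])
  finally have "min_energy TYPE('a) lam m \<le> energy lam ?A"
    using sets_lebesgue_affine_image[OF A(1), of c 0] c1 by (intro min_energy_le) auto
  also have "\<dots> \<le> ennreal (c ^ (2 * DIM('a))) * energy lam A"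
    by (rule energy_affine_image[OF A(1) c1 lam])
  also have "c ^ (2 * DIM('a)) = (m / a)\<^sup>2" using cN by (metis mult.commute power_mult)
  finally show ?thesis .
qed

text \<open>A dyadic substitute for polar coordinates: where norm z lies between 2 to the power -(k
  + 1) and \<open>r k\<close>, the kernel is at most \<open>t k\<close>. The resulting series is
  geometric with ratio 2 powr (\<open>lam\<close> - N), below 1 because \<open>lam\<close> <
  N.\<close>

lemma kernel_locally_integrable:
  assumes lam: "0 < lam" "lam < real DIM('a::euclidean_space)"
  shows "(\<integral>\<^sup>+z\<in>ball (0::'a) 1. ennreal (1 / norm z powr lam) \<partial>lebesgue) < \<infinity>"
proof -
  define \<omega> where "\<omega> = unit_ball_vol (real DIM('a))"
  have \<omega>0: "\<omega> \<ge> 0" unfolding \<omega>_def by (rule unit_ball_vol_nonneg) simp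
  define t where "t k = ((2::real) ^ Suc k) powr lam" for k
  define r where "r k = (1/2::real) ^ k" for k
  have ptw: "ennreal (1 / norm z powr lam) * indicator (ball 0 1) z \<le> (\<Sum>k. ennreal (t k) * indicator (ball 0 (r k)) z)" for z :: 'a
  \<comment> \<open>At the origin the integrand is 1 / 0 = 0, so the remaining cases are
    trivial.\<close>
  proof (cases "z \<in> ball 0 1 \<and> z \<noteq> 0")
    case True
    then have z: "norm z < 1" "norm z > 0" by auto
    obtain n where n: "(1/2::real) ^ n < norm z" using real_arch_pow_inv[of "norm z" "1/2"] z by auto
    define m where "m = (LEAST n. (1/2::real) ^ n \<le> norm z)"
    have m: "(1/2::real) ^ m \<le> norm z" unfolding m_def by (rule LeastI[of _ n]) (use n in simp)
    then have "m \<noteq> 0" using z by (metis power_0 not_le)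
    then obtain k where k: "m = Suc k" by (metis not0_implies_Suc)
    have "\<not> (1/2::real) ^ k \<le> norm z" using not_less_Least[of k "\<lambda>n. (1/2::real) ^ n \<le> norm z"] k m_def by simp
    then have zk: "z \<in> ball 0 (r k)" unfolding r_def by simp
    have "1 / norm z \<le> 2 ^ Suc k" using m z unfolding k by (simp add: field_simps power_one_over)
    then have "(1 / norm z) powr lam \<le> t k" unfolding t_def by (intro powr_mono2) (use lam z in auto)
    then have "1 / norm z powr lam \<le> t k" using z by (simp add: powr_divide)
    then have "ennreal (1 / norm z powr lam) * indicator (ball 0 1) z \<le> ennreal (t k) * indicator (ball 0 (r k)) z"
      using zk True by (simp add: ennreal_leI)
    also have "\<dots> \<le> (\<Sum>j. ennreal (t j) * indicator (ball 0 (r j)) z)"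
    proof -
      have "f k \<le> suminf f" for f :: "nat \<Rightarrow> ennreal" using sum_le_suminf[of f "{k}"] by simp
      then show ?thesis .
    qed
    finally show ?thesis .
  qed auto
  have [measurable]: "ball (0::'a) s \<in> sets lebesgue" for s by simp
  have t0: "t k \<ge> 0" for k unfolding t_def by simp
  have em: "emeasure lebesgue (ball (0::'a) (r k)) = ennreal (\<omega> * r k ^ DIM('a))" for k
    unfolding \<omega>_def r_def by (subst emeasure_ball[symmetric]) auto
  have "(\<integral>\<^sup>+z\<in>ball (0::'a) 1. ennreal (1 / norm z powr lam) \<partial>lebesgue)
     \<le> (\<integral>\<^sup>+z. (\<Sum>k. ennreal (t k) * indicator (ball 0 (r k)) z) \<partial>(lebesgue :: 'a measure))"
    by (intro nn_integral_mono ptw)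
  also have "\<dots> = (\<Sum>k. \<integral>\<^sup>+z. ennreal (t k) * indicator (ball 0 (r k)) z \<partial>(lebesgue :: 'a measure))"
    by (rule nn_integral_suminf) measurable
  also have "\<dots> = (\<Sum>k. ennreal (t k * (\<omega> * r k ^ DIM('a))))"
    by (simp add: nn_integral_cmult em ennreal_mult' t0 mult.assoc)
  also have "\<dots> < \<infinity>"
  proof -
    define q where "q = 2 powr (lam - real DIM('a))"
    have q: "0 < q" "q < 1" unfolding q_def using lam by (auto intro: powr_less_one)
    have teq: "t k * (\<omega> * r k ^ DIM('a)) = \<omega> * 2 powr lam * q ^ k" for k
    proof -
      have "t k = 2 powr lam * (2 powr lam) ^ k"
        unfolding t_def by (simp add: powr_mult powr_realpow[symmetric] powr_powr mult.commute)
      moreover have "r k ^ DIM('a) = (2 powr (- real DIM('a))) ^ k"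
        unfolding r_def by (simp add: powr_minus powr_realpow power_one_over power_mult[symmetric] mult.commute inverse_eq_divide)
      moreover have "q ^ k = (2 powr lam) ^ k * (2 powr (- real DIM('a))) ^ k"
        unfolding q_def by (simp add: power_mult_distrib[symmetric] powr_add[symmetric])
      ultimately show ?thesis by (simp add: ac_simps)
    qed
    have "summable (\<lambda>k. \<omega> * 2 powr lam * q ^ k)"
      by (intro summable_mult summable_geometric) (use q in auto)
    then have "(\<Sum>k. ennreal (\<omega> * 2 powr lam * q ^ k)) \<noteq> top"
      by (rule ennreal_suminf_neq_top) (use q \<omega>0 in auto)
    then have "(\<Sum>k. ennreal (t k * (\<omega> * r k ^ DIM('a)))) \<noteq> top" by (simp only: teq not_False_eq_True)
    then show ?thesis by (simp add: less_top)
  qed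
  finally show ?thesis .
qed

text \<open>The integral is split at distance 1 from \<open>x\<close>: nearby, \<Omega>-independent
  local integrability of the kernel takes over; farther away the kernel is at most 1.\<close>

lemma potential_le:
  fixes B :: "'a::euclidean_space set"
  assumes lam: "0 < lam" and B[measurable]: "B \<in> sets lebesgue"
  shows "potential lam B x \<le> (\<integral>\<^sup>+z\<in>ball (0::'a) 1. ennreal (1 / norm z powr lam) \<partial>lebesgue) + emeasure lebesgue B"
proof -
  let ?h = "\<lambda>y::'a. if norm y < 1 then ennreal (1 / norm y powr lam) else 0"
  have hm: "(\<lambda>y. ?h (x - y)) \<in> borel_measurable lebesgue"
    by measurable
  have hm': "(\<lambda>y. ?h (x - (x + y))) \<in> borel_measurable lebesgue"
    by measurable
  have "potential lam B x \<le> (\<integral>\<^sup>+y. ?h (x - y) + indicator B y \<partial>lebesgue)"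
    unfolding potential_def
  proof (rule nn_integral_mono)
    fix y
    show "ennreal (1 / norm (x - y) powr lam) * indicator B y \<le> ?h (x - y) + indicator B y"
    proof (cases "norm (x - y) < 1")
      case False
      then have "1 \<le> norm (x - y) powr lam" using lam by (intro ge_one_powr_ge_zero) auto
      then have "ennreal (1 / norm (x - y) powr lam) \<le> ennreal 1" by (intro ennreal_leI) (auto simp: divide_le_eq_1)
      then show ?thesis by (auto simp: indicator_def)
    qed (auto simp: indicator_def)
  qed
  also have "\<dots> = (\<integral>\<^sup>+y. ?h (x - y) \<partial>lebesgue) + emeasure lebesgue B"
    by (subst nn_integral_add[OF hm]) auto
  also have "(\<integral>\<^sup>+y. ?h (x - y) \<partial>lebesgue) = (\<integral>\<^sup>+y. ?h (x - (x + y)) \<partial>lebesgue)"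
    using nn_integral_lebesgue_affine[OF hm, of 1 x] by (simp only: power_one ennreal_1 mult_1_left scaleR_one zero_less_one)
  also have "\<dots> = (\<integral>\<^sup>+z\<in>ball (0::'a) 1. ennreal (1 / norm z powr lam) \<partial>lebesgue)"
    by (intro nn_integral_cong) (simp add: indicator_def)
  finally show ?thesis .
qed

lemma interaction_finite:
  fixes A :: "'a::euclidean_space set"
  assumes lam: "0 < lam" "lam < real DIM('a)"
    and A[measurable]: "A \<in> sets lebesgue" and B: "B \<in> sets lebesgue"
    and fin: "emeasure lebesgue A < \<infinity>" "emeasure lebesgue B < \<infinity>"
  shows "interaction lam A B < \<infinity>"
proof -
  let ?C = "(\<integral>\<^sup>+z\<in>ball (0::'a) 1. ennreal (1 / norm z powr lam) \<partial>lebesgue) + emeasure lebesgue B"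
  have "interaction lam A B \<le> (\<integral>\<^sup>+x. ?C * indicator A x \<partial>lebesgue)"
    unfolding interaction_def by (intro nn_integral_mono mult_right_mono potential_le lam B) auto
  also have "\<dots> = ?C * emeasure lebesgue A" by (subst nn_integral_cmult) auto
  also have "\<dots> < \<infinity>" using kernel_locally_integrable[OF lam] fin by (simp add: ennreal_mult_less_top)
  finally show ?thesis .
qed

lemma riesz_energy_finite:
  fixes A :: "'a::euclidean_space set"
  assumes lam: "0 < lam" "lam < real DIM('a)" and A: "A \<in> sets lebesgue" "emeasure lebesgue A < \<infinity>"
  shows "riesz_energy lam A < \<infinity>"
  unfolding riesz_energy_eq[OF A(1)] using interaction_finite[OF lam A(1) A(1) A(2) A(2)]
  by (simp add: ennreal_divide_eq_top_iff less_top[symmetric])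

lemma interaction_le_separated:
  fixes A :: "'a::euclidean_space set"
  assumes lam: "0 < lam" and A[measurable]: "A \<in> sets lebesgue" and B[measurable]: "B \<in> sets lebesgue"
    and d: "d > 0" "\<And>x y. x \<in> A \<Longrightarrow> y \<in> B \<Longrightarrow> norm (x - y) \<ge> d"
  shows "interaction lam A B \<le> ennreal (1 / d powr lam) * (emeasure lebesgue A * emeasure lebesgue B)"
proof -
  have "potential lam B x \<le> ennreal (1 / d powr lam) * emeasure lebesgue B" if "x \<in> A" for x
  proof -
    have "potential lam B x \<le> (\<integral>\<^sup>+y. ennreal (1 / d powr lam) * indicator B y \<partial>lebesgue)"
      unfolding potential_def
    proof (intro nn_integral_mono)
      fix y
      show "ennreal (1 / norm (x - y) powr lam) * indicator B y \<le> ennreal (1 / d powr lam) * indicator B y"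
      proof (cases "y \<in> B")
        case True
        have "d powr lam \<le> norm (x - y) powr lam"
          by (rule powr_mono2) (use lam d True that in auto)
        then have "1 / norm (x - y) powr lam \<le> 1 / d powr lam"
          by (intro divide_left_mono) (use d True that in \<open>fastforce intro!: mult_pos_pos\<close>)+
        then show ?thesis using True by (simp add: ennreal_leI)
      qed simp
    qed
    also have "\<dots> = ennreal (1 / d powr lam) * emeasure lebesgue B"
      by (subst nn_integral_cmult) auto
    finally show ?thesis .
  qed
  then have "interaction lam A B \<le> (\<integral>\<^sup>+x. (ennreal (1 / d powr lam) * emeasure lebesgue B) * indicator A x \<partial>lebesgue)"
    unfolding interaction_def by (intro nn_integral_mono) (auto simp: indicator_def)
  also have "\<dots> = ennreal (1 / d powr lam) * (emeasure lebesgue A * emeasure lebesgue B)"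
    by (subst nn_integral_cmult) (auto simp: ac_simps)
  finally show ?thesis .
qed

text \<open>The kernel vanishes only for x = y, by the convention 1 / 0 = 0, and for fixed x this is
  a single point. So the potential of a non-null set is nowhere 0.\<close>

lemma interaction_pos:
  fixes A :: "'a::euclidean_space set"
  assumes A[measurable]: "A \<in> sets lebesgue" and B[measurable]: "B \<in> sets lebesgue"
    and pos: "emeasure lebesgue A > 0" "emeasure lebesgue B > 0"
  shows "interaction lam A B > 0"
proof (rule ccontr)
  assume "\<not> interaction lam A B > 0"
  then have "interaction lam A B = 0" by simp
  then have "AE x in lebesgue. potential lam B x * indicator A x = 0"
    unfolding interaction_def by (subst (asm) nn_integral_0_iff_AE) auto
  moreover have "potential lam B x \<noteq> 0" for x
  proof
    assume "potential lam B x = 0"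
    then have "AE y in lebesgue. ennreal (1 / norm (x - y) powr lam) * indicator B y = 0"
      unfolding potential_def by (subst (asm) nn_integral_0_iff_AE) auto
    moreover have "AE y in lebesgue. y \<noteq> x"
      by (rule AE_I'[of "{x}"]) auto
    ultimately have "AE y in lebesgue. y \<notin> B"
      by eventually_elim (auto simp: indicator_def split: if_splits)
    then have "B \<in> null_sets lebesgue" by (simp add: AE_iff_null_sets B)
    then show False using pos by auto
  qed
  ultimately have "AE x in lebesgue. x \<notin> A"
    by (elim eventually_mono) (auto simp: indicator_def split: if_splits)
  then have "A \<in> null_sets lebesgue" by (simp add: AE_iff_null_sets A)
  then show False using pos by auto
qed

section \<open>Translations and the isoperimetric inequality\<close>

lemma set_integrable_compact_support:
  fixes f :: "'a::euclidean_space \<Rightarrow> real"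
  assumes "continuous_on UNIV f" "compact K" "\<And>x. x \<notin> K \<Longrightarrow> f x = 0" "A \<in> sets lebesgue"
  shows "set_integrable lebesgue A f"
  using integrable_compact_support[OF assms(1-3)] assms(4)
  unfolding set_integrable_def by (intro integrable_mult_indicator) auto

lemma translate_compact_support:
  fixes K :: "'a::euclidean_space set"
  shows "compact K \<Longrightarrow> compact ((\<lambda>k. k - h) ` K)"
  by (rule compact_continuous_image) (intro continuous_intros)

lemma translate_zero_off:
  fixes f :: "'a::euclidean_space \<Rightarrow> 'b::zero"
  assumes "\<And>x. x \<notin> K \<Longrightarrow> f x = 0" and x: "x \<notin> (\<lambda>k. k - h) ` K"
  shows "f (x + h) = 0"
proof -
  have "x + h \<notin> K"
  proof
    assume "x + h \<in> K"
    then have "(x + h) - h \<in> (\<lambda>k. k - h) ` K" by (rule imageI)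
    then show False using x by simp
  qed
  then show "f (x + h) = 0" by (rule assms)
qed

text \<open>Differentiation under the integral sign. The difference quotients are bounded by a
  Lipschitz constant times norm h and live on a fixed compact set, so dominated convergence applies
  even if \<open>A\<close> has infinite volume.\<close>

lemma set_integral_translation_derivative:
  fixes \<psi> :: "'a::euclidean_space \<Rightarrow> real"
  assumes A[measurable]: "A \<in> sets lebesgue"
    and \<psi>': "\<And>x. (\<psi> has_derivative \<psi>' x) (at x)" "\<And>v. continuous_on UNIV (\<lambda>x. \<psi>' x v)"
    and K: "compact K" "\<And>x. x \<notin> K \<Longrightarrow> \<psi> x = 0"
  shows "((\<lambda>s. LINT x:A|lebesgue. \<psi> (x + s *\<^sub>R h)) has_real_derivative (LINT x:A|lebesgue. \<psi>' (x + s *\<^sub>R h) h)) (at s)"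
proof -
  let ?g = "\<lambda>s. LINT x:A|lebesgue. \<psi> (x + s *\<^sub>R h)"
  obtain G where G: "\<And>x. \<psi>' x = blinfun_apply (G x)" "continuous_on UNIV G"
    using C1_blinfun[OF \<psi>'] by blast
  have C1\<psi>: "C1 \<psi>" using \<psi>' by (rule C1I)
  have cont: "continuous_on UNIV (\<lambda>x. \<psi> (x + u))" for u
    by (rule continuous_on_compose2[OF C1_continuous[OF C1\<psi>, of UNIV]]) (auto intro!: continuous_intros)
  have "G x = 0" if "x \<notin> K" for x
  proof -
    have "supp \<psi> \<subseteq> K"
      by (rule closure_minimal) (use K compact_imp_closed in auto)
    then have "\<psi>' x = (\<lambda>v. 0)" using has_derivative_zero_off_support[OF \<psi>'(1)] that by blast
    then show ?thesis using G by (intro blinfun_eqI) simp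
  qed
  then obtain M where M: "M > 0" "\<And>x. norm (G x) \<le> M"
    using bounded_compact_support[OF G(2) K(1)] by blast
  have lip: "norm (\<psi> a - \<psi> b) \<le> M * norm (a - b)" for a b
  proof (rule differentiable_bound[OF convex_UNIV])
    show "(\<psi> has_derivative blinfun_apply (G x)) (at x within UNIV)" for x using \<psi>'(1)[of x] G(1) by simp
    show "onorm (blinfun_apply (G x)) \<le> M" for x using M(2)[of x] by (simp add: norm_blinfun.rep_eq)
  qed auto
  have meas: "(\<lambda>x. \<psi> (x + u)) \<in> borel_measurable lebesgue" for u
    by (intro borel_measurable_lebesgueI borel_measurable_continuous_onI cont)
  have "continuous_on UNIV (\<lambda>x. \<psi>' (x + u) h)" for u
    by (rule continuous_on_compose2[OF \<psi>'(2)]) (auto intro!: continuous_intros)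
  then have meas': "(\<lambda>x. \<psi>' (x + u) h) \<in> borel_measurable lebesgue" for u
    by (intro borel_measurable_lebesgueI borel_measurable_continuous_onI)
  note [measurable] = meas meas'
  show ?thesis
    unfolding DERIV_def tendsto_at_iff_sequentially comp_def
  proof (intro allI impI)
    fix X :: "nat \<Rightarrow> real" assume X: "\<forall>i. X i \<in> UNIV - {0}" "X \<longlonglongrightarrow> 0"
    then have X0: "X n \<noteq> 0" for n by auto
    obtain R where R: "\<And>n. \<bar>X n\<bar> \<le> R" using convergent_imp_Bseq[of X] X convergentI
      unfolding Bseq_def by (metis real_norm_def)
    \<comment> \<open>The union of the translates of \<open>K\<close> that occur along the sequence:
      outside of it every difference quotient is 0.\<close>
    define C where "C = (\<lambda>z. fst z - snd z *\<^sub>R h) ` (K \<times> {s-R..s+R})"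
    have C: "compact C"
      unfolding C_def by (intro compact_continuous_image compact_Times K(1) compact_Icc) (auto intro!: continuous_intros)
    define q where "q n x = (\<psi> (x + (s + X n) *\<^sub>R h) - \<psi> (x + s *\<^sub>R h)) / X n" for n x
    have qb: "\<bar>q n x\<bar> \<le> M * norm h * indicator C x" for n x
    proof (cases "x \<in> C")
      case True
      have "\<bar>q n x\<bar> \<le> (M * norm ((x + (s + X n) *\<^sub>R h) - (x + s *\<^sub>R h))) / \<bar>X n\<bar>"
        unfolding q_def abs_divide by (intro divide_right_mono lip[unfolded real_norm_def]) simp
      also have "(x + (s + X n) *\<^sub>R h) - (x + s *\<^sub>R h) = X n *\<^sub>R h" by (simp add: algebra_simps)
      finally show ?thesis using True X0 by simp
    next
      case False
      have "x + u *\<^sub>R h \<notin> K" if "\<bar>u - s\<bar> \<le> R" for u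
      proof
        assume "x + u *\<^sub>R h \<in> K"
        then have "fst (x + u *\<^sub>R h, u) - snd (x + u *\<^sub>R h, u) *\<^sub>R h \<in> C"
          unfolding C_def by (intro imageI) (use that in auto)
        then show False using False by simp
      qed
      moreover have "R \<ge> 0" using R[of n] by linarith
      ultimately have "x + (s + X n) *\<^sub>R h \<notin> K" "x + s *\<^sub>R h \<notin> K" using R[of n] by auto
      then have "\<psi> (x + (s + X n) *\<^sub>R h) = 0" "\<psi> (x + s *\<^sub>R h) = 0"
        by (auto intro!: K(2))
      then show ?thesis using False by (simp add: q_def)
    qed
    have int: "set_integrable lebesgue A (\<lambda>x. \<psi> (x + u))" for u
      by (rule set_integrable_compact_support[OF cont translate_compact_support[OF K(1)] translate_zero_off[of K \<psi>, OF K(2)] A])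
    have "(\<lambda>n. \<integral>x. indicator A x *\<^sub>R q n x \<partial>lebesgue) \<longlonglongrightarrow> (\<integral>x. indicator A x *\<^sub>R \<psi>' (x + s *\<^sub>R h) h \<partial>lebesgue)"
    proof (rule integral_dominated_convergence[where w = "\<lambda>x. M * norm h * indicator C x"])
      show "(\<lambda>x. indicator A x *\<^sub>R \<psi>' (x + s *\<^sub>R h) h) \<in> borel_measurable lebesgue" by measurable
      show "(\<lambda>x. indicator A x *\<^sub>R q n x) \<in> borel_measurable lebesgue" for n unfolding q_def by measurable
      have "C \<in> lmeasurable" using C by (rule lmeasurable_compact)
      then show "integrable lebesgue (\<lambda>x. M * norm h * indicator C x)"
        by (intro integrable_mult_right) (auto simp: fmeasurable_def)
      show "AE x in lebesgue. norm (indicator A x *\<^sub>R q n x) \<le> M * norm h * indicator C x" for n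
      proof (rule AE_I2)
        fix x
        show "norm (indicator A x *\<^sub>R q n x) \<le> M * norm h * indicator C x"
          using qb[of n x] M(1) by (cases "x \<in> A") auto
      qed
      show "AE x in lebesgue. (\<lambda>n. indicator A x *\<^sub>R q n x) \<longlonglongrightarrow> indicator A x *\<^sub>R \<psi>' (x + s *\<^sub>R h) h"
      proof (rule AE_I2)
        fix x
        have "((\<lambda>t. x + t *\<^sub>R h) has_derivative (\<lambda>t. t *\<^sub>R h)) (at s)" by (auto intro!: derivative_eq_intros)
        from has_derivative_compose[OF this \<psi>'(1)]
        have "((\<lambda>t. \<psi> (x + t *\<^sub>R h)) has_derivative (\<lambda>t. \<psi>' (x + s *\<^sub>R h) h * t)) (at s)"
          unfolding G(1) by (simp add: blinfun.scaleR_right mult.commute)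
        then have "((\<lambda>t. \<psi> (x + t *\<^sub>R h)) has_real_derivative \<psi>' (x + s *\<^sub>R h) h) (at s)"
          unfolding has_field_derivative_def .
        then have "(\<lambda>n. q n x) \<longlonglongrightarrow> \<psi>' (x + s *\<^sub>R h) h"
          using X unfolding DERIV_def tendsto_at_iff_sequentially comp_def q_def by blast
        then show "(\<lambda>n. indicator A x *\<^sub>R q n x) \<longlonglongrightarrow> indicator A x *\<^sub>R \<psi>' (x + s *\<^sub>R h) h"
          by (intro tendsto_intros)
      qed
    qed
    moreover have "(\<integral>x. indicator A x *\<^sub>R q n x \<partial>lebesgue)
       = (?g (s + X n) - ?g s) / X n" for n
    proof -
      have "(\<integral>x. indicator A x *\<^sub>R q n x \<partial>lebesgue) = (LINT x:A|lebesgue. (\<psi> (x + (s + X n) *\<^sub>R h) - \<psi> (x + s *\<^sub>R h)) / X n)"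
        unfolding set_lebesgue_integral_def q_def ..
      also have "\<dots> = (LINT x:A|lebesgue. \<psi> (x + (s + X n) *\<^sub>R h) - \<psi> (x + s *\<^sub>R h)) / X n"
        by (rule set_integral_divide_zero)
      also have "(LINT x:A|lebesgue. \<psi> (x + (s + X n) *\<^sub>R h) - \<psi> (x + s *\<^sub>R h))
         = ?g (s + X n) - ?g s"
        by (intro set_integral_diff int)
      finally show ?thesis .
    qed
    ultimately show "(\<lambda>n. (?g (s + X n) - ?g s) / X n)
        \<longlonglongrightarrow> (LINT x:A|lebesgue. \<psi>' (x + s *\<^sub>R h) h)"
      unfolding set_lebesgue_integral_def by simp
  qed
qed

text \<open>Translation invariance replaces integration by parts: the integral of
  \<open>F (x + s *\<^sub>R b) \<bullet> b\<close> does not depend on s, and its derivative at s = 0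
  is the integral of the summand of the divergence belonging to b.\<close>

lemma integral_divergence:
  fixes F :: "'a::euclidean_space \<Rightarrow> 'a"
  assumes F: "F \<in> C1_compact_support"
  shows "(LINT x:UNIV|lebesgue. divergence F x) = 0"
proof -
  have C1F: "C1 F" "compact (supp F)" using F C1_compact_support_iff by auto
  obtain F' where F': "\<And>x. (F has_derivative F' x) (at x)" "\<And>v. continuous_on UNIV (\<lambda>x. F' x v)"
    using C1E[OF C1F(1)] by blast
  have 0: "(LINT x:UNIV|lebesgue. F' x b \<bullet> b) = 0" for b
  proof -
    have "((\<lambda>s. LINT x:UNIV|lebesgue. F (x + s *\<^sub>R b) \<bullet> b) has_real_derivative
       (LINT x:UNIV|lebesgue. F' (x + 0 *\<^sub>R b) b \<bullet> b)) (at 0)"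
    proof (rule set_integral_translation_derivative[where \<psi>' = "\<lambda>x v. F' x v \<bullet> b"])
      show "((\<lambda>x. F x \<bullet> b) has_derivative (\<lambda>v. F' x v \<bullet> b)) (at x)" for x
        by (intro has_derivative_inner_left F')
      show "continuous_on UNIV (\<lambda>x. F' x v \<bullet> b)" for v by (intro continuous_intros F')
      show "F x \<bullet> b = 0" if "x \<notin> supp F" for x using zero_off_support[OF that] by simp
    qed (use C1F in auto)
    moreover have "(\<lambda>s. LINT x:UNIV|lebesgue. F (x + s *\<^sub>R b) \<bullet> b) = (\<lambda>s. LINT x:UNIV|lebesgue. F x \<bullet> b)"
    proof
      fix s
      have "(\<lambda>x. F x \<bullet> b) \<in> borel_measurable lebesgue"
        by (intro C1_measurable C1_inner C1F C1_const)
      from integral_lebesgue_affine[OF this, of 1 "s *\<^sub>R b"]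
      show "(LINT x:UNIV|lebesgue. F (x + s *\<^sub>R b) \<bullet> b) = (LINT x:UNIV|lebesgue. F x \<bullet> b)"
        unfolding set_lebesgue_integral_def by (simp add: add.commute)
    qed
    ultimately have "((\<lambda>s::real. LINT x:UNIV|lebesgue. F x \<bullet> b) has_real_derivative
       (LINT x:UNIV|lebesgue. F' x b \<bullet> b)) (at 0)" by simp
    then show ?thesis using DERIV_const DERIV_unique by blast
  qed
  have "(LINT x:UNIV|lebesgue. divergence F x) = (LINT x:UNIV|lebesgue. (\<Sum>b\<in>Basis. F' x b \<bullet> b))"
    using divergence_eq[OF F'(1)] by simp
  also have "\<dots> = (\<Sum>b\<in>Basis. LINT x:UNIV|lebesgue. F' x b \<bullet> b)"
    unfolding set_lebesgue_integral_def scaleR_sum_right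
  proof (rule Bochner_Integration.integral_sum)
    fix b
    have "F' x = (\<lambda>v. 0)" if "x \<notin> supp F" for x
      by (rule has_derivative_zero_off_support[OF F'(1) that])
    then have "set_integrable lebesgue UNIV (\<lambda>x. F' x b \<bullet> b)"
      by (intro set_integrable_compact_support[OF _ C1F(2)]) (auto intro!: continuous_intros F')
    then show "integrable lebesgue (\<lambda>x. indicator UNIV x *\<^sub>R (F' x b \<bullet> b))" unfolding set_integrable_def .
  qed
  finally show ?thesis using 0 by simp
qed

text \<open>This allows a ball to be cut out of the whole space, so that a set of finite perimeter
  is obtained without computing the area of a sphere.\<close>

lemma perimeter_UNIV: "perimeter UNIV = 0"
proof -
  have "perimeter (UNIV :: 'a set) \<le> 0"
    by (rule perimeter_least) (simp add: integral_divergence)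
  then show ?thesis by simp
qed

text \<open>The mean value theorem along the segment from 0 to \<open>h\<close> yields an
  intermediate translate. There the derivative is \<open>norm h\<close> times the divergence of an
  admissible field: the translated \<psi> times the unit vector along \<open>h\<close>.\<close>

lemma set_integral_translate_le_perimeter:
  fixes \<psi> :: "'a::euclidean_space \<Rightarrow> real"
  assumes A: "A \<in> sets lebesgue" and p: "perimeter A = ennreal p" "p \<ge> 0"
    and \<psi>: "C1 \<psi>" "compact K" "\<And>x. x \<notin> K \<Longrightarrow> \<psi> x = 0" "\<And>x. \<bar>\<psi> x\<bar> \<le> 1"
  shows "(LINT x:A|lebesgue. \<psi> (x + h)) - (LINT x:A|lebesgue. \<psi> x) \<le> norm h * p"
proof (cases "h = 0")
  case False
  obtain \<psi>' where \<psi>': "\<And>x. (\<psi> has_derivative \<psi>' x) (at x)" "\<And>v. continuous_on UNIV (\<lambda>x. \<psi>' x v)"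
    using C1E[OF \<psi>(1)] by blast
  let ?g = "\<lambda>s. LINT x:A|lebesgue. \<psi> (x + s *\<^sub>R h)"
  have der: "(?g has_real_derivative (LINT x:A|lebesgue. \<psi>' (x + s *\<^sub>R h) h)) (at s)" for s
    by (rule set_integral_translation_derivative[OF A \<psi>' \<psi>(2,3)])
  obtain s where s: "?g 1 - ?g 0 = (1 - 0) * (LINT x:A|lebesgue. \<psi>' (x + s *\<^sub>R h) h)"
    using MVT2[of 0 1 ?g "\<lambda>s. LINT x:A|lebesgue. \<psi>' (x + s *\<^sub>R h) h"] der by auto
  define F where "F x = \<psi> (x + s *\<^sub>R h) *\<^sub>R ((1 / norm h) *\<^sub>R h)" for x
  have C1s: "C1 (\<lambda>x. \<psi> (x + s *\<^sub>R h))"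
    using C1_compose[OF C1_affine[of "s *\<^sub>R h" 1] \<psi>(1)] by (simp add: add.commute)
  have F: "F \<in> C1_compact_support"
  proof (rule C1_compact_supportI)
    show "C1 F" unfolding F_def by (intro C1_scaleR C1s C1_const)
    show "compact ((\<lambda>k. k - s *\<^sub>R h) ` K)" by (rule translate_compact_support[OF \<psi>(2)])
    show "F x = 0" if "x \<notin> (\<lambda>k. k - s *\<^sub>R h) ` K" for x
      using translate_zero_off[of K \<psi>, OF \<psi>(3) that] unfolding F_def by simp
  qed
  have Fn: "norm (F x) \<le> 1" for x using \<psi>(4) False unfolding F_def by simp
  have div: "divergence F x = (1 / norm h) * \<psi>' (x + s *\<^sub>R h) h" for x
  proof -
    have "((\<lambda>x. x + s *\<^sub>R h) has_derivative (\<lambda>v. v)) (at x)" by (auto intro!: derivative_eq_intros)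
    from has_derivative_compose[OF this \<psi>'(1)]
    have 1: "((\<lambda>x. \<psi> (x + s *\<^sub>R h)) has_derivative \<psi>' (x + s *\<^sub>R h)) (at x)" .
    have 2: "((\<lambda>x. (1 / norm h) *\<^sub>R h) has_derivative (\<lambda>v. 0)) (at x)" by simp
    have "divergence F x = \<psi>' (x + s *\<^sub>R h) ((1 / norm h) *\<^sub>R h)"
      unfolding F_def divergence_scaleR_left[OF 1 2] using divergence_eq[OF 2] by simp
    also have "\<dots> = (1 / norm h) *\<^sub>R \<psi>' (x + s *\<^sub>R h) h"
      using has_derivative_linear[OF \<psi>'(1)] linear_scale by blast
    finally show ?thesis by simp
  qed
  have "ennreal (LINT x:A|lebesgue. divergence F x) \<le> ennreal p"
    using perimeter_upper[OF F Fn, of A] p by simp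
  then have "(LINT x:A|lebesgue. divergence F x) \<le> p" using p(2) by (simp add: ennreal_le_iff)
  then have "(1 / norm h) * (LINT x:A|lebesgue. \<psi>' (x + s *\<^sub>R h) h) \<le> p"
    unfolding div set_lebesgue_integral_def by (simp add: mult.left_commute)
  then have "(LINT x:A|lebesgue. \<psi>' (x + s *\<^sub>R h) h) \<le> norm h * p"
    using False by (simp add: field_simps)
  then show ?thesis using s by simp
qed simp

text \<open>\<open>K\<close> is covered by finitely many balls whose closures lie in
  \<open>U\<close>. The bumps are squared positive parts of the squared radius minus the squared
  distance, which avoids differentiating the norm.\<close>

lemma C1_Urysohn:
  fixes K :: "'a::euclidean_space set"
  assumes K: "compact K" "open U" "K \<subseteq> U"
  obtains \<psi> :: "'a \<Rightarrow> real" and C where "C1 \<psi>" "compact C" "\<And>x. x \<notin> C \<Longrightarrow> \<psi> x = 0" "C \<subseteq> U"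
    "\<And>x. 0 \<le> \<psi> x" "\<And>x. \<psi> x \<le> 1" "\<And>x. x \<in> K \<Longrightarrow> \<psi> x = 1"
proof (cases "K = {}")
  case True
  show ?thesis by (rule that[of "\<lambda>x. 0" "{}"]) (use True in auto)
next
  case False
  have "\<exists>r>0. cball x r \<subseteq> U" if "x \<in> K" for x using that K open_contains_cball by blast
  then obtain r where r: "\<And>x. x \<in> K \<Longrightarrow> r x > 0" "\<And>x. x \<in> K \<Longrightarrow> cball x (r x) \<subseteq> U" by metis
  have "K \<subseteq> (\<Union>x\<in>K. ball x (r x))" using r(1) by force
  then obtain I where I: "I \<subseteq> K" "finite I" "K \<subseteq> (\<Union>x\<in>I. ball x (r x))"
    by (rule compactE_image[OF K(1), of K "\<lambda>x. ball x (r x)", rotated]) auto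
  define f where "f y = (\<Sum>x\<in>I. (max 0 ((r x)\<^sup>2 - (y - x) \<bullet> (y - x)))\<^sup>2)" for y
  have C1f: "C1 f"
    unfolding f_def
  proof (rule C1_sum)
    fix x
    have id: "C1 (\<lambda>y::'a. y)" by (intro C1_bounded_linear bounded_linear_ident)
    have "C1 (\<lambda>s::real. (max 0 s)\<^sup>2)"
      by (rule C1_real[OF max0_square_derivative]) (intro continuous_intros)
    moreover have "C1 (\<lambda>y. (r x)\<^sup>2 - (y - x) \<bullet> (y - x))"
      by (intro C1_diff C1_const C1_inner id)
    ultimately show "C1 (\<lambda>y. (max 0 ((r x)\<^sup>2 - (y - x) \<bullet> (y - x)))\<^sup>2)"
      using C1_compose[of _ "\<lambda>s::real. (max 0 s)\<^sup>2"] by blast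
  qed
  have f0: "f y \<ge> 0" for y unfolding f_def by (intro sum_nonneg) auto
  have fpos: "f y > 0" if y: "y \<in> K" for y
  proof -
    obtain x where x: "x \<in> I" "y \<in> ball x (r x)" using I y by blast
    then have "norm (y - x) < r x" by (simp add: dist_norm norm_minus_commute)
    then have "(norm (y - x))\<^sup>2 < (r x)\<^sup>2" by (intro power_strict_mono) auto
    then have "0 < (r x)\<^sup>2 - (y - x) \<bullet> (y - x)" by (simp add: power2_norm_eq_inner)
    then have "0 < (max 0 ((r x)\<^sup>2 - (y - x) \<bullet> (y - x)))\<^sup>2" by simp
    then show ?thesis unfolding f_def by (intro sum_pos2[OF I(2) x(1)]) auto
  qed
  \<comment> \<open>Dividing by the minimum of \<open>f\<close> over \<open>K\<close> lifts
    \<open>f\<close> to at least 1 there, where \<open>smooth_step\<close> is constantly 1.\<close>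
  obtain y0 where y0: "y0 \<in> K" "\<And>y. y \<in> K \<Longrightarrow> f y0 \<le> f y"
    using continuous_attains_inf[OF K(1) False C1_continuous[OF C1f]] by blast
  let ?C = "\<Union>x\<in>I. cball x (r x)"
  show ?thesis
  proof (rule that[of "\<lambda>y. smooth_step ((1 / f y0) * f y)" ?C])
    show "C1 (\<lambda>y. smooth_step ((1 / f y0) * f y))"
      by (rule C1_compose[OF C1_mult[OF C1_const C1f] C1_real[OF smooth_step_derivative tent_continuous]])
    show "compact ?C" by (intro compact_UN I(2)) auto
    show "?C \<subseteq> U" using I(1) r(2) by blast
    show "smooth_step ((1 / f y0) * f y) = 0" if "y \<notin> ?C" for y
    proof -
      have "(max 0 ((r x)\<^sup>2 - (y - x) \<bullet> (y - x)))\<^sup>2 = 0" if x: "x \<in> I" for x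
      proof -
        have "r x > 0" using r I x by blast
        moreover have "r x < norm (y - x)" using \<open>y \<notin> ?C\<close> x by (auto simp: dist_norm norm_minus_commute not_le)
        ultimately have "(r x)\<^sup>2 \<le> (norm (y - x))\<^sup>2" by (intro power_mono) auto
        then show ?thesis by (simp add: power2_norm_eq_inner)
      qed
      then have "f y = 0" unfolding f_def by (intro sum.neutral) auto
      then show ?thesis by (simp add: smooth_step_eq_0)
    qed
    show "smooth_step ((1 / f y0) * f y) = 1" if "y \<in> K" for y
      by (rule smooth_step_eq_1) (use y0(2)[OF that] fpos[OF y0(1)] in \<open>simp add: field_simps\<close>)
  qed (rule smooth_step_bounds)+
qed

section \<open>From translates to the isoperimetric inequality\<close>

lemma lebesgue_inner_compact:
  fixes S :: "'a::euclidean_space set"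
  assumes S: "S \<in> lmeasurable" and e: "e > 0"
  obtains K where "compact K" "K \<subseteq> S" "measure lebesgue S - e \<le> measure lebesgue K"
proof -
  obtain C where C: "closed C" "C \<subseteq> S" "S - C \<in> lmeasurable" "emeasure lebesgue (S - C) < ennreal (e/2)"
    using sets_lebesgue_inner_closed[of S "e/2"] S e by auto
  have Cm: "C \<in> lmeasurable" by (rule fmeasurableI2[OF S C(2)]) (use C(1) in \<open>simp add: sets_completionI_sets\<close>)
  have "measure lebesgue (S - C) = measure lebesgue S - measure lebesgue C"
    using S C Cm by (intro measurable_measure_Diff) auto
  moreover have "measure lebesgue (S - C) \<le> e/2"
    using C(3,4) e by (simp add: emeasure_eq_measure2 less_imp_le ennreal_less_iff)
  ultimately have 1: "measure lebesgue S - e/2 \<le> measure lebesgue C" by simp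
  have UC: "(\<Union>n. C \<inter> cball 0 (real n)) = C" by (auto simp: real_arch_simple)
  have "(\<lambda>n. measure lebesgue (C \<inter> cball 0 (real n))) \<longlonglongrightarrow> measure lebesgue (\<Union>n. C \<inter> cball 0 (real n))"
  proof (rule Lim_measure_incseq)
    show "range (\<lambda>n. C \<inter> cball 0 (real n)) \<subseteq> sets lebesgue" using Cm by auto
    show "incseq (\<lambda>n. C \<inter> cball 0 (real n))" by (auto simp: incseq_def)
    show "emeasure lebesgue (\<Union>n. C \<inter> cball 0 (real n)) \<noteq> \<infinity>"
      using fmeasurableD2[OF Cm] UC by simp
  qed
  then have "(\<lambda>n. measure lebesgue (C \<inter> cball 0 (real n))) \<longlonglongrightarrow> measure lebesgue C" unfolding UC .
  then have "\<forall>\<^sub>F n in sequentially. measure lebesgue (C \<inter> cball 0 (real n)) > measure lebesgue C - e/2"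
    by (rule order_tendstoD) (use e in auto)
  then obtain n where "measure lebesgue (C \<inter> cball 0 (real n)) > measure lebesgue C - e/2"
    using eventually_happens by fastforce
  then show ?thesis
    using C 1 by (intro that[of "C \<inter> cball 0 (real n)"]) (auto intro: closed_Int_compact)
qed

text \<open>The test function is 1 on a compact \<open>K\<close> that fills the difference
  \<open>?S\<close> up to e/2, and it is supported in an open \<open>U\<close> exceeding
  \<open>K\<close> by at most e/2 in volume. As \<open>K\<close> avoids \<open>A\<close>, its
  integral over \<open>A\<close> is at most e/2, while over the translate it nearly reaches the
  volume of \<open>?S\<close>. The difference of the two integrals is the change of one integral
  under translation.\<close>

lemma measure_translate_diff_le:
  fixes A :: "'a::euclidean_space set"
  assumes A: "A \<in> lmeasurable" and p: "perimeter A = ennreal p" "p \<ge> 0"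
  shows "measure lebesgue ((\<lambda>x. h + x) ` A - A) \<le> norm h * p"
proof (rule field_le_epsilon)
  fix e :: real assume e: "e > 0"
  let ?T = "(\<lambda>x. h + x) ` A"
  let ?S = "?T - A"
  have As: "A \<in> sets lebesgue" using A by auto
  have T: "?T \<in> lmeasurable" using A measurable_translation by blast
  have S: "?S \<in> lmeasurable" using T A by (intro fmeasurable_Diff) auto
  obtain K where K: "compact K" "K \<subseteq> ?S" "measure lebesgue ?S - e/2 \<le> measure lebesgue K"
    using lebesgue_inner_compact[OF S, of "e/2"] e by auto
  have Km: "K \<in> lmeasurable" using K(1) by (rule lmeasurable_compact)
  obtain U where U: "open U" "K \<subseteq> U" "U - K \<in> lmeasurable" "emeasure lebesgue (U - K) < ennreal (e/2)"
    using sets_lebesgue_outer_open[of K "e/2"] Km e by auto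
  obtain \<psi> :: "'a \<Rightarrow> real" and C where \<psi>: "C1 \<psi>" "compact C" "\<And>x. x \<notin> C \<Longrightarrow> \<psi> x = 0" "C \<subseteq> U"
    "\<And>x. 0 \<le> \<psi> x" "\<And>x. \<psi> x \<le> 1" "\<And>x. x \<in> K \<Longrightarrow> \<psi> x = 1"
    using C1_Urysohn[OF K(1) U(1,2)] by metis
  have cont: "continuous_on UNIV \<psi>" by (rule C1_continuous[OF \<psi>(1)])
  have \<psi>m: "\<psi> \<in> borel_measurable lebesgue" by (rule C1_measurable[OF \<psi>(1)])
  have iA: "set_integrable lebesgue A \<psi>" by (rule set_integrable_compact_support[OF cont \<psi>(2,3) As])
  have iT: "set_integrable lebesgue ?T \<psi>" by (rule set_integrable_compact_support[OF cont \<psi>(2,3)]) (use T in auto)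
  have 1: "(LINT x:A|lebesgue. \<psi> (x + h)) - (LINT x:A|lebesgue. \<psi> x) \<le> norm h * p"
    by (rule set_integral_translate_le_perimeter[OF As p \<psi>(1-3)]) (use \<psi>(5,6) in \<open>auto simp: abs_le_iff intro: order_trans[of _ 0]\<close>)
  have "(LINT x:?T|lebesgue. \<psi> x) = (\<integral>x. indicator ?T (h + x) *\<^sub>R \<psi> (h + x) \<partial>lebesgue)"
    unfolding set_lebesgue_integral_def
    using integral_lebesgue_affine[of "\<lambda>x. indicator ?T x *\<^sub>R \<psi> x" 1 h] T \<psi>m by auto
  also have "\<dots> = (LINT x:A|lebesgue. \<psi> (x + h))"
    unfolding set_lebesgue_integral_def
    by (intro Bochner_Integration.integral_cong) (auto simp: indicator_def add.commute)
  finally have 2: "(LINT x:?T|lebesgue. \<psi> x) = (LINT x:A|lebesgue. \<psi> (x + h))" .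
  have "measure lebesgue K = (\<integral>x. indicator K x \<partial>lebesgue)" by simp
  also have "\<dots> \<le> (\<integral>x. indicator ?T x *\<^sub>R \<psi> x \<partial>lebesgue)"
  proof (rule integral_mono)
    show "integrable lebesgue (indicator K :: 'a \<Rightarrow> real)" using Km by (auto simp: fmeasurable_def)
    show "integrable lebesgue (\<lambda>x. indicator ?T x *\<^sub>R \<psi> x)" using iT unfolding set_integrable_def .
    show "indicator K x \<le> indicator ?T x *\<^sub>R \<psi> x" for x using K(2) \<psi>(5,7) by (auto simp: indicator_def)
  qed
  finally have 3: "measure lebesgue K \<le> (LINT x:?T|lebesgue. \<psi> x)" unfolding set_lebesgue_integral_def .
  have "(\<integral>x. indicator A x *\<^sub>R \<psi> x \<partial>lebesgue) \<le> (\<integral>x. indicator (U - K) x \<partial>lebesgue)"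
  proof (rule integral_mono)
    show "integrable lebesgue (indicator (U - K) :: 'a \<Rightarrow> real)" using U(3) by (auto simp: fmeasurable_def)
    show "integrable lebesgue (\<lambda>x. indicator A x *\<^sub>R \<psi> x)" using iA unfolding set_integrable_def .
    show "indicator A x *\<^sub>R \<psi> x \<le> indicator (U - K) x" for x
    proof (cases "x \<in> A \<and> x \<in> U")
      case True
      then have "x \<in> U - K" using K(2) by auto
      then show ?thesis using \<psi>(6) True by simp
    next
      case False
      then have "x \<in> A \<Longrightarrow> \<psi> x = 0" using \<psi>(3)[of x] \<psi>(4) by blast
      then show ?thesis by (auto simp: indicator_def)
    qed
  qed
  also have "\<dots> = measure lebesgue (U - K)" by simp
  also have "\<dots> \<le> e/2" using U(3,4) e by (simp add: emeasure_eq_measure2 less_imp_le ennreal_less_iff)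
  finally have 4: "(LINT x:A|lebesgue. \<psi> x) \<le> e/2" unfolding set_lebesgue_integral_def .
  show "measure lebesgue ?S \<le> norm h * p + e" using 1 2 3 4 K(3) by linarith
qed

text \<open>Null sets are invisible to volume and perimeter. A Borel representative makes the
  indicator of its translates jointly measurable in the point and the shift, as Tonelli requires in
  \<open>isoperimetric_ball\<close>.\<close>

lemma lebesgue_borel_core:
  fixes A :: "'a::euclidean_space set"
  assumes "A \<in> sets lebesgue"
  obtains B where "B \<in> sets borel" "B \<subseteq> A" "emeasure lebesgue B = emeasure lebesgue A" "perimeter B = perimeter A"
proof -
  obtain S N N' where SN: "A = S \<union> N" "N \<subseteq> N'" "N' \<in> null_sets lborel" "S \<in> sets lborel"
    using sets_completionE[OF assms] by metis
  have N0: "N' \<in> null_sets lebesgue" using SN(3) by (rule null_sets_completionI)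
  have ae: "AE x in lebesgue. x \<in> S \<longleftrightarrow> x \<in> A"
    by (rule AE_I'[OF N0]) (use SN in auto)
  have Sl: "S \<in> sets lebesgue" using SN(4) by simp
  have "emeasure lebesgue S = emeasure lebesgue A" by (rule emeasure_eq_AE[OF ae Sl assms])
  moreover have "(LINT x:S|lebesgue. divergence F x) = (LINT x:A|lebesgue. divergence F x)" if "F \<in> C1_compact_support" for F
    using set_integrable_divergence[OF that Sl] set_integrable_divergence[OF that assms] ae
    unfolding set_lebesgue_integral_def set_integrable_def
    by (intro integral_cong_AE) (auto elim!: eventually_mono simp: indicator_def)
  then have "perimeter S = perimeter A"
    unfolding perimeter_def by (intro SUP_cong) auto
  ultimately show ?thesis using that[of S] SN by auto
qed

text \<open>On average over \<open>h\<close> in a ball of volume at least \<open>2 * a\<close>, the set and its translate by \<open>h\<close> overlap in at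
  most half of the volume, whereas the symmetric difference is controlled by the perimeter.\<close>

lemma isoperimetric_ball:
  fixes A :: "'a::euclidean_space set"
  assumes A: "A \<in> sets lebesgue" "emeasure lebesgue A = ennreal a" and a: "a > 0" and R: "R > 0"
    and p: "perimeter A = ennreal p" "p \<ge> 0"
    and ball: "ennreal (2 * a) \<le> emeasure lebesgue (ball (0::'a) R)"
  shows "a / 2 \<le> R * p"
proof (rule ccontr)
  assume neg: "\<not> a / 2 \<le> R * p"
  obtain B :: "'a set" where B: "B \<in> sets borel" "emeasure lebesgue B = ennreal a" "perimeter B = ennreal p"
    using lebesgue_borel_core[OF A(1)] A(2) p(1) by metis
  have Bs[measurable]: "B \<in> sets borel" by (rule B)
  have Bl: "B \<in> lmeasurable" using B by (auto simp: fmeasurable_def)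
  have mB: "measure lebesgue B = a" using B a by (simp add: measure_def)
  let ?T = "\<lambda>h. (\<lambda>x. h + x) ` B"
  have T[measurable]: "?T h \<in> lmeasurable" for h using Bl measurable_translation by blast
  have ov: "a - R * p \<le> measure lebesgue (B \<inter> ?T h)" if h: "norm h \<le> R" for h
  proof -
    have "measure lebesgue (?T h) = a" using mB by (simp add: measure_translation)
    moreover have "measure lebesgue (?T h) = measure lebesgue (?T h \<inter> B) + measure lebesgue (?T h - B)"
    proof -
      have "measure lebesgue (?T h - ?T h \<inter> B) = measure lebesgue (?T h) - measure lebesgue (?T h \<inter> B)"
        using T[of h] Bl by (intro measurable_measure_Diff) auto
      then show ?thesis by (simp add: Diff_Int)
    qed
    moreover have "measure lebesgue (?T h - B) \<le> norm h * p"
      by (rule measure_translate_diff_le[OF Bl B(3) p(2)])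
    moreover have "norm h * p \<le> R * p" using h p by (intro mult_right_mono) auto
    ultimately show ?thesis by (simp add: Int_commute)
  qed
  let ?J = "\<lambda>h x. indicator B x * indicator B (- h + x) :: ennreal"
  have eq: "(\<integral>\<^sup>+x. ?J h x \<partial>lborel) = emeasure lebesgue (B \<inter> ?T h)" for h
  proof -
    have T_eq: "?T h = {x. - h + x \<in> B}"
    proof (intro equalityI subsetI)
      fix x assume "x \<in> {x. - h + x \<in> B}"
      then show "x \<in> ?T h" by (intro image_eqI[of _ _ "- h + x"]) auto
    qed auto
    have "B \<inter> ?T h = {x. x \<in> B \<and> - h + x \<in> B}" unfolding T_eq by auto
    moreover have "{x \<in> space borel. x \<in> B \<and> - h + x \<in> B} \<in> sets borel" by measurable
    ultimately have "B \<inter> ?T h \<in> sets borel" by simp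
    then have "emeasure lebesgue (B \<inter> ?T h) = emeasure lborel (B \<inter> ?T h)"
      "emeasure lborel (B \<inter> ?T h) = (\<integral>\<^sup>+x. indicator (B \<inter> ?T h) x \<partial>lborel)"
      using emeasure_completion[of "B \<inter> ?T h" lborel] main_part[of "B \<inter> ?T h" lborel] sets_completionI_sets[of "B \<inter> ?T h" lborel]
      by (simp_all only: sets_lborel nn_integral_indicator simp_thms)
    then have "emeasure lebesgue (B \<inter> ?T h) = (\<integral>\<^sup>+x. indicator (B \<inter> ?T h) x \<partial>lborel)" by (rule trans)
    also have "\<dots> = (\<integral>\<^sup>+x. ?J h x \<partial>lborel)"
      by (intro nn_integral_cong) (auto simp: indicator_def T_eq)
    finally show ?thesis by (rule sym)
  qed
  \<comment> \<open>The overlap integrated over all shifts is exactly \<open>a * a\<close>, while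
    every shift in the ball contributes at least \<open>a - R * p\<close>. With ball volume at least
    \<open>2 * a\<close> this gives 2 (a - R p) \<le> a.\<close>
  have "ennreal (2 * a) * ennreal (a - R * p) \<le> emeasure lebesgue (ball (0::'a) R) * ennreal (a - R * p)"
    by (intro mult_right_mono ball) auto
  also have "\<dots> = (\<integral>\<^sup>+h\<in>ball (0::'a) R. ennreal (a - R * p) \<partial>lborel)"
    by (subst nn_integral_cmult_indicator) (auto simp: mult.commute)
  also have "\<dots> \<le> (\<integral>\<^sup>+h. \<integral>\<^sup>+x. ?J h x \<partial>lborel \<partial>lborel)"
  proof (rule nn_integral_mono)
    fix h :: 'a
    show "ennreal (a - R * p) * indicator (ball 0 R) h \<le> (\<integral>\<^sup>+x. ?J h x \<partial>lborel)"
    proof (cases "norm h < R")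
      case True
      then have "ennreal (a - R * p) \<le> ennreal (measure lebesgue (B \<inter> ?T h))" by (intro ennreal_leI ov) auto
      also have "\<dots> = emeasure lebesgue (B \<inter> ?T h)"
        by (intro emeasure_eq_measure2[symmetric] fmeasurable.Int Bl T)
      finally show ?thesis using True unfolding eq by simp
    qed simp
  qed
  also have "\<dots> = (\<integral>\<^sup>+x. \<integral>\<^sup>+h. ?J h x \<partial>lborel \<partial>lborel)"
    by (rule lborel_pair.Fubini') measurable
  also have "\<dots> = (\<integral>\<^sup>+x. indicator B x * (\<integral>\<^sup>+h. indicator B (- h + x) \<partial>lborel) \<partial>lborel)"
    by (subst nn_integral_cmult) auto
  also have "\<dots> = (\<integral>\<^sup>+x. indicator B x * ennreal a \<partial>lborel)"
  proof (intro nn_integral_cong arg_cong2[where f = "(*)"] refl)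
    fix x
    have "ennreal a = (\<integral>\<^sup>+h. indicator B h \<partial>lborel)" using B by simp
    also have "\<dots> = (\<integral>\<^sup>+h. indicator B (x + (- 1) *\<^sub>R h) \<partial>lborel)"
      by (subst lborel_affine[of "-1" x]) (auto simp: nn_integral_density nn_integral_distr)
    finally show "(\<integral>\<^sup>+h. indicator B (- h + x) \<partial>lborel) = ennreal a" by simp
  qed
  also have "\<dots> = ennreal a * ennreal a"
    using B by (subst nn_integral_multc) auto
  finally have "ennreal (2 * a * (a - R * p)) \<le> ennreal (a * a)"
    using a neg by (simp add: ennreal_mult)
  then have "2 * a * (a - R * p) \<le> a * a" using a by (simp add: ennreal_le_iff)
  then have "2 * (a - R * p) \<le> a" using a by (simp add: mult.assoc mult.left_commute)
  then show False using neg by simp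
qed

text \<open>\<open>R\<close> is chosen such that the ball has volume exactly \<open>2 * a\<close>,
  which makes it proportional to \<open>root N a\<close>. The quotient \<open>a / root N a\<close>
  stands for a powr ((N - 1) / N).\<close>

lemma isoperimetric:
  "\<exists>c>0. \<forall>(A :: 'a::euclidean_space set) a. A \<in> sets lebesgue \<longrightarrow> emeasure lebesgue A = ennreal a \<longrightarrow> a > 0 \<longrightarrow>
     ennreal (c * (a / root DIM('a) a)) \<le> perimeter A"
proof -
  define \<omega> where "\<omega> = unit_ball_vol (real DIM('a))"
  have \<omega>: "\<omega> > 0" unfolding \<omega>_def by (rule unit_ball_vol_pos) simp
  define \<gamma> where "\<gamma> = root DIM('a) (2 / \<omega>)"
  have \<gamma>: "\<gamma> > 0" unfolding \<gamma>_def using \<omega> by (simp add: real_root_gt_zero)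
  show ?thesis
  proof (intro exI[of _ "1 / (2 * \<gamma>)"] conjI allI impI)
    show "0 < 1 / (2 * \<gamma>)" using \<gamma> by simp
    fix A :: "'a set" and a assume A: "A \<in> sets lebesgue" "emeasure lebesgue A = ennreal a" and a: "a > 0"
    define R where "R = \<gamma> * root DIM('a) a"
    have ra: "root DIM('a) a > 0" using a by (simp add: real_root_gt_zero)
    have R: "R > 0" unfolding R_def using \<gamma> ra by simp
    have "\<omega> * R ^ DIM('a) = \<omega> * (2 / \<omega>) * a"
      unfolding R_def \<gamma>_def using \<omega> a by (simp add: power_mult_distrib)
    then have ball: "ennreal (2 * a) \<le> emeasure lebesgue (ball (0::'a) R)"
      using R \<omega> by (simp add: emeasure_ball \<omega>_def[symmetric])
    show "ennreal (1 / (2 * \<gamma>) * (a / root DIM('a) a)) \<le> perimeter A"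
    proof (cases "perimeter A")
      case (real p)
      then have "a / 2 \<le> R * p" by (intro isoperimetric_ball[OF A a R _ _ ball]) auto
      then have "1 / (2 * \<gamma>) * (a / root DIM('a) a) \<le> p"
        unfolding R_def using \<gamma> ra by (simp add: field_simps)
      then show ?thesis using real by (simp add: ennreal_leI)
    qed simp
  qed
qed

section \<open>Finite energy and subadditivity\<close>

lemma nn_integral_interval_witness:
  fixes f :: "real \<Rightarrow> ennreal"
  assumes "a < b" "c \<ge> 0" "(\<integral>\<^sup>+l\<in>{a..b}. f l \<partial>lborel) < ennreal (c * (b - a))"
  obtains l where "a \<le> l" "l \<le> b" "f l < ennreal c"
proof (rule ccontr)
  note witness = that
  assume neg: "\<not> thesis"
  have *: "ennreal c \<le> f l" if l: "a \<le> l" "l \<le> b" for l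
    using witness[OF l] neg by (meson not_less)
  have "ennreal (c * (b - a)) = (\<integral>\<^sup>+l. ennreal c * indicator {a..b} l \<partial>lborel)"
    using assms by (subst nn_integral_cmult_indicator) (auto simp: ennreal_mult)
  also have "\<dots> \<le> (\<integral>\<^sup>+l\<in>{a..b}. f l \<partial>lborel)"
    by (intro nn_integral_mono) (auto simp: indicator_def *)
  finally show False using assms(3) by simp
qed

section \<open>Functions whose levels serve as cuts\<close>

lemma C1_contraction_inner: "norm b \<le> 1 \<Longrightarrow> C1_contraction (\<lambda>x. x \<bullet> b)"
  unfolding C1_contraction_def
proof (intro exI[of _ "\<lambda>x v. v \<bullet> b"] conjI allI)
  show "((\<lambda>x. x \<bullet> b) has_derivative (\<lambda>v. v \<bullet> b)) (at x)" for x by (auto intro!: derivative_eq_intros)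
  assume b: "norm b \<le> 1"
  show "\<bar>v \<bullet> b\<bar> \<le> norm v" for v
  proof -
    have "\<bar>v \<bullet> b\<bar> \<le> norm v * norm b" by (rule Cauchy_Schwarz_ineq2)
    also have "\<dots> \<le> norm v * 1" by (intro mult_left_mono b) auto
    finally show ?thesis by simp
  qed
qed auto

text \<open>A smooth substitute for the distance to \<open>a\<close>, with the same level sets.\<close>

definition sdist :: "'a::euclidean_space \<Rightarrow> 'a \<Rightarrow> real" where
  "sdist a y = sqrt (1 + (y - a) \<bullet> (y - a))"

lemma sdist_ge: "1 \<le> sdist a y" "norm (y - a) \<le> sdist a y" "sdist a y \<le> norm (y - a) + 1"
proof -
  show "1 \<le> sdist a y" unfolding sdist_def by simp
  show "norm (y - a) \<le> sdist a y" unfolding sdist_def by (rule real_le_rsqrt) (simp add: power2_norm_eq_inner)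
  show "sdist a y \<le> norm (y - a) + 1" unfolding sdist_def
    by (rule real_le_lsqrt) (auto simp: power2_sum power2_norm_eq_inner)
qed

lemma sdist_0: "norm y \<le> sdist 0 y" "sdist 0 y \<le> norm y + 1"
  using sdist_ge[where a = 0 and y = y] by simp_all

lemma C1_contraction_sdist: "C1_contraction (sdist a)"
  unfolding C1_contraction_def
proof (intro exI[of _ "\<lambda>y v. ((y - a) \<bullet> v) / sdist a y"] conjI allI)
  have pos: "1 + (y - a) \<bullet> (y - a) > 0" for y by (simp add: add_pos_nonneg)
  show "(sdist a has_derivative (\<lambda>v. ((y - a) \<bullet> v) / sdist a y)) (at y)" for y
    unfolding sdist_def[abs_def]
    by (rule derivative_eq_intros refl pos | simp add: pos inner_commute field_simps)+
  have nz: "sdist a y \<noteq> 0" for y using sdist_ge(1)[of a y] by simp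
  have "continuous_on UNIV (sdist a)" unfolding sdist_def[abs_def] by (intro continuous_intros)
  then show "continuous_on UNIV (\<lambda>y. ((y - a) \<bullet> v) / sdist a y)" for v
    using nz by (intro continuous_intros) auto
  show "\<bar>((y - a) \<bullet> v) / sdist a y\<bar> \<le> norm v" for y v
  proof -
    have "\<bar>(y - a) \<bullet> v\<bar> \<le> norm (y - a) * norm v" by (rule Cauchy_Schwarz_ineq2)
    also have "\<dots> \<le> sdist a y * norm v" by (intro mult_right_mono sdist_ge) auto
    finally show ?thesis using sdist_ge(1)[of a y] by (simp add: abs_divide divide_le_eq mult.commute)
  qed
qed

text \<open>With \<open>g = sdist t\<close> this turns slabs around the level t of \<open>k\<close>
  into sublevel sets, so that shells are handled like half-spaces and balls.\<close>

lemma C1_contraction_compose: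
  fixes g :: "real \<Rightarrow> real"
  assumes "C1_contraction g" "C1_contraction k"
  shows "C1_contraction (\<lambda>x. g (k x))"
proof -
  obtain k' where k: "\<And>x. (k has_derivative k' x) (at x)" "\<And>v. continuous_on UNIV (\<lambda>x. k' x v)" "\<And>x v. \<bar>k' x v\<bar> \<le> norm v"
    using assms(2) unfolding C1_contraction_def by blast
  obtain g' where g: "\<And>x. (g has_derivative g' x) (at x)" "\<And>v. continuous_on UNIV (\<lambda>x. g' x v)" "\<And>x v. \<bar>g' x v\<bar> \<le> norm v"
    using assms(1) unfolding C1_contraction_def by blast
  have g1: "g' y v = v * g' y 1" for y v
    using linear_scale[OF has_derivative_linear[OF g(1)], of y v 1] by simp
  show ?thesis
    unfolding C1_contraction_def
  proof (intro exI[of _ "\<lambda>x v. g' (k x) (k' x v)"] conjI allI)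
    show "((\<lambda>x. g (k x)) has_derivative (\<lambda>v. g' (k x) (k' x v))) (at x)" for x
      by (rule has_derivative_compose[OF k(1) g(1)])
    have kc: "continuous_on UNIV k" by (rule C1_continuous[OF C1_contraction_C1[OF assms(2)]])
    have "continuous_on UNIV (\<lambda>x. k' x v * g' (k x) 1)" for v
      by (intro continuous_on_mult k(2) continuous_on_compose2[OF g(2) kc]) auto
    then show "continuous_on UNIV (\<lambda>x. g' (k x) (k' x v))" for v by (subst g1)
    show "\<bar>g' (k x) (k' x v)\<bar> \<le> norm v" for x v
      using g(3)[of "k x" "k' x v"] k(3)[of x v] by simp
  qed
qed

text \<open>The whole space is cut along a sphere whose radius is found by averaging. As the
  perimeter of the whole space is 0, the finite area of the cut bounds the perimeter of the
  ball.\<close>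

lemma ex_finite_energy:
  assumes lam: "0 < lam" "lam < real DIM('a)"
  shows "\<exists>(B :: 'a::euclidean_space set) b. B \<in> sets lebesgue \<and> emeasure lebesgue B = ennreal b \<and> 0 < b \<and> energy lam B < \<infinity>"
proof -

  let ?k = "sdist (0::'a)"
  let ?I = "\<integral>\<^sup>+l\<in>{3/2..2}. slice_area ?k UNIV l \<partial>lborel"
  let ?S = "{x\<in>UNIV. 3/2 < ?k x \<and> ?k x \<le> 3}"
  have km: "?k \<in> borel_measurable lebesgue" by (rule C1_contraction_measurable[OF C1_contraction_sdist])
  have U: "(UNIV::'a set) \<in> sets lebesgue" by simp
  have "?S \<subseteq> cball 0 3"
    using order_trans[OF sdist_0(1)] by auto
  then have "emeasure lebesgue ?S \<le> emeasure lebesgue (cball (0::'a) 3)"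
    by (rule emeasure_mono) simp
  also have "\<dots> < \<infinity>" by (simp add: emeasure_cball)
  finally have fin: "2 * emeasure lebesgue ?S < \<infinity>" by (simp add: ennreal_mult_less_top)
  have "?I \<le> 2 * emeasure lebesgue ?S"
    by (rule nn_integral_slice_area_interval[OF km U]) simp
  with fin have "?I < \<infinity>" by (rule order.strict_trans1[rotated])
  then obtain M where M: "M \<ge> 0" "?I = ennreal M"
    by (cases "?I") auto
  \<comment> \<open>The window has length 1/2, so the factor 2 M + 2 makes the right-hand side M +
    1.\<close>
  then have "?I < ennreal ((2 * M + 2) * (2 - 3/2))"
    by (simp add: ennreal_less_iff)
  from nn_integral_interval_witness[OF _ _ this]
  obtain l where l: "3/2 \<le> l" "l \<le> 2" "slice_area ?k UNIV l < ennreal (2 * M + 2)"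
    using M(1) by auto
  let ?B = "{x\<in>UNIV. ?k x \<le> l}"
  have Bm: "?B \<in> sets lebesgue" by (rule sets_lebesgue_le[OF U km])
  have "perimeter ?B \<le> perimeter ?B + perimeter {x\<in>UNIV. l < ?k x}" by simp
  also have "\<dots> \<le> perimeter (UNIV :: 'a set) + slice_area ?k UNIV l"
    by (rule perimeter_split[OF U C1_contraction_sdist])
  also have "\<dots> < \<infinity>" using l(3) by (simp add: perimeter_UNIV order.strict_trans[OF _ ennreal_less_top])
  finally have P: "perimeter ?B < \<infinity>" .
  have "?B \<subseteq> cball 0 2" using order_trans[OF order_trans[OF sdist_0(1)] l(2)] by auto
  then have "emeasure lebesgue ?B \<le> emeasure lebesgue (cball (0::'a) 2)" by (rule emeasure_mono) simp
  also have "\<dots> < \<infinity>" by (simp add: emeasure_cball)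
  finally have F: "emeasure lebesgue ?B < \<infinity>" .
  have "ball 0 (1/2) \<subseteq> ?B"
  proof
    fix x :: 'a assume "x \<in> ball 0 (1/2)"
    then show "x \<in> ?B" using sdist_0(2)[of x] l(1) by simp
  qed
  then have "emeasure lebesgue (ball (0::'a) (1/2)) \<le> emeasure lebesgue ?B" using Bm by (rule emeasure_mono)
  moreover have "emeasure lebesgue (ball (0::'a) (1/2)) > 0"
    by (simp add: emeasure_ball unit_ball_vol_pos)
  ultimately have pos: "emeasure lebesgue ?B > 0" by (rule order.strict_trans2[rotated])
  obtain b where b: "emeasure lebesgue ?B = ennreal b" "b > 0" using F pos by (cases "emeasure lebesgue ?B") auto
  have "energy lam ?B < \<infinity>" unfolding energy_def using P riesz_energy_finite[OF lam Bm F] by simp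
  with Bm b show ?thesis by blast
qed

text \<open>Finite volume makes cheap cuts available far out: the slice areas have total integral at
  most 2 a, so a long enough window beyond a half-space that holds all but \<delta> of the mass
  contains a level with area below \<delta>.\<close>

lemma halfspace_truncation:
  fixes A :: "'a::euclidean_space set"
  assumes A: "A \<in> sets lebesgue" "emeasure lebesgue A = ennreal a" "a \<ge> 0" and e: "norm e \<le> 1" and \<delta>: "\<delta> > 0"
  shows "\<exists>R a'. emeasure lebesgue {x\<in>A. x \<bullet> e \<le> R} = ennreal a' \<and> a - \<delta> \<le> a' \<and> 0 \<le> a' \<and> a' \<le> a \<and>
     perimeter {x\<in>A. x \<bullet> e \<le> R} \<le> perimeter A + ennreal \<delta>"
proof -
  let ?k = "\<lambda>x. x \<bullet> e" and ?A = "\<lambda>R. {x\<in>A. x \<bullet> e \<le> R}"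
  have k: "C1_contraction ?k" by (rule C1_contraction_inner[OF e])
  have km: "?k \<in> borel_measurable lebesgue" by (rule C1_contraction_measurable[OF k])
  have Am: "?A R \<in> sets lebesgue" for R by (rule sets_lebesgue_le[OF A(1) km])
  have Al: "A \<in> lmeasurable" using A by (auto simp: fmeasurable_def)
  have mA: "measure lebesgue A = a" using A by (simp add: measure_def)
  have Asub: "?A R \<in> lmeasurable" for R by (rule fmeasurableI2[OF Al _ Am]) auto
  have un: "(\<Union>n. ?A (real n)) = A" by (auto simp: real_arch_simple)
  have "(\<lambda>n. measure lebesgue (?A (real n))) \<longlonglongrightarrow> measure lebesgue (\<Union>n. ?A (real n))"
  proof (rule Lim_measure_incseq)
    show "range (\<lambda>n. ?A (real n)) \<subseteq> sets lebesgue" using Am by auto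
    show "incseq (\<lambda>n. ?A (real n))"
    proof (rule incseq_SucI)
      show "?A (real n) \<subseteq> ?A (real (Suc n))" for n by auto
    qed
    show "emeasure lebesgue (\<Union>n. ?A (real n)) \<noteq> \<infinity>" unfolding un using A by simp
  qed
  then have "(\<lambda>n. measure lebesgue (?A (real n))) \<longlonglongrightarrow> a" unfolding un mA .
  then have "\<forall>\<^sub>F n in sequentially. measure lebesgue (?A (real n)) > a - \<delta>"
    by (rule order_tendstoD) (use \<delta> in auto)
  then obtain n where n: "measure lebesgue (?A (real n)) > a - \<delta>"
    using eventually_happens by fastforce
  \<comment> \<open>The length is chosen such that \<delta> L = 2 a + 1 exceeds the total 2
    a.\<close>
  define L where "L = (2 * a + 1) / \<delta>"
  have L: "L > 0" unfolding L_def using A \<delta> by simp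
  have "(\<integral>\<^sup>+l\<in>{real n..real n + L}. slice_area ?k A l \<partial>lborel) \<le> (\<integral>\<^sup>+l. slice_area ?k A l \<partial>lborel)"
    by (intro nn_integral_mono) (auto simp: indicator_def)
  also have "\<dots> \<le> 2 * emeasure lebesgue A" by (rule nn_integral_slice_area[OF km A(1)])
  also have "\<dots> = ennreal (2 * a)" using A by (simp add: ennreal_mult)
  also have "\<dots> < ennreal (\<delta> * (real n + L - real n))" unfolding L_def using A \<delta> by (simp add: ennreal_less_iff)
  finally have less: "(\<integral>\<^sup>+l\<in>{real n..real n + L}. slice_area ?k A l \<partial>lborel) < ennreal (\<delta> * (real n + L - real n))" .
  have "real n < real n + L" using L by simp
  then obtain R where R: "real n \<le> R" "R \<le> real n + L" "slice_area ?k A R < ennreal \<delta>"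
    by (rule nn_integral_interval_witness[OF _ less_imp_le[OF \<delta>] less])
  have "perimeter (?A R) \<le> perimeter (?A R) + perimeter {x\<in>A. R < x \<bullet> e}" by simp
  also have "\<dots> \<le> perimeter A + slice_area ?k A R" by (rule perimeter_split[OF A(1) k])
  also have "\<dots> \<le> perimeter A + ennreal \<delta>" using R by (intro add_left_mono) auto
  finally have P: "perimeter (?A R) \<le> perimeter A + ennreal \<delta>" .
  have m1: "measure lebesgue (?A (real n)) \<le> measure lebesgue (?A R)"
    by (rule measure_mono_fmeasurable) (use R Am Asub in auto)
  have m2: "measure lebesgue (?A R) \<le> a"
    unfolding mA[symmetric] by (rule measure_mono_fmeasurable) (use Am Al in auto)
  have em: "emeasure lebesgue (?A R) = ennreal (measure lebesgue (?A R))"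
    by (rule emeasure_eq_measure2[OF Asub])
  have m0: "a - \<delta> \<le> measure lebesgue (?A R)" using n m1 by linarith
  show ?thesis
    by (rule exI[of _ R], rule exI[of _ "measure lebesgue (?A R)"], intro conjI em m0 m2 P measure_nonneg)
qed

text \<open>Separation along a single axis is enough: \<open>A\<close> is truncated from above and
  \<open>B\<close> from below in direction \<open>e\<close>, and a translation pushes the second
  beyond the first. The error 3 \<delta> consists of two truncations and the remaining
  interaction.\<close>

lemma far_apart_competitor:
  fixes A B :: "'a::euclidean_space set"
  assumes lam: "lam > 0"
    and A: "A \<in> sets lebesgue" "emeasure lebesgue A = ennreal a" "a \<ge> 0"
    and B: "B \<in> sets lebesgue" "emeasure lebesgue B = ennreal b" "b \<ge> 0"
    and \<delta>: "\<delta> > 0"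
  shows "\<exists>(C :: 'a set) c. C \<in> sets lebesgue \<and> emeasure lebesgue C = ennreal c \<and> a + b - 2 * \<delta> \<le> c \<and> c \<le> a + b \<and>
     energy lam C \<le> energy lam A + energy lam B + ennreal (3 * \<delta>)"
proof -
  obtain e :: 'a where e: "e \<in> Basis" using nonempty_Basis by blast
  have e1: "norm e = 1" "e \<bullet> e = 1" using e by (auto simp: inner_Basis)
  have e2: "norm (- e) \<le> 1" using e1 by simp
  obtain R1 a' where R1: "emeasure lebesgue {x\<in>A. x \<bullet> e \<le> R1} = ennreal a'" "a - \<delta> \<le> a'" "0 \<le> a'" "a' \<le> a"
     "perimeter {x\<in>A. x \<bullet> e \<le> R1} \<le> perimeter A + ennreal \<delta>"
    using halfspace_truncation[OF A eq_refl[OF e1(1)] \<delta>] by blast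
  obtain R2 b' where R2: "emeasure lebesgue {x\<in>B. x \<bullet> (- e) \<le> R2} = ennreal b'" "b - \<delta> \<le> b'" "0 \<le> b'" "b' \<le> b"
     "perimeter {x\<in>B. x \<bullet> (- e) \<le> R2} \<le> perimeter B + ennreal \<delta>"
    using halfspace_truncation[OF B e2 \<delta>] by blast
  let ?A = "{x\<in>A. x \<bullet> e \<le> R1}" and ?B = "{x\<in>B. x \<bullet> (- e) \<le> R2}"
  have Am: "?A \<in> sets lebesgue" by (rule sets_lebesgue_le[OF A(1)]) measurable
  have Bm: "?B \<in> sets lebesgue" by (rule sets_lebesgue_le[OF B(1)]) measurable
  \<comment> \<open>\<open>Q\<close> is the value of D powr \<open>lam\<close> at which the
    interaction, at most a b / Q, drops below \<delta>.\<close>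
  define Q where "Q = (a * b + 1) / \<delta>"
  define D where "D = Q powr (1 / lam)"
  have ab: "a * b \<ge> 0" using A B by simp
  have q: "Q > 0" unfolding Q_def using ab \<delta> by (intro divide_pos_pos add_nonneg_pos) auto
  have D: "D > 0" unfolding D_def using q by simp
  have Dl: "D powr lam = Q" unfolding D_def using q lam by (simp add: powr_powr)
  \<comment> \<open>The truncated sets lie in \<open>x \<bullet> e \<le> R1\<close> and
    \<open>x \<bullet> e \<ge> - R2\<close>, so this shift leaves a gap of width
    \<open>D\<close>.\<close>
  define d where "d = D + R1 + R2"
  let ?T = "\<lambda>x. d *\<^sub>R e + 1 *\<^sub>R x"
  let ?B' = "?T ` ?B"
  have TBm: "?B' \<in> sets lebesgue" by (rule sets_lebesgue_affine_image[OF Bm]) simp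
  have sep: "norm (x - y) \<ge> D" if x: "x \<in> ?A" and y: "y \<in> ?B'" for x y
  proof -
    obtain z where z: "y = ?T z" "z \<in> ?B" using y by (rule imageE)
    have "D \<le> (y - x) \<bullet> e"
      using x z e1 by (simp add: d_def inner_diff_left inner_add_left)
    also have "\<dots> \<le> norm (y - x) * norm e" by (rule norm_cauchy_schwarz)
    finally show ?thesis using e1 by (simp add: norm_minus_commute)
  qed
  have dis: "?A \<inter> ?B' = {}"
  proof (rule ccontr)
    assume "?A \<inter> ?B' \<noteq> {}"
    then obtain x where x: "x \<in> ?A \<inter> ?B'" by (meson ex_in_conv)
    from sep[OF IntD1[OF x] IntD2[OF x]] D show False by simp
  qed
  let ?C = "?A \<union> ?B'"
  have eT: "emeasure lebesgue ?B' = ennreal b'"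
    using emeasure_lebesgue_affine_image[of 1 "d *\<^sub>R e" ?B] R2(1) by simp
  have C: "?C \<in> sets lebesgue" using Am TBm by blast
  have eC: "emeasure lebesgue ?C = ennreal (a' + b')"
    unfolding plus_emeasure[OF Am TBm dis, symmetric] R1(1) eT
    by (rule ennreal_plus[symmetric, OF R1(3) R2(3)])
  have cross: "interaction lam ?A ?B' \<le> ennreal \<delta>"
  proof -
    have "interaction lam ?A ?B' \<le> ennreal (1 / D powr lam) * (emeasure lebesgue ?A * emeasure lebesgue ?B')"
      by (rule interaction_le_separated[OF lam Am TBm D sep])
    also have "\<dots> = ennreal (1 / D powr lam * (a' * b'))"
    proof -
      have "ennreal a' * ennreal b' = ennreal (a' * b')"
        by (rule ennreal_mult[symmetric, OF R1(3) R2(3)])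
      moreover have "ennreal (1 / D powr lam) * ennreal (a' * b') = ennreal (1 / D powr lam * (a' * b'))"
        by (rule ennreal_mult[symmetric]) (use R1(3) R2(3) in auto)
      ultimately show ?thesis unfolding eT R1(1) by (simp only:)
    qed
    also have "\<dots> \<le> ennreal \<delta>"
    proof (rule ennreal_leI)
      have "a' * b' \<le> a * b" by (rule mult_mono[OF R1(4) R2(4) A(3) R2(3)])
      then have "a' * b' \<le> a * b + 1" by simp
      then have "1 / D powr lam * (a' * b') \<le> 1 / D powr lam * (a * b + 1)"
        by (intro mult_left_mono) auto
      also have "\<dots> = \<delta>" unfolding Dl Q_def using ab \<delta> by simp
      finally show "1 / D powr lam * (a' * b') \<le> \<delta>" .
    qed
    finally show ?thesis .
  qed
  have tA: "energy lam ?A \<le> energy lam A + ennreal \<delta>"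
    unfolding energy_def using add_mono[OF R1(5) riesz_energy_mono[OF Am A(1), of lam]] by (auto simp: ac_simps)
  have tB: "energy lam ?B \<le> energy lam B + ennreal \<delta>"
    unfolding energy_def using add_mono[OF R2(5) riesz_energy_mono[OF Bm B(1), of lam]] by (auto simp: ac_simps)
  have "energy lam ?C \<le> (perimeter ?A + perimeter ?B') + (riesz_energy lam ?A + riesz_energy lam ?B' + interaction lam ?A ?B')"
    unfolding energy_def riesz_energy_Un[OF Am TBm dis] by (intro add_right_mono perimeter_Un_disjoint Am TBm dis)
  also have "\<dots> = energy lam ?A + energy lam ?B' + interaction lam ?A ?B'"
    unfolding energy_def by (simp add: ac_simps)
  also have "energy lam ?B' \<le> energy lam ?B"
    using energy_affine_image[OF Bm order_refl lam, of "d *\<^sub>R e"] by simp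
  also have "energy lam ?A + energy lam ?B + interaction lam ?A ?B'
     \<le> (energy lam A + ennreal \<delta>) + (energy lam B + ennreal \<delta>) + ennreal \<delta>"
    by (intro add_mono tA tB cross)
  also have "\<dots> = energy lam A + energy lam B + (ennreal \<delta> + ennreal \<delta> + ennreal \<delta>)" by (simp add: ac_simps)
  also have "ennreal \<delta> + ennreal \<delta> + ennreal \<delta> = ennreal (3 * \<delta>)" using \<delta> by (simp flip: ennreal_plus)
  finally have "energy lam ?C \<le> energy lam A + energy lam B + ennreal (3 * \<delta>)" by (simp add: add_mono)
  with C eC R1 R2 show ?thesis by (intro exI[of _ ?C] exI[of _ "a' + b'"]) auto
qed

text \<open>The far-apart competitors miss mass up to 2 \<delta>; a dilation restores it at a factor
  tending to 1, and \<delta> is sent to 0. The right-hand side has given sets instead of two infima,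
  so that the parts of a cut minimizer, possibly null, can be inserted directly.\<close>

lemma min_energy_subadditive:
  fixes A B :: "'a::euclidean_space set"
  assumes lam: "lam > 0"
    and A: "A \<in> sets lebesgue" "emeasure lebesgue A = ennreal a" "a \<ge> 0"
    and B: "B \<in> sets lebesgue" "emeasure lebesgue B = ennreal b" "b \<ge> 0"
    and m: "m = a + b" "m > 0"
  shows "min_energy TYPE('a) lam m \<le> energy lam A + energy lam B"
proof (cases "energy lam A + energy lam B")
  case (real E)
  let ?f = "\<lambda>\<delta>. ennreal ((m / (m - 2 * \<delta>))\<^sup>2 * (E + 3 * \<delta>))"
  have le: "min_energy TYPE('a) lam m \<le> ?f \<delta>" if \<delta>: "0 < \<delta>" "2 * \<delta> < m" for \<delta>
  proof -
    obtain C :: "'a set" and c where C: "C \<in> sets lebesgue" "emeasure lebesgue C = ennreal c" "m - 2 * \<delta> \<le> c" "c \<le> m"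
      "energy lam C \<le> energy lam A + energy lam B + ennreal (3 * \<delta>)"
      using far_apart_competitor[OF lam A B \<delta>(1)] unfolding m(1) by blast
    have "min_energy TYPE('a) lam m \<le> ennreal ((m / c)\<^sup>2) * energy lam C"
      by (rule min_energy_le_dilation[OF C(1,2) _ C(4) lam]) (use C \<delta> in auto)
    also have "\<dots> \<le> ennreal ((m / (m - 2 * \<delta>))\<^sup>2) * ennreal (E + 3 * \<delta>)"
    proof (intro mult_mono ennreal_leI power_mono divide_left_mono)
      show "energy lam C \<le> ennreal (E + 3 * \<delta>)"
        using C(5) ennreal_plus[OF real(1), of "3 * \<delta>"] \<delta> unfolding real(2) by simp
    qed (use C \<delta> m in auto)
    also have "\<dots> = ?f \<delta>" using real \<delta> by (simp add: ennreal_mult)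
    finally show ?thesis .
  qed
  have d: "(\<lambda>n. inverse (real (Suc n))) \<longlonglongrightarrow> 0" by (rule LIMSEQ_inverse_real_of_nat)
  have lim: "(\<lambda>n. ?f (inverse (real (Suc n)))) \<longlonglongrightarrow> ?f 0"
    by (intro tendsto_intros d) (use m in auto)
  have "\<forall>\<^sub>F n in sequentially. inverse (real (Suc n)) < m / 2"
    by (rule order_tendstoD(2)[OF d]) (use m in auto)
  then have ev: "\<forall>\<^sub>F n in sequentially. min_energy TYPE('a) lam m \<le> ?f (inverse (real (Suc n)))"
  proof (rule eventually_mono)
    fix n assume n: "inverse (real (Suc n)) < m / 2"
    show "min_energy TYPE('a) lam m \<le> ?f (inverse (real (Suc n)))"
    proof (rule le)
      show "0 < inverse (real (Suc n))" by simp
      show "2 * inverse (real (Suc n)) < m" using n by linarith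
    qed
  qed
  have "min_energy TYPE('a) lam m \<le> ?f 0"
    by (rule tendsto_lowerbound[OF lim ev]) simp
  then show ?thesis using m real by simp
next
  case top
  then show ?thesis by (simp only: top_greatest)
qed

text \<open>Splitting off copies of one set of mass \<open>b\<close> costs \<open>e\<close> each, by
  subadditivity. What remains has mass between b and 2 b and is reached by a dilation, at a factor
  of at most 4.\<close>

lemma min_energy_linear_bound:
  assumes lam: "0 < lam" "lam < real DIM('a::euclidean_space)"
  shows "\<exists>C \<mu>. C > 0 \<and> \<mu> > 0 \<and> (\<forall>m\<ge>\<mu>. min_energy TYPE('a) lam m \<le> ennreal (C * m))"
proof -
  obtain B :: "'a set" and b where B: "B \<in> sets lebesgue" "emeasure lebesgue B = ennreal b" "0 < b" "energy lam B < \<infinity>"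
    using ex_finite_energy[OF lam] by blast
  then obtain e where e: "energy lam B = ennreal e" "e \<ge> 0" by (cases "energy lam B") auto
  \<comment> \<open>\<open>s\<close> strictly exceeds the initial cost 4 e and the cost e of a step.
    Strictness is carried through the induction because the infimum may not be attained: only
    \<open>?E m < t\<close> yields a set of energy at most t.\<close>
  define s where "s = 4 * e + 1"
  have s: "s > 0" "s > e" unfolding s_def using e by auto
  let ?E = "min_energy TYPE('a) lam" and ?t = "\<lambda>n. ennreal ((real n + 1) * s)"
  have base: "?E m \<le> ennreal (4 * e)" if m: "b \<le> m" "m \<le> 2 * b" for m
  proof -
    have mb: "m / b \<le> 2" using m(2) B(3) by (simp add: divide_le_eq)
    have mb0: "0 \<le> m / b" using m(1) B(3) by simp
    have "(m / b)\<^sup>2 \<le> 2\<^sup>2" using mb mb0 by (rule power_mono)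
    then have sq: "(m / b)\<^sup>2 \<le> 4" by simp
    have "?E m \<le> ennreal ((m / b)\<^sup>2) * energy lam B"
      by (rule min_energy_le_dilation[OF B(1,2,3) m(1) lam(1)])
    also have "\<dots> = ennreal ((m / b)\<^sup>2 * e)"
      unfolding e(1) by (rule ennreal_mult[symmetric]) (use e(2) in auto)
    also have "\<dots> \<le> ennreal (4 * e)"
      by (intro ennreal_leI mult_right_mono sq e(2))
    finally show ?thesis .
  qed
  have ex: "\<exists>A::'a set. A \<in> sets lebesgue \<and> emeasure lebesgue A = ennreal m \<and> energy lam A \<le> ennreal t"
    if "?E m < ennreal t" for m t
  proof -
    obtain A :: "'a set" where "A \<in> sets_of_mass m" "energy lam A < ennreal t"
      using \<open>?E m < ennreal t\<close> unfolding min_energy_def INF_less_iff by blast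
    then show ?thesis unfolding sets_of_mass_def using less_imp_le by blast
  qed
  have P: "\<forall>m. b \<le> m \<and> m \<le> (real n + 2) * b \<longrightarrow> ?E m < ?t n" for n
  proof (induction n)
    case 0
    show ?case
    proof (intro allI impI, elim conjE)
      fix m assume m: "b \<le> m" "m \<le> (real 0 + 2) * b"
      have "m \<le> 2 * b" using m(2) by simp
      with m(1) have "?E m \<le> ennreal (4 * e)" by (rule base)
      also have "\<dots> < ennreal ((real 0 + 1) * s)"
      proof (rule ennreal_lessI)
        show "0 < (real 0 + 1) * s" using s by simp
        show "4 * e < (real 0 + 1) * s" unfolding s_def by simp
      qed
      finally show "?E m < ennreal ((real 0 + 1) * s)" .
    qed
  next
    case (Suc n)
    show ?case
    proof (intro allI impI, elim conjE)
      fix m assume m: "b \<le> m" "m \<le> (real (Suc n) + 2) * b"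
      show "?E m < ?t (Suc n)"
      proof (cases "m \<le> (real n + 2) * b")
        case True
        then have "?E m < ?t n" using Suc m by blast
        also have "\<dots> \<le> ?t (Suc n)" using s by (intro ennreal_leI mult_right_mono) auto
        finally show ?thesis .
      next
        case False
        have "b \<le> (real n + 1) * b" using B(3) by simp
        also have "\<dots> \<le> m - b" using False by (simp add: algebra_simps)
        finally have mb: "b \<le> m - b" .
        moreover have "m - b \<le> (real n + 2) * b" using m by (simp add: algebra_simps)
        ultimately have "?E (m - b) < ?t n" using Suc by blast
        then obtain A :: "'a set" where A: "A \<in> sets lebesgue" "emeasure lebesgue A = ennreal (m - b)" "energy lam A \<le> ?t n"
          using ex by blast
        have "?E m \<le> energy lam A + energy lam B"
          by (rule min_energy_subadditive[OF lam(1) A(1,2) _ B(1,2)]) (use mb B(3) in auto)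
        also have "\<dots> \<le> ?t n + ennreal e" unfolding e(1) by (intro add_right_mono A)
        also have "\<dots> = ennreal ((real n + 1) * s + e)" using s e by (simp add: ennreal_plus)
        also have "\<dots> < ?t (Suc n)"
        proof (rule ennreal_lessI)
          show "(real n + 1) * s + e < (real (Suc n) + 1) * s" using s by (simp add: algebra_simps)
          show "0 < (real (Suc n) + 1) * s" using s by simp
        qed
        finally show ?thesis .
      qed
    qed
  qed
  show ?thesis
  proof (rule exI[of _ "2 * s / b"], rule exI[of _ b], intro conjI allI impI)
    fix m assume m: "b \<le> m"
    define n where "n = nat \<lfloor>m / b\<rfloor>"
    have "m / b \<ge> 1" using m B by simp
    then have n: "real n \<le> m / b" "m / b \<le> real n + 1" unfolding n_def by linarith+
    have "m \<le> (real n + 1) * b" using n(2) B by (simp add: divide_le_eq)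
    also have "\<dots> \<le> (real n + 2) * b" using B by simp
    finally have "?E m < ?t n" using P[of n] m by blast
    also have "\<dots> \<le> ennreal (2 * s / b * m)"
    proof (rule ennreal_leI)
      \<comment> \<open>Here n + 1 \<le> 2 m / b, since n \<le> m / b and 1 \<le> m / b; this is the
        origin of the constant 2 s / b.\<close>
      have "(real n + 1) * s \<le> (2 * (m / b)) * s" using n \<open>m / b \<ge> 1\<close> s by (intro mult_right_mono) auto
      then show "(real n + 1) * s \<le> 2 * s / b * m" by (simp add: ac_simps)
    qed
    finally show "?E m \<le> ennreal (2 * s / b * m)" by simp
  qed (use s B in auto)
qed

section \<open>Minimizers\<close>

lemma is_minimizerD:
  assumes "is_minimizer lam m (\<Omega> :: 'a::euclidean_space set)"
  shows "\<Omega> \<in> sets lebesgue" "emeasure lebesgue \<Omega> = ennreal m" "energy lam \<Omega> = min_energy TYPE('a) lam m"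
  using assms unfolding is_minimizer_def sets_of_mass_def by auto

abbreviation sub_mass :: "'a::euclidean_space set \<Rightarrow> ('a \<Rightarrow> real) \<Rightarrow> real \<Rightarrow> real" where
  "sub_mass \<Omega> k l \<equiv> measure lebesgue {x\<in>\<Omega>. k x \<le> l}"

lemma lmeasurable_level_parts:
  fixes \<Omega> :: "'a::euclidean_space set" and k :: "'a \<Rightarrow> real"
  assumes \<Omega>: "\<Omega> \<in> sets lebesgue" "emeasure lebesgue \<Omega> = ennreal m" "m \<ge> 0"
    and k: "k \<in> borel_measurable lebesgue"
  shows "{x\<in>\<Omega>. k x \<le> l} \<in> lmeasurable" "{x\<in>\<Omega>. l < k x} \<in> lmeasurable"
    "sub_mass \<Omega> k l + measure lebesgue {x\<in>\<Omega>. l < k x} = m"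
proof -
  have \<Omega>l: "\<Omega> \<in> lmeasurable" using \<Omega> by (simp add: fmeasurable_def)
  show A: "{x\<in>\<Omega>. k x \<le> l} \<in> lmeasurable"
    by (rule fmeasurableI2[OF \<Omega>l _ sets_lebesgue_le(1)[OF \<Omega>(1) k]]) blast
  show B: "{x\<in>\<Omega>. l < k x} \<in> lmeasurable"
    by (rule fmeasurableI2[OF \<Omega>l _ sets_lebesgue_le(2)[OF \<Omega>(1) k]]) blast
  have "measure lebesgue ({x\<in>\<Omega>. k x \<le> l} \<union> {x\<in>\<Omega>. l < k x}) = sub_mass \<Omega> k l + measure lebesgue {x\<in>\<Omega>. l < k x}"
    by (rule measure_Un2[OF A B, THEN trans]) (auto intro!: arg_cong[of _ _ "measure lebesgue"])
  moreover have "{x\<in>\<Omega>. k x \<le> l} \<union> {x\<in>\<Omega>. l < k x} = \<Omega>" by auto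
  moreover have "measure lebesgue \<Omega> = m" using \<Omega> by (simp add: measure_def)
  ultimately show "sub_mass \<Omega> k l + measure lebesgue {x\<in>\<Omega>. l < k x} = m" by simp
qed

text \<open>Moving the two parts of a minimizer far apart cannot lower the energy.\<close>

lemma interaction_le_slice_area:
  fixes \<Omega> :: "'a::euclidean_space set"
  assumes lam: "lam > 0" and min: "is_minimizer lam m \<Omega>" and m: "m > 0" and fin: "min_energy TYPE('a) lam m < \<infinity>"
    and k: "C1_contraction k"
  shows "interaction lam {x\<in>\<Omega>. k x \<le> l} {x\<in>\<Omega>. l < k x} \<le> slice_area k \<Omega> l"
proof -
  note \<Omega> = is_minimizerD[OF min]
  let ?A = "{x\<in>\<Omega>. k x \<le> l}" and ?B = "{x\<in>\<Omega>. l < k x}"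
  have km: "k \<in> borel_measurable lebesgue" by (rule C1_contraction_measurable[OF k])
  note parts = lmeasurable_level_parts[OF \<Omega>(1,2) less_imp_le[OF m] km, of l]
  have A: "?A \<in> sets lebesgue" and B: "?B \<in> sets lebesgue" using parts by (auto dest: fmeasurableD)
  have "energy lam \<Omega> \<le> energy lam ?A + energy lam ?B"
    unfolding \<Omega>(3)
    by (rule min_energy_subadditive[OF lam A emeasure_eq_measure2[OF parts(1)] measure_nonneg B
        emeasure_eq_measure2[OF parts(2)] measure_nonneg parts(3)[symmetric] m])
  also have "\<dots> = (perimeter ?A + perimeter ?B) + (riesz_energy lam ?A + riesz_energy lam ?B)"
    unfolding energy_def by (simp add: ac_simps)
  also have "\<dots> \<le> (perimeter \<Omega> + slice_area k \<Omega> l) + (riesz_energy lam ?A + riesz_energy lam ?B)"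
    by (intro add_right_mono perimeter_split \<Omega> k)
  finally have 1: "energy lam \<Omega> \<le> (perimeter \<Omega> + (riesz_energy lam ?A + riesz_energy lam ?B)) + slice_area k \<Omega> l"
    by (simp add: ac_simps)
  have AB: "?A \<union> ?B = \<Omega>" "?A \<inter> ?B = {}" by auto
  have 2: "energy lam \<Omega> = (perimeter \<Omega> + (riesz_energy lam ?A + riesz_energy lam ?B)) + interaction lam ?A ?B"
    unfolding energy_def using riesz_energy_Un[OF A B AB(2), of lam] unfolding AB(1) by (simp add: ac_simps)
  \<comment> \<open>Finiteness permits cancelling the common part of \<open>1\<close> and
    \<open>2\<close> in \<open>ennreal\<close>.\<close>
  have "energy lam \<Omega> < \<infinity>" using fin \<Omega>(3) by simp
  then have "perimeter \<Omega> + (riesz_energy lam ?A + riesz_energy lam ?B) \<noteq> \<infinity>" unfolding 2 by auto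
  then show ?thesis using 1 unfolding 2 by (simp add: ennreal_add_left_cancel_le)
qed

lemma emeasure_lborel_Ico_ennreal: "emeasure lborel {u..<v::real} = ennreal (v - u)"
  by (cases "u \<le> v") (auto simp: ennreal_neg)

text \<open>Truncation makes \<open>ennreal ((y - x) \<bullet> b)\<close> a positive part, which is
  the length of the set of levels l with \<open>x \<bullet> b \<le> l\<close> and
  \<open>l < y \<bullet> b\<close>. By Tonelli the left-hand side is therefore the integral over l
  of the interaction across the hyperplane at level l, which the slice areas dominate.\<close>

lemma nn_integral_directional:
  fixes \<Omega> :: "'a::euclidean_space set"
  assumes lam: "lam > 0" and min: "is_minimizer lam m \<Omega>" and m: "m > 0" and fin: "min_energy TYPE('a) lam m < \<infinity>"
    and b: "norm b \<le> 1"
  shows "(\<integral>\<^sup>+x\<in>\<Omega>. (\<integral>\<^sup>+y\<in>\<Omega>. ennreal (1 / norm (x - y) powr lam) * ennreal ((y - x) \<bullet> b) \<partial>lebesgue) \<partial>lebesgue) \<le> 2 * ennreal m"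
proof -

  note \<Omega> = is_minimizerD[OF min]
  have [measurable]: "\<Omega> \<in> sets lebesgue" by (rule \<Omega>)
  interpret S: sigma_finite_measure "lebesgue :: 'a measure" by (rule sigma_finite_lebesgue)
  interpret P: pair_sigma_finite "lborel :: real measure" "lebesgue :: 'a measure"
    by (simp add: pair_sigma_finite_def sigma_finite_lebesgue lborel.sigma_finite_measure_axioms)
  let ?K = "\<lambda>x y. ennreal (1 / norm (x - y) powr lam)"
  let ?I = "\<lambda>l x y. indicator {x \<bullet> b..<y \<bullet> b} l :: ennreal"
  let ?G = "\<lambda>l x y. ?K x y * ?I l x y * indicator \<Omega> y * indicator \<Omega> x"
  \<comment> \<open>The interval depends on x and y; written as a condition, its indicator is
    visibly measurable in l, x and y jointly.\<close>
  have I: "?I l x y = (if x \<bullet> b \<le> l \<and> l < y \<bullet> b then 1 else 0)" for l x y by (auto simp: indicator_def)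
  have m3: "(\<lambda>(z, y). ?K (snd z) y * ?I (fst z) (snd z) y * indicator \<Omega> y * indicator \<Omega> (snd z))
     \<in> borel_measurable (((lborel :: real measure) \<Otimes>\<^sub>M lebesgue) \<Otimes>\<^sub>M lebesgue)"
    unfolding I by measurable
  have m2: "(\<lambda>(l, x). \<integral>\<^sup>+y. ?G l x y \<partial>lebesgue)
     \<in> borel_measurable ((lborel :: real measure) \<Otimes>\<^sub>M lebesgue)"
    using S.borel_measurable_nn_integral[OF m3] by (simp only: case_prod_unfold)
  have m1: "(\<lambda>(l, y). ?G l x y)
     \<in> borel_measurable ((lborel :: real measure) \<Otimes>\<^sub>M lebesgue)" for x
    unfolding I by measurable
  have "(\<integral>\<^sup>+x\<in>\<Omega>. (\<integral>\<^sup>+y\<in>\<Omega>. ?K x y * ennreal ((y - x) \<bullet> b) \<partial>lebesgue) \<partial>lebesgue)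
     = (\<integral>\<^sup>+x. \<integral>\<^sup>+y. \<integral>\<^sup>+l. ?G l x y \<partial>lborel \<partial>lebesgue \<partial>lebesgue)"
  proof (intro nn_integral_cong)
    fix x :: 'a
    have "(\<integral>\<^sup>+l. ?G l x y \<partial>lborel)
       = (?K x y * ennreal ((y - x) \<bullet> b) * indicator \<Omega> y) * indicator \<Omega> x" for y
    proof -
      have "(\<integral>\<^sup>+l. ?G l x y \<partial>lborel)
         = (\<integral>\<^sup>+l. (?K x y * indicator \<Omega> y * indicator \<Omega> x) * ?I l x y \<partial>lborel)"
        by (intro nn_integral_cong) (simp add: ac_simps)
      also have "\<dots> = (?K x y * indicator \<Omega> y * indicator \<Omega> x) * emeasure lborel {x \<bullet> b..<y \<bullet> b}"
        by (rule nn_integral_cmult_indicator) simp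
      finally show ?thesis by (simp add: emeasure_lborel_Ico_ennreal inner_diff_left ac_simps)
    qed
    then have "(\<integral>\<^sup>+y. \<integral>\<^sup>+l. ?G l x y \<partial>lborel \<partial>lebesgue)
       = (\<integral>\<^sup>+y. (?K x y * ennreal ((y - x) \<bullet> b) * indicator \<Omega> y) * indicator \<Omega> x \<partial>lebesgue)"
      by simp
    also have "\<dots> = (\<integral>\<^sup>+y\<in>\<Omega>. ?K x y * ennreal ((y - x) \<bullet> b) \<partial>lebesgue) * indicator \<Omega> x"
      by (rule nn_integral_multc) measurable
    finally show "(\<integral>\<^sup>+y\<in>\<Omega>. ?K x y * ennreal ((y - x) \<bullet> b) \<partial>lebesgue) * indicator \<Omega> x
       = (\<integral>\<^sup>+y. \<integral>\<^sup>+l. ?G l x y \<partial>lborel \<partial>lebesgue)" ..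
  qed
  also have "\<dots> = (\<integral>\<^sup>+x. \<integral>\<^sup>+l. \<integral>\<^sup>+y. ?G l x y \<partial>lebesgue \<partial>lborel \<partial>lebesgue)"
    by (intro nn_integral_cong P.Fubini'[OF m1])
  also have "\<dots> = (\<integral>\<^sup>+l. \<integral>\<^sup>+x. \<integral>\<^sup>+y. ?G l x y \<partial>lebesgue \<partial>lebesgue \<partial>lborel)"
    by (rule P.Fubini'[OF m2])
  also have "\<dots> = (\<integral>\<^sup>+l. interaction lam {x\<in>\<Omega>. x \<bullet> b \<le> l} {y\<in>\<Omega>. l < y \<bullet> b} \<partial>lborel)"
  proof (rule nn_integral_cong)
    fix l :: real
    show "(\<integral>\<^sup>+x. \<integral>\<^sup>+y. ?G l x y \<partial>lebesgue \<partial>lebesgue)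
      = interaction lam {x\<in>\<Omega>. x \<bullet> b \<le> l} {y\<in>\<Omega>. l < y \<bullet> b}"
      unfolding interaction_def potential_def
    proof (rule nn_integral_cong)
      fix x :: 'a
      show "(\<integral>\<^sup>+y. ?G l x y \<partial>lebesgue)
        = (\<integral>\<^sup>+y\<in>{y\<in>\<Omega>. l < y \<bullet> b}. ?K x y \<partial>lebesgue) * indicator {x\<in>\<Omega>. x \<bullet> b \<le> l} x"
      proof (cases "x \<in> \<Omega> \<and> x \<bullet> b \<le> l")
        case True
        then show ?thesis by (auto intro!: nn_integral_cong simp: indicator_def)
      next
        case False
        then have "(\<lambda>y. ?G l x y) = (\<lambda>y. 0)"
          by (auto simp: indicator_def fun_eq_iff)
        then show ?thesis using False by (simp only: nn_integral_const mult_zero_left) (auto simp: indicator_def)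
      qed
    qed
  qed
  also have "\<dots> \<le> (\<integral>\<^sup>+l. slice_area (\<lambda>x. x \<bullet> b) \<Omega> l \<partial>lborel)"
    by (intro nn_integral_mono interaction_le_slice_area[OF lam min m fin C1_contraction_inner[OF b]])
  also have "\<dots> \<le> 2 * emeasure lebesgue \<Omega>"
    by (rule nn_integral_slice_area[OF C1_contraction_measurable[OF C1_contraction_inner[OF b]] \<Omega>(1)])
  finally show ?thesis unfolding \<Omega>(2) .
qed

text \<open>One direction only sees the positive part of a coordinate, so both signs of each basis
  vector are summed: 2 N directions with 2 m each give the constant 4 N m.\<close>

lemma nn_integral_first_moment:
  fixes \<Omega> :: "'a::euclidean_space set"
  assumes lam: "lam > 0" and min: "is_minimizer lam m \<Omega>" and m: "m > 0" and fin: "min_energy TYPE('a) lam m < \<infinity>"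
  shows "(\<integral>\<^sup>+x\<in>\<Omega>. (\<integral>\<^sup>+y\<in>\<Omega>. ennreal (norm (x - y) / norm (x - y) powr lam) \<partial>lebesgue) \<partial>lebesgue) \<le> ennreal (4 * real DIM('a) * m)"
proof -
  have [measurable]: "\<Omega> \<in> sets lebesgue" by (rule is_minimizerD[OF min])
  interpret S: sigma_finite_measure "lebesgue :: 'a measure" by (rule sigma_finite_lebesgue)
  let ?K = "\<lambda>x y. ennreal (1 / norm (x - y) powr lam)"
  let ?B = "Basis \<union> uminus ` Basis :: 'a set"
  have fB: "finite ?B" by simp
  have nB: "norm b \<le> 1" if "b \<in> ?B" for b using that by auto
  have ptw: "ennreal (norm (x - y) / norm (x - y) powr lam) \<le> (\<Sum>b\<in>?B. ?K x y * ennreal ((y - x) \<bullet> b))" for x y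
  proof -
    have dis: "Basis \<inter> uminus ` Basis = ({} :: 'a set)"
    proof (rule ccontr)
      assume "Basis \<inter> uminus ` Basis \<noteq> ({} :: 'a set)"
      then obtain u v :: 'a where "u \<in> Basis" "v \<in> Basis" "u = - v" by blast
      then show False using inner_Basis[of u v] by (auto split: if_splits)
    qed
    have "norm (y - x) \<le> (\<Sum>b\<in>Basis. \<bar>(y - x) \<bullet> b\<bar>)" by (rule norm_le_l1)
    then have "ennreal (norm (y - x)) \<le> (\<Sum>b\<in>Basis. ennreal \<bar>(y - x) \<bullet> b\<bar>)"
      by (simp add: sum_ennreal ennreal_leI)
    also have "\<dots> = (\<Sum>b\<in>Basis. ennreal ((y - x) \<bullet> b) + ennreal ((y - x) \<bullet> (- b)))"
      by (intro sum.cong refl) (auto simp: abs_if ennreal_neg)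
    also have "\<dots> = (\<Sum>b\<in>?B. ennreal ((y - x) \<bullet> b))"
      unfolding sum.union_disjoint[OF finite_Basis finite_imageI[OF finite_Basis] dis]
      by (subst sum.reindex) (auto simp: inj_on_def sum.distrib)
    finally have "?K x y * ennreal (norm (y - x)) \<le> ?K x y * (\<Sum>b\<in>?B. ennreal ((y - x) \<bullet> b))"
      by (rule mult_left_mono) simp
    also have "\<dots> = (\<Sum>b\<in>?B. ?K x y * ennreal ((y - x) \<bullet> b))" by (rule sum_distrib_left)
    also have "?K x y * ennreal (norm (y - x)) = ennreal (norm (x - y) / norm (x - y) powr lam)"
      by (simp add: ennreal_mult[symmetric] norm_minus_commute)
    finally show ?thesis .
  qed
  have mi: "(\<lambda>x. \<integral>\<^sup>+y\<in>\<Omega>. ?K x y * ennreal ((y - x) \<bullet> b) \<partial>lebesgue) \<in> borel_measurable lebesgue" for b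
    by measurable
  have "(\<integral>\<^sup>+x\<in>\<Omega>. (\<integral>\<^sup>+y\<in>\<Omega>. ennreal (norm (x - y) / norm (x - y) powr lam) \<partial>lebesgue) \<partial>lebesgue)
    \<le> (\<integral>\<^sup>+x. (\<integral>\<^sup>+y. (\<Sum>b\<in>?B. ?K x y * ennreal ((y - x) \<bullet> b) * indicator \<Omega> y) \<partial>lebesgue) * indicator \<Omega> x \<partial>lebesgue)"
    unfolding sum_distrib_right[symmetric] by (intro nn_integral_mono mult_right_mono ptw) auto
  also have "\<dots> = (\<integral>\<^sup>+x. (\<Sum>b\<in>?B. (\<integral>\<^sup>+y\<in>\<Omega>. ?K x y * ennreal ((y - x) \<bullet> b) \<partial>lebesgue) * indicator \<Omega> x) \<partial>lebesgue)"
    by (intro nn_integral_cong, subst nn_integral_sum) (auto simp: sum_distrib_right)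
  also have "\<dots> = (\<Sum>b\<in>?B. \<integral>\<^sup>+x\<in>\<Omega>. (\<integral>\<^sup>+y\<in>\<Omega>. ?K x y * ennreal ((y - x) \<bullet> b) \<partial>lebesgue) \<partial>lebesgue)"
    by (rule nn_integral_sum) (use mi in measurable)
  also have "\<dots> \<le> (\<Sum>b\<in>?B. 2 * ennreal m)"
    by (intro sum_mono nn_integral_directional[OF lam min m fin] nB)
  also have "\<dots> = of_nat (card ?B) * (2 * ennreal m)" by simp
  also have "\<dots> \<le> of_nat (2 * DIM('a)) * (2 * ennreal m)"
  proof (rule mult_right_mono)
    have "card ?B \<le> DIM('a) + card (uminus ` (Basis :: 'a set))" by (rule card_Un_le)
    also have "\<dots> \<le> 2 * DIM('a)" using card_image_le[OF finite_Basis, of "uminus :: 'a \<Rightarrow> 'a"] by simp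
    finally show "(of_nat (card ?B) :: ennreal) \<le> of_nat (2 * DIM('a))" by (simp only: of_nat_le_iff)
  qed simp
  also have "\<dots> = ennreal (4 * real DIM('a) * m)"
  proof -
    have "ennreal (real (2 * DIM('a))) * (ennreal 2 * ennreal m) = ennreal (real (2 * DIM('a)) * (2 * m))"
      using m by (simp only: ennreal_mult[symmetric] less_imp_le zero_le_numeral of_nat_0_le_iff mult_nonneg_nonneg)
    also have "real (2 * DIM('a)) * (2 * m) = 4 * real DIM('a) * m" by simp
    finally show ?thesis by (simp only: ennreal_of_nat_eq_real_of_nat ennreal_numeral)
  qed
  finally show ?thesis .
qed

section \<open>Lower bounds for the mass of a minimizer in shells\<close>

text \<open>A discrete form of integrating \<open>w' \<ge> g * w powr ((N - 1) / N)\<close>: the radius \<open>root N w\<close> halves when the argument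
  decreases by a multiple of the radius, so that \<open>w\<close> would vanish within a distance proportional to \<open>root N (w \<beta>)\<close>.\<close>

lemma root_growth:
  fixes w :: "real \<Rightarrow> real"
  assumes N: "N > 0" and g: "g > 0"
    and pos: "\<And>a. \<alpha> < a \<Longrightarrow> a \<le> \<beta> \<Longrightarrow> 0 < w a"
    and step: "\<And>a b. \<alpha> < a \<Longrightarrow> a < b \<Longrightarrow> b \<le> \<beta> \<Longrightarrow> w a + g * (b - a) * root N (w a) ^ (N - 1) \<le> w b"
    and \<alpha>\<beta>: "\<alpha> < \<beta>"
  shows "g * (\<beta> - \<alpha>) \<le> 2 ^ N * root N (w \<beta>)"
proof (rule ccontr)
  assume neg: "\<not> g * (\<beta> - \<alpha>) \<le> 2 ^ N * root N (w \<beta>)"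
  define R where "R = root N (w \<beta>)"
  have w\<beta>: "w \<beta> > 0" using pos \<alpha>\<beta> by simp
  have R: "R > 0" unfolding R_def using w\<beta> N by simp
  \<comment> \<open>Chosen such that g times \<delta> r times (r / 2) to the power N - 1 equals r to
    the power N: if the radius were still above r / 2 after going back by \<delta> r, the mass at
    the starting point would exceed its bound.\<close>
  define \<delta> where "\<delta> r = 2 ^ (N - 1) * r / g" for r
  have \<delta>pos: "r > 0 \<Longrightarrow> \<delta> r > 0" for r unfolding \<delta>_def using g by simp
  have pow: "root N x ^ N = x" if "x > 0" for x using that N by (simp add: real_root_pow_pos)
  have halve: "root N (w (b - \<delta> r)) \<le> r / 2"
    if b: "b \<le> \<beta>" "\<alpha> < b - \<delta> r" and r: "root N (w b) \<le> r" "r > 0" for b r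
  proof (rule ccontr)
    assume n: "\<not> root N (w (b - \<delta> r)) \<le> r / 2"
    have lt: "b - \<delta> r < b" using \<delta>pos[OF r(2)] by simp
    have wb: "w b > 0" using pos b lt by simp
    have wa: "w (b - \<delta> r) > 0" using pos b lt by simp
    have "r ^ N = g * \<delta> r * (r / 2) ^ (N - 1)"
    proof -
      have "g * \<delta> r * (r / 2) ^ (N - 1) = r * r ^ (N - 1)" unfolding \<delta>_def using g by (simp add: power_divide)
      also have "\<dots> = r ^ N" using N by (metis Suc_diff_1 power_Suc)
      finally show ?thesis by simp
    qed
    also have "\<dots> \<le> g * \<delta> r * root N (w (b - \<delta> r)) ^ (N - 1)"
      by (intro mult_left_mono power_mono) (use n r g \<delta>pos[OF r(2)] in auto)
    also have "\<dots> < w (b - \<delta> r) + g * (b - (b - \<delta> r)) * root N (w (b - \<delta> r)) ^ (N - 1)"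
      using wa by simp
    also have "\<dots> \<le> w b" by (rule step[OF b(2) lt b(1)])
    also have "w b = root N (w b) ^ N" using pow[OF wb] by simp
    also have "\<dots> \<le> r ^ N" by (intro power_mono r real_root_ge_zero less_imp_le[OF wb])
    finally show False by simp
  qed
  have "2 * (2 ^ (N - 1) * R) = 2 ^ N * R" using N by (metis Suc_diff_1 mult.assoc power_Suc)
  then have "2 * \<delta> R = 2 ^ N * R / g" unfolding \<delta>_def by simp
  also have "\<dots> < \<beta> - \<alpha>" using neg g unfolding R_def by (simp add: divide_less_eq mult.commute)
  finally have room: "\<alpha> < \<beta> - 2 * \<delta> R" by simp
  \<comment> \<open>The j-th halving of the radius takes a step of length \<delta> R / 2^j, so the
    steps sum to at most 2 \<delta> R, which is less than \<beta> - \<alpha>.\<close>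
  define b where "b j = \<beta> - 2 * \<delta> R * (1 - (1/2) ^ j)" for j :: nat
  have bge: "\<beta> - 2 * \<delta> R \<le> b j" and ble: "b j \<le> \<beta>" for j
    unfolding b_def using \<delta>pos[OF R] by (auto simp: power_le_one mult_left_le)
  have small: "root N (w (b j)) \<le> R * (1/2) ^ j" for j
  proof (induction j)
    case 0
    then show ?case by (simp add: b_def R_def)
  next
    case (Suc j)
    have eq: "b j - \<delta> (R * (1/2) ^ j) = b (Suc j)" 
    proof -
      have "\<delta> (R * (1/2) ^ j) = \<delta> R * (1/2) ^ j" unfolding \<delta>_def by simp
      then show ?thesis unfolding b_def by (simp add: algebra_simps)
    qed
    have "root N (w (b j - \<delta> (R * (1/2) ^ j))) \<le> R * (1/2) ^ j / 2"
      by (rule halve[OF ble _ Suc]) (use eq bge[of "Suc j"] room R in auto)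
    then show ?case unfolding eq by simp
  qed
  \<comment> \<open>At the limit of the points \<open>b j\<close>, monotonicity bounds the radius by
    every \<open>R * (1/2) ^ j\<close>, although \<open>w p\<close> is positive.\<close>
  define p where "p = \<beta> - 2 * \<delta> R"
  have p: "\<alpha> < p" "p \<le> \<beta>" unfolding p_def using room \<delta>pos[OF R] by auto
  have wp: "w p > 0" by (rule pos[OF p])
  have "root N (w p) \<le> R * (1/2) ^ j" for j
  proof -
    have "w p \<le> w (b j)"
    proof (cases "p < b j")
      case True
      have "w p + g * (b j - p) * root N (w p) ^ (N - 1) \<le> w (b j)" by (rule step[OF p(1) True ble])
      moreover have "0 \<le> g * (b j - p) * root N (w p) ^ (N - 1)"
        using g True by (intro mult_nonneg_nonneg zero_le_power real_root_ge_zero less_imp_le[OF wp]) auto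
      ultimately show ?thesis by linarith
    next
      case False
      then have "p = b j" using bge[of j] unfolding p_def by simp
      then show ?thesis by simp
    qed
    then have "root N (w p) \<le> root N (w (b j))" using N by simp
    then show ?thesis using small[of j] by linarith
  qed
  moreover have "(\<lambda>j. R * (1/2) ^ j) \<longlonglongrightarrow> R * 0"
    by (intro tendsto_intros LIMSEQ_power_zero) simp
  ultimately have "root N (w p) \<le> 0" using LIMSEQ_le_const[of "\<lambda>j. R * (1/2) ^ j" 0] by auto
  then show False using wp N by simp
qed

section \<open>Density estimates for minimizers\<close>

lemma divide_root_eq: "N > 0 \<Longrightarrow> v > 0 \<Longrightarrow> v / root N v = root N v ^ (N - 1)"
  by (metis Suc_diff_1 nonzero_mult_div_cancel_left power_Suc real_root_gt_0_iff real_root_pow_pos less_irrefl)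

text \<open>The low part, of mass v, is discarded and the rest is dilated. Minimality and the linear
  energy bound give q \<le> 6 C v + 4 s for the perimeter q of the discarded part and the slice area
  s, while q is at least c times v powr ((N - 1) / N). For small v the term 6 C v is at most half of
  that, leaving the constant c / 8 for s.\<close>

lemma slice_area_lower_bound:
  assumes lam: "0 < lam" "lam < real DIM('a::euclidean_space)"
  shows "\<exists>\<mu> \<gamma> v\<^sub>0. \<mu> > 0 \<and> \<gamma> > 0 \<and> v\<^sub>0 > 0 \<and>
    (\<forall>m\<ge>\<mu>. min_energy TYPE('a) lam m < \<infinity> \<and>
      (\<forall>\<Omega> k l. is_minimizer lam m (\<Omega> :: 'a set) \<longrightarrow> C1_contraction k \<longrightarrow>
        0 < sub_mass \<Omega> k l \<longrightarrow> sub_mass \<Omega> k l \<le> v\<^sub>0 \<longrightarrow>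
        ennreal (\<gamma> * root DIM('a) (sub_mass \<Omega> k l) ^ (DIM('a) - 1)) \<le> slice_area k \<Omega> l))"
proof -
  obtain C \<mu> where C: "C > 0" "\<mu> > 0" "\<And>m. m \<ge> \<mu> \<Longrightarrow> min_energy TYPE('a) lam m \<le> ennreal (C * m)"
    using min_energy_linear_bound[OF lam] by blast
  obtain c where c: "c > 0" "\<And>(A :: 'a set) a. A \<in> sets lebesgue \<Longrightarrow> emeasure lebesgue A = ennreal a \<Longrightarrow> a > 0 \<Longrightarrow>
     ennreal (c * (a / root DIM('a) a)) \<le> perimeter A"
    using isoperimetric by blast
  let ?N = "DIM('a)"
  have N: "?N > 0" by simp
  \<comment> \<open>The first bound gives v \<le> m / 2; the second gives 12 C
    \<open>root N v\<close> \<le> c, by which 6 C v is half absorbed.\<close>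
  define v0 where "v0 = min (\<mu> / 2) ((c / (12 * C)) ^ ?N)"
  have v0: "v0 > 0" unfolding v0_def using C c by simp
  have main: "ennreal (c / 8 * root ?N v ^ (?N - 1)) \<le> slice_area k \<Omega> l"
    if m: "m \<ge> \<mu>" and min: "is_minimizer lam m (\<Omega> :: 'a set)" and k: "C1_contraction k"
      and v: "v = sub_mass \<Omega> k l" "0 < v" "v \<le> v0" for m \<Omega> k l v
  proof (cases "slice_area k \<Omega> l")
    case (real s)
    note \<Omega> = is_minimizerD[OF min]
    have m0: "m > 0" using m C by simp
    let ?V = "{x\<in>\<Omega>. k x \<le> l}" and ?A = "{x\<in>\<Omega>. l < k x}"
    have km: "k \<in> borel_measurable lebesgue" by (rule C1_contraction_measurable[OF k])
    note parts = lmeasurable_level_parts[OF \<Omega>(1,2) less_imp_le[OF m0] km, of l]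
    have V: "?V \<in> sets lebesgue" and A: "?A \<in> sets lebesgue" using parts by (auto dest: fmeasurableD)
    have eV: "emeasure lebesgue ?V = ennreal v" using emeasure_eq_measure2[OF parts(1)] v by simp
    have eA: "emeasure lebesgue ?A = ennreal (m - v)"
    proof -
      have "measure lebesgue ?A = m - v" using parts(3) v(1) by linarith
      then show ?thesis using emeasure_eq_measure2[OF parts(2)] by simp
    qed
    have vm: "v \<le> m / 2" using v(3) m unfolding v0_def by simp
    have E: "energy lam \<Omega> \<le> ennreal (C * m)" using C(3)[OF m] \<Omega>(3) by simp
    then have "energy lam \<Omega> < \<infinity>" using order.strict_trans1 ennreal_less_top by (metis infinity_ennreal_def)
    then obtain p d where pd: "perimeter \<Omega> = ennreal p" "p \<ge> 0" "riesz_energy lam \<Omega> = ennreal d" "d \<ge> 0"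
      unfolding energy_def by (cases "perimeter \<Omega>"; cases "riesz_energy lam \<Omega>") auto
    have pdC: "p + d \<le> C * m"
      using E pd C m0 unfolding energy_def by (simp add: ennreal_plus[symmetric] ennreal_le_iff del: ennreal_plus)
    have split: "perimeter ?V + perimeter ?A \<le> ennreal (p + s)"
      using perimeter_split[OF \<Omega>(1) k, of l] pd real by (simp add: ennreal_plus)
    then have fin: "perimeter ?V + perimeter ?A < \<infinity>" using order.strict_trans1 ennreal_less_top by (metis infinity_ennreal_def)
    then obtain q r where q: "perimeter ?V = ennreal q" "q \<ge> 0" and r: "perimeter ?A = ennreal r" "r \<ge> 0"
      by (cases "perimeter ?V"; cases "perimeter ?A") auto
    have qr: "q + r \<le> p + s"
      using split q r pd real by (simp add: ennreal_plus[symmetric] ennreal_le_iff del: ennreal_plus)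
    have "energy lam \<Omega> \<le> ennreal ((m / (m - v))\<^sup>2) * energy lam ?A"
      unfolding \<Omega>(3) by (rule min_energy_le_dilation[OF A eA _ _ lam(1)]) (use vm m0 v in auto)
    also have "energy lam ?A \<le> ennreal (r + d)"
    proof -
      have "riesz_energy lam ?A \<le> ennreal d" using riesz_energy_mono[OF A \<Omega>(1), of lam] pd by auto
      then show ?thesis unfolding energy_def r(1) ennreal_plus[OF r(2) pd(4)] by (rule add_left_mono)
    qed
    finally have "ennreal (p + d) \<le> ennreal ((m / (m - v))\<^sup>2) * ennreal (r + d)"
      unfolding energy_def pd by (simp add: ennreal_plus[OF pd(2,4)] mult_left_mono)
    then have "ennreal (p + d) \<le> ennreal ((m / (m - v))\<^sup>2 * (r + d))"
      using r pd by (simp add: ennreal_mult)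
    then have 1: "p + d \<le> (m / (m - v))\<^sup>2 * (r + d)"
      using r pd by (simp add: ennreal_le_iff del: ennreal_plus)
    define t where "t = v / m"
    have t: "0 \<le> t" "t \<le> 1/2" unfolding t_def using v vm m0 by (auto simp: divide_le_eq)
    have "m / (m - v) \<le> 1 + 2 * t"
    proof -
      have "m \<le> (1 + 2 * t) * (m - v)"
      proof -
        have "(1 + 2 * t) * (m - v) = m + v * (1 - 2 * t)" unfolding t_def using m0 by (simp add: field_simps)
        then show ?thesis using t v by simp
      qed
      then show ?thesis using vm m0 by (simp add: divide_le_eq)
    qed
    then have "(m / (m - v))\<^sup>2 \<le> (1 + 2 * t)\<^sup>2" using vm m0 by (intro power_mono) auto
    also have "\<dots> \<le> 1 + 6 * t"
    proof -
      have "4 * (t * t) \<le> 2 * t" using mult_left_mono[OF t(2) t(1)] by simp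
      then show ?thesis by (simp add: power2_eq_square algebra_simps)
    qed
    finally have "(m / (m - v))\<^sup>2 * (r + d) \<le> (1 + 6 * t) * (r + d)" using r pd by (intro mult_right_mono) auto
    with 1 have 2: "p \<le> r + 6 * t * (r + d)" by (simp add: algebra_simps)
    \<comment> \<open>The remaining energy r + d is at most C m + s, as the cut adds at most s to
      the perimeter. Then t m = v turns the dilation cost into 6 C v, and t \<le> 1/2 makes the rest
      at most 3 s.\<close>
    have "6 * t * (r + d) \<le> 6 * t * (C * m + s)" using t qr q pdC by (intro mult_left_mono) auto
    also have "\<dots> = 6 * C * v + 6 * t * s" unfolding t_def using m0 by (simp add: field_simps)
    also have "6 * t * s \<le> 3 * s" using mult_right_mono[of "6 * t" 3 s] t real by simp
    finally have 3: "q \<le> 6 * C * v + 4 * s" using 2 qr by linarith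
    define \<rho> where "\<rho> = root ?N v"
    have \<rho>: "\<rho> > 0" unfolding \<rho>_def using v by simp
    have v\<rho>: "v = \<rho> * \<rho> ^ (?N - 1)"
      using divide_root_eq[OF N v(2)] \<rho> unfolding \<rho>_def by (simp add: field_simps)
    have vr: "v / root ?N v = \<rho> ^ (?N - 1)" unfolding \<rho>_def by (rule divide_root_eq[OF N v(2)])
    have "ennreal (c * (v / root ?N v)) \<le> perimeter ?V" by (rule c(2)[OF V eV v(2)])
    then have "ennreal (c * \<rho> ^ (?N - 1)) \<le> ennreal q" by (simp only: vr q(1))
    then have 4: "c * \<rho> ^ (?N - 1) \<le> q" using q(2) by (simp only: ennreal_le_iff)
    have "\<rho> \<le> root ?N ((c / (12 * C)) ^ ?N)" unfolding \<rho>_def using v(3) N unfolding v0_def by simp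
    also have "\<dots> = c / (12 * C)" using c C by (intro real_root_power_cancel) auto
    finally have "12 * C * \<rho> \<le> c" using C by (simp add: field_simps)
    then have "12 * C * \<rho> * \<rho> ^ (?N - 1) \<le> c * \<rho> ^ (?N - 1)" using \<rho> by (intro mult_right_mono) auto
    then have "12 * C * v \<le> c * \<rho> ^ (?N - 1)" unfolding v\<rho> by (simp add: mult.assoc)
    then have "c / 8 * \<rho> ^ (?N - 1) \<le> s" using 3 4 by linarith
    then show ?thesis unfolding real(2) \<rho>_def by (rule ennreal_leI)
  qed simp
  show ?thesis
  proof (rule exI[of _ \<mu>], rule exI[of _ "c / 8"], rule exI[of _ v0], intro conjI allI impI)
    fix m assume m: "m \<ge> \<mu>"
    show "min_energy TYPE('a) lam m < \<infinity>" using order.strict_trans1[OF C(3)[OF m] ennreal_less_top] by simp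
    fix \<Omega> :: "'a set" and k l
    assume "is_minimizer lam m \<Omega>" "C1_contraction k"
      "0 < sub_mass \<Omega> k l" "sub_mass \<Omega> k l \<le> v0"
    then show "ennreal (c / 8 * root ?N (sub_mass \<Omega> k l) ^ (?N - 1)) \<le> slice_area k \<Omega> l"
      using main[OF m _ _ refl] by blast
  qed (use c C v0 in auto)
qed

text \<open>As long as the slab around level t has mass at most \<open>v0\<close>, its mass obeys
  the hypothesis of \<open>root_growth\<close> in the width. So either the mass exceeds
  \<open>v0\<close>, or it has grown to \<open>r0 ^ N\<close> at width parameter 5/4.\<close>

lemma shell_mass:
  assumes lam: "0 < lam" "lam < real DIM('a::euclidean_space)"
  shows "\<exists>\<mu> c. \<mu> > 0 \<and> c > 0 \<and> (\<forall>m\<ge>\<mu>. min_energy TYPE('a) lam m < \<infinity> \<and>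
     (\<forall>\<Omega> h t. is_minimizer lam m (\<Omega> :: 'a set) \<longrightarrow> C1_contraction h \<longrightarrow>
        0 < sub_mass \<Omega> h t \<longrightarrow> 0 < measure lebesgue {x\<in>\<Omega>. t < h x} \<longrightarrow>
        c \<le> measure lebesgue {x\<in>\<Omega>. sdist t (h x) \<le> 5/4}))"
proof -
  let ?N = "DIM('a)"
  have N: "?N > 0" by simp
  obtain \<mu> \<gamma> v0 where \<mu>: "\<mu> > 0" and \<gamma>: "\<gamma> > 0" and v0: "v0 > 0" and
    H: "\<forall>m\<ge>\<mu>. min_energy TYPE('a) lam m < \<infinity> \<and>
      (\<forall>\<Omega> k l. is_minimizer lam m (\<Omega> :: 'a set) \<longrightarrow> C1_contraction k \<longrightarrow>
        0 < sub_mass \<Omega> k l \<longrightarrow> sub_mass \<Omega> k l \<le> v0 \<longrightarrow>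
        ennreal (\<gamma> * root ?N (sub_mass \<Omega> k l) ^ (?N - 1)) \<le> slice_area k \<Omega> l)"
    using slice_area_lower_bound[OF lam] by (elim exE conjE) (rule that)
  have fin: "min_energy TYPE('a) lam m < \<infinity>" if "m \<ge> \<mu>" for m using H that by simp
  have low: "ennreal (\<gamma> * root ?N (sub_mass \<Omega> k l) ^ (?N - 1)) \<le> slice_area k \<Omega> l"
    if "m \<ge> \<mu>" "is_minimizer lam m (\<Omega> :: 'a set)" "C1_contraction k"
      "0 < sub_mass \<Omega> k l" "sub_mass \<Omega> k l \<le> v0" for m \<Omega> k l
    by (rule H[rule_format, OF that(1), THEN conjunct2, rule_format, OF that(2-5)])
  \<comment> \<open>One factor 1/2 comes from counting both faces. The other is lost by integrating
    the slice area only up to the midpoint \<open>d\<close> of a and b, since the mollifiers need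
    slack to the right.\<close>
  define g where "g = \<gamma> / 4"
  have g: "g > 0" unfolding g_def using \<gamma> by simp
  \<comment> \<open>This is the radius that \<open>root_growth\<close> yields for width parameters
    between 1 and 5/4, where \<beta> - \<alpha> = 1/4.\<close>
  define r0 where "r0 = g / 4 / 2 ^ ?N"
  have r0: "r0 > 0" unfolding r0_def using g by simp
  define c where "c = min v0 (r0 ^ ?N)"
  have c: "c > 0" unfolding c_def using v0 r0 by simp
  have main: "c \<le> measure lebesgue {x\<in>\<Omega>. sdist t (h x) \<le> 5/4}"
    if m: "m \<ge> \<mu>" and min: "is_minimizer lam m (\<Omega> :: 'a set)" and h: "C1_contraction h"
      and pos: "0 < sub_mass \<Omega> h t" "0 < measure lebesgue {x\<in>\<Omega>. t < h x}" for m \<Omega> h t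
  proof (rule ccontr)
    note \<Omega> = is_minimizerD[OF min]
    have m0: "m > 0" using m \<mu> by simp
    \<comment> \<open>The values of \<open>sdist\<close> start at 1, so the relevant parameters are
      \<kappa> > 1; the slab \<open>k x \<le> \<kappa>\<close> has half-width sqrt(\<kappa>^2 -
      1).\<close>
    define k where "k x = sdist t (h x)" for x
    have k: "C1_contraction k" unfolding k_def by (rule C1_contraction_compose[OF C1_contraction_sdist h])
    have km: "k \<in> borel_measurable lebesgue" by (rule C1_contraction_measurable[OF k])
    have hm: "h \<in> borel_measurable lebesgue" by (rule C1_contraction_measurable[OF h])
    note parts = lmeasurable_level_parts[OF \<Omega>(1,2) less_imp_le[OF m0] km]
    note hparts = lmeasurable_level_parts[OF \<Omega>(1,2) less_imp_le[OF m0] hm, of t]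
    define w where "w \<kappa> = sub_mass \<Omega> k \<kappa>" for \<kappa>
    have mono: "w a \<le> w b" if "a \<le> b" for a b
      unfolding w_def by (rule measure_mono_fmeasurable[OF _ fmeasurableD[OF parts(1)] parts(1)]) (use that in auto)
    assume "\<not> c \<le> measure lebesgue {x\<in>\<Omega>. sdist t (h x) \<le> 5/4}"
    then have wc: "w (5/4) < c" unfolding w_def k_def by simp
    \<comment> \<open>A null slab would make the slice area of \<open>h\<close> at level t vanish.
      Then the parts of \<Omega> below and above t could be separated for free, although both have
      mass and their interaction is positive.\<close>
    have wpos: "0 < w \<kappa>" if \<kappa>: "1 < \<kappa>" for \<kappa>
    proof (rule ccontr)
      assume "\<not> 0 < w \<kappa>"
      then have "w \<kappa> = 0" using measure_nonneg[of lebesgue "{x\<in>\<Omega>. k x \<le> \<kappa>}"] unfolding w_def by linarith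
      then have "emeasure lebesgue {x\<in>\<Omega>. k x \<le> \<kappa>} = 0"
        using emeasure_eq_measure2[OF parts(1)] unfolding w_def by simp
      then have null: "{x\<in>\<Omega>. k x \<le> \<kappa>} \<in> null_sets lebesgue"
        using fmeasurableD[OF parts(1)] by (rule null_setsI)
      define s where "s = sqrt (\<kappa>\<^sup>2 - 1)"
      have \<kappa>2: "\<kappa>\<^sup>2 > 1" using \<kappa> by (rule one_less_power) simp
      have s: "s > 0" "s\<^sup>2 = \<kappa>\<^sup>2 - 1" unfolding s_def using \<kappa>2 by auto
      have ae: "AE x in lebesgue. x \<in> \<Omega> \<longrightarrow> \<not> (t < h x \<and> h x < t + s)"
      proof (rule AE_I'[OF null], clarify)
        fix x assume x: "x \<in> \<Omega>" "t < h x" "h x < t + s"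
        have "(h x - t)\<^sup>2 \<le> s\<^sup>2" by (rule power_mono) (use x in auto)
        then have "1 + (h x - t) \<bullet> (h x - t) \<le> \<kappa>\<^sup>2" using s by (simp add: power2_eq_square)
        then show "k x \<le> \<kappa>" unfolding k_def sdist_def by (rule real_le_lsqrt[rotated]) (use \<kappa> in simp)
      qed
      have "interaction lam {x\<in>\<Omega>. h x \<le> t} {x\<in>\<Omega>. t < h x} \<le> slice_area h \<Omega> t"
        by (rule interaction_le_slice_area[OF lam(1) min m0 fin[OF m] h])
      also have "\<dots> = 0" by (rule slice_area_eq_0[OF s(1) ae])
      finally have "interaction lam {x\<in>\<Omega>. h x \<le> t} {x\<in>\<Omega>. t < h x} = 0" by simp
      moreover have "interaction lam {x\<in>\<Omega>. h x \<le> t} {x\<in>\<Omega>. t < h x} > 0"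
        by (rule interaction_pos[OF fmeasurableD[OF hparts(1)] fmeasurableD[OF hparts(2)]])
          (use pos emeasure_eq_measure2[OF hparts(1)] emeasure_eq_measure2[OF hparts(2)] in auto)
      ultimately show False by simp
    qed
    have step: "w a + g * (b - a) * root ?N (w a) ^ (?N - 1) \<le> w b" if ab: "1 < a" "a < b" "b \<le> 5/4" for a b
    proof -
      define d where "d = (a + b) / 2"
      have d: "a < d" "d < b" unfolding d_def using ab by auto
      define \<rho> where "\<rho> = root ?N (w a) ^ (?N - 1)"
      have \<rho>: "\<rho> \<ge> 0" unfolding \<rho>_def using wpos[OF ab(1)] by (intro zero_le_power real_root_ge_zero) simp
      have "ennreal (\<gamma> * \<rho> * (d - a)) = ennreal (\<gamma> * \<rho>) * emeasure lborel {a..d}"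
        using d \<gamma> \<rho> by (simp add: ennreal_mult[symmetric])
      also have "\<dots> = (\<integral>\<^sup>+l. ennreal (\<gamma> * \<rho>) * indicator {a..d} l \<partial>lborel)"
        by (rule nn_integral_cmult_indicator[symmetric]) simp
      also have "\<dots> \<le> (\<integral>\<^sup>+l\<in>{a..d}. slice_area k \<Omega> l \<partial>lborel)"
      proof (rule nn_integral_mono)
        fix l :: real
        show "ennreal (\<gamma> * \<rho>) * indicator {a..d} l \<le> slice_area k \<Omega> l * indicator {a..d} l"
        proof (cases "l \<in> {a..d}")
          case True
          have wl: "0 < w l" by (rule wpos) (use True ab in auto)
          have "w l \<le> w (5/4)" by (rule mono) (use True d ab in auto)
          then have wv: "w l \<le> v0" using wc unfolding c_def by simp
          have "root ?N (w a) \<le> root ?N (w l)" using mono[of a l] True by simp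
          then have "\<rho> \<le> root ?N (w l) ^ (?N - 1)"
            unfolding \<rho>_def by (rule power_mono) (rule real_root_ge_zero[OF less_imp_le[OF wpos[OF ab(1)]]])
          then have "ennreal (\<gamma> * \<rho>) \<le> ennreal (\<gamma> * root ?N (w l) ^ (?N - 1))"
            using \<gamma> by (intro ennreal_leI mult_left_mono) auto
          also have "\<dots> \<le> slice_area k \<Omega> l"
            unfolding w_def by (rule low[OF m min k]) (use wl wv in \<open>auto simp: w_def\<close>)
          finally show ?thesis using True by simp
        qed simp
      qed
      also have "\<dots> \<le> 2 * emeasure lebesgue {x\<in>\<Omega>. a < k x \<and> k x \<le> b}"
        by (rule nn_integral_slice_area_interval[OF km \<Omega>(1) d(2)])
      also have "{x\<in>\<Omega>. a < k x \<and> k x \<le> b} = {x\<in>\<Omega>. k x \<le> b} - {x\<in>\<Omega>. k x \<le> a}" by auto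
      also have "emeasure lebesgue ({x\<in>\<Omega>. k x \<le> b} - {x\<in>\<Omega>. k x \<le> a}) = ennreal (w b - w a)"
      proof -
        have "measure lebesgue ({x\<in>\<Omega>. k x \<le> b} - {x\<in>\<Omega>. k x \<le> a}) = w b - w a"
          unfolding w_def by (rule measurable_measure_Diff[OF parts(1) fmeasurableD[OF parts(1)]]) (use ab in auto)
        then show ?thesis using emeasure_eq_measure2[OF fmeasurable_Diff[OF parts(1) fmeasurableD[OF parts(1)], of b a]] by simp
      qed
      also have "2 * ennreal (w b - w a) = ennreal (2 * (w b - w a))"
        using mono[of a b] ab by (subst ennreal_mult) auto
      finally have "\<gamma> * \<rho> * (d - a) \<le> 2 * (w b - w a)"
        using mono[of a b] ab by (simp add: ennreal_le_iff)
      then show ?thesis unfolding \<rho>_def[symmetric] g_def d_def by (simp add: field_simps)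
    qed
    have "g * (5/4 - 1) \<le> 2 ^ ?N * root ?N (w (5/4))"
      by (rule root_growth[OF N g _ step]) (use wpos in auto)
    then have "r0 \<le> root ?N (w (5/4))" unfolding r0_def by (simp add: field_simps)
    then have "r0 ^ ?N \<le> root ?N (w (5/4)) ^ ?N" using r0 by (intro power_mono) auto
    also have "\<dots> = w (5/4)" by (rule real_root_pow_pos) (use wpos[of "5/4"] in auto)
    finally show False using wc unfolding c_def by simp
  qed
  show ?thesis
  proof (rule exI[of _ \<mu>], rule exI[of _ c], intro conjI allI impI \<mu> c)
    fix m assume m: "\<mu> \<le> m"
    show "min_energy TYPE('a) lam m < \<infinity>" by (rule fin[OF m])
    fix \<Omega> :: "'a set" and h t
    assume "is_minimizer lam m \<Omega>" "C1_contraction h"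
      "0 < sub_mass \<Omega> h t" "0 < measure lebesgue {x\<in>\<Omega>. t < h x}"
    then show "c \<le> measure lebesgue {x\<in>\<Omega>. sdist t (h x) \<le> 5/4}" by (rule main[OF m])
  qed
qed

text \<open>A weak substitute for the density theorem: an exceptional point lies in a null piece cut
  out by a ball of radius 1/2 with centre in a countable dense set. It provides the mass inside the
  shells.\<close>

lemma AE_ball_measure_pos:
  fixes \<Omega> :: "'a::euclidean_space set"
  assumes \<Omega>[measurable]: "\<Omega> \<in> sets lebesgue"
  shows "AE x in lebesgue. x \<in> \<Omega> \<longrightarrow> 0 < emeasure lebesgue (\<Omega> \<inter> ball x 1)"
proof -
  have [measurable]: "ball x r \<in> sets lebesgue" for x :: 'a and r by simp
  obtain D :: "'a set" where D: "countable D" "\<And>X. open X \<Longrightarrow> X \<noteq> {} \<Longrightarrow> \<exists>d\<in>D. d \<in> X"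
    by (rule countable_dense_setE) (rule that, assumption, blast)
  let ?D = "{d\<in>D. \<Omega> \<inter> ball d (1/2) \<in> null_sets lebesgue}"
  have null: "(\<Union>d\<in>?D. \<Omega> \<inter> ball d (1/2)) \<in> null_sets lebesgue"
    by (rule null_sets_UN') (use D(1) in auto)
  show ?thesis
  proof (rule AE_I'[OF null], rule subsetI)
    fix x assume "x \<in> {x \<in> space lebesgue. \<not> (x \<in> \<Omega> \<longrightarrow> 0 < emeasure lebesgue (\<Omega> \<inter> ball x 1))}"
    then have x: "x \<in> \<Omega>" "emeasure lebesgue (\<Omega> \<inter> ball x 1) = 0" by auto
    obtain d where d: "d \<in> D" "d \<in> ball x (1/2)" using D(2)[of "ball x (1/2)"] by auto
    have "ball d (1/2) \<subseteq> ball x 1"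
    proof
      fix y assume "y \<in> ball d (1/2)"
      then show "y \<in> ball x 1" using d(2) dist_triangle[of x y d] by (simp add: dist_commute)
    qed
    then have "emeasure lebesgue (\<Omega> \<inter> ball d (1/2)) \<le> emeasure lebesgue (\<Omega> \<inter> ball x 1)"
      by (intro emeasure_mono) auto
    then have "\<Omega> \<inter> ball d (1/2) \<in> null_sets lebesgue" using x(2) by (intro null_setsI) auto
    moreover have "x \<in> ball d (1/2)" using d(2) by (simp add: dist_commute)
    ultimately show "x \<in> (\<Union>d\<in>?D. \<Omega> \<inter> ball d (1/2))" using d(1) x(1) by blast
  qed
qed

text \<open>This is where \<open>lam\<close> \<le> 2 enters: for r \<ge> 1 the weight r powr (1 -
  \<open>lam\<close>) decays no faster than 1 / r, the borderline at which the sum over shells still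
  diverges.\<close>

lemma first_moment_kernel_ge:
  fixes r lam :: real
  assumes "1 \<le> r" "r \<le> R" "lam \<le> 2"
  shows "1 / R \<le> r / r powr lam"
proof -
  have "r powr lam \<le> r powr 2" using assms by (intro powr_mono) auto
  then have "r powr lam \<le> r * r" using assms by (simp add: powr_realpow[of r 2, simplified] power2_eq_square)
  then have "r / (r * r) \<le> r / r powr lam" using assms by (intro divide_left_mono mult_pos_pos) auto
  moreover have "1 / R \<le> 1 / r" using assms by (intro divide_left_mono) auto
  ultimately show ?thesis using assms by simp
qed

theorem no_minimizer_large_mass:
  assumes lam: "0 < lam" "lam < real DIM('a::euclidean_space)" "lam \<le> 2"
  shows "\<exists>M. \<forall>m > M. \<not> (\<exists>\<Omega> :: 'a set. is_minimizer lam m \<Omega>)"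
proof -
  obtain \<mu> c where \<mu>: "\<mu> > 0" and c: "c > 0" and
    H: "\<forall>m\<ge>\<mu>. min_energy TYPE('a) lam m < \<infinity> \<and>
     (\<forall>\<Omega> h t. is_minimizer lam m (\<Omega> :: 'a set) \<longrightarrow> C1_contraction h \<longrightarrow>
        0 < sub_mass \<Omega> h t \<longrightarrow> 0 < measure lebesgue {x\<in>\<Omega>. t < h x} \<longrightarrow>
        c \<le> measure lebesgue {x\<in>\<Omega>. sdist t (h x) \<le> 5/4})"
    using shell_mass[OF lam(1,2)] by (elim exE conjE) (rule that)
  have fin: "min_energy TYPE('a) lam m < \<infinity>" if "m \<ge> \<mu>" for m using H that by simp
  have shell: "c \<le> measure lebesgue {x\<in>\<Omega>. sdist t (h x) \<le> 5/4}"
    if "m \<ge> \<mu>" "is_minimizer lam m (\<Omega> :: 'a set)" "C1_contraction h"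
      "0 < sub_mass \<Omega> h t" "0 < measure lebesgue {x\<in>\<Omega>. t < h x}" for m \<Omega> h t
    by (rule H[rule_format, OF that(1), THEN conjunct2, rule_format, OF that(2-5)])
  have "\<forall>\<^sub>F J in sequentially. 24 * real DIM('a) / c < harm J"
    using harm_at_top[unfolded filterlim_at_top_dense] by (rule spec)
  then have "\<exists>J. \<forall>n\<ge>J. 24 * real DIM('a) / c < harm n" by (simp only: eventually_sequentially)
  then obtain J where "\<forall>n\<ge>J. 24 * real DIM('a) / c < harm n" ..
  \<comment> \<open>The lower bound c / 6 \<open>harm J\<close> m meets the upper bound 4 N m at
    \<open>harm J\<close> = 24 N / c.\<close>
  then have J: "24 * real DIM('a) / c < harm J" by simp
  \<comment> \<open>A mass above this cannot fit into a ball of radius 4 J, so there is mass outside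
    of each of the first \<open>J\<close> shells.\<close>
  let ?b = "measure lebesgue (cball (0::'a) (4 * real J))"
  define M where "M = max \<mu> ?b"
  have "\<not> is_minimizer lam m \<Omega>" if mM: "m > M" for m and \<Omega> :: "'a set"
  proof
    assume min: "is_minimizer lam m \<Omega>"
    note \<Omega> = is_minimizerD[OF min]
    have m\<mu>: "m \<ge> \<mu>" and mball: "m > ?b" using mM unfolding M_def by auto
    have m0: "m > 0" using m\<mu> \<mu> by simp
    have [measurable]: "\<Omega> \<in> sets lebesgue" by (rule \<Omega>)
    have \<Omega>l: "\<Omega> \<in> lmeasurable" using \<Omega> by (simp add: fmeasurable_def)
    let ?f = "\<lambda>x y. ennreal (norm (x - y) / norm (x - y) powr lam)"
    let ?V = "\<lambda>x. \<integral>\<^sup>+y\<in>\<Omega>. ?f x y \<partial>lebesgue"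
    have inner: "ennreal (c / 6 * harm J) \<le> ?V x"
      if x: "0 < emeasure lebesgue (\<Omega> \<inter> ball x 1)" for x
    proof -
      let ?h = "sdist x"
      let ?H = "\<lambda>j. {y\<in>\<Omega>. ?h y \<le> 4 * real j}"
      \<comment> \<open>A member of \<open>S j\<close> has \<open>sdist\<close> within 5/4 of 4 j.
        The spacing 4 exceeds 2 times 5/4, so the shells are disjoint, and for j \<ge> 1 the
        distance to x lies between 4 j - 9/4 \<ge> 1 and 4 j + 5/4 \<le> 6 j.\<close>
      define S where "S j = {y\<in>\<Omega>. sdist (4 * real j) (?h y) \<le> 5/4}" for j
      have hm: "?h \<in> borel_measurable lebesgue" by (rule C1_contraction_measurable[OF C1_contraction_sdist])
      note parts = lmeasurable_level_parts[OF \<Omega>(1,2) less_imp_le[OF m0] hm]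
      have Sl: "S j \<in> lmeasurable" for j
        unfolding S_def
        by (rule lmeasurable_level_parts(1)[OF \<Omega>(1,2) less_imp_le[OF m0]])
          (rule C1_contraction_measurable[OF C1_contraction_compose[OF C1_contraction_sdist C1_contraction_sdist]])
      have Sm[measurable]: "S j \<in> sets lebesgue" for j using Sl by (rule fmeasurableD)
      have Sc: "c \<le> measure lebesgue (S j)" if j: "j \<in> {1..J}" for j
        unfolding S_def
      proof (rule shell[OF m\<mu> min C1_contraction_sdist])
        have "\<Omega> \<inter> ball x 1 \<subseteq> ?H j"
        proof
          fix y assume y: "y \<in> \<Omega> \<inter> ball x 1"
          then have "dist y x < 1" by (simp only: Int_iff mem_ball dist_commute[of y x])
          then have "norm (y - x) < 1" by (simp only: dist_norm)
          moreover have "?h y \<le> norm (y - x) + 1" by (rule sdist_ge(3))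
          moreover have "1 \<le> real j" using j by auto
          ultimately have "?h y \<le> 4 * real j" by linarith
          then show "y \<in> ?H j" using y by blast
        qed
        then have "emeasure lebesgue (\<Omega> \<inter> ball x 1) \<le> emeasure lebesgue (?H j)"
          by (rule emeasure_mono[OF _ fmeasurableD[OF parts(1)]])
        with x have "0 < emeasure lebesgue (?H j)" by (rule order.strict_trans2)
        then show "0 < measure lebesgue (?H j)"
          unfolding emeasure_eq_measure2[OF parts(1)] by simp
        have cb: "cball x (4 * real J) \<in> lmeasurable" by (rule lmeasurable_cball)
        have "measure lebesgue (?H j) \<le> measure lebesgue (cball x (4 * real J))"
        proof (rule measure_mono_fmeasurable[OF _ fmeasurableD[OF parts(1)] cb], rule subsetI)
          fix y assume y: "y \<in> ?H j"
          moreover have "real j \<le> real J" using j by simp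
          ultimately have "norm (y - x) \<le> 4 * real J" using sdist_ge(2)[where a = x and y = y] by simp
          then show "y \<in> cball x (4 * real J)" by (simp add: dist_norm norm_minus_commute)
        qed
        also have "\<dots> = ?b"
          by (simp add: content_cball)
        also have "\<dots> < m" by (rule mball)
        finally show "0 < measure lebesgue {y\<in>\<Omega>. 4 * real j < ?h y}" using parts(3)[of "4 * real j"] by linarith
      qed
      let ?u = "\<lambda>j. ennreal (1 / (6 * real j))"
      have ptw: "(\<Sum>j\<in>{1..J}. ?u j * indicator (S j) y) \<le> ?f x y * indicator \<Omega> y" for y
      proof (cases "\<exists>j\<in>{1..J}. y \<in> S j")
        case True
        then obtain j where j: "j \<in> {1..J}" "y \<in> S j" by blast
        have dist: "\<bar>?h y - 4 * real i\<bar> \<le> 5/4" if "y \<in> S i" for i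
          using that sdist_ge(2)[where a = "4 * real i" and y = "?h y"] unfolding S_def by simp
        have uniq: "i = j" if "y \<in> S i" for i
        proof -
          have "\<bar>real i - real j\<bar> < 1" using dist[OF that] dist[OF j(2)] by linarith
          then show ?thesis by linarith
        qed
        have "(\<Sum>i\<in>{1..J}. ?u i * indicator (S i) y)
           = (\<Sum>i\<in>{1..J}. if i = j then ?u j else 0)"
        proof (rule sum.cong[OF refl])
          fix i
          show "?u i * indicator (S i) y = (if i = j then ?u j else 0)"
          proof (cases "i = j")
            case False
            then have "y \<notin> S i" using uniq by blast
            then show ?thesis using False by simp
          qed (use j(2) in simp)
        qed
        also have "\<dots> = ?u j" using j(1) by simp
        also have "\<dots> \<le> ?f x y"
        proof (intro ennreal_leI first_moment_kernel_ge lam)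
          have j1: "1 \<le> real j" using j(1) by simp
          have n: "norm (x - y) = norm (y - x)" by (rule norm_minus_commute)
          show "1 \<le> norm (x - y)" unfolding n using dist[OF j(2)] sdist_ge(3)[of x y] j1 by linarith
          show "norm (x - y) \<le> 6 * real j" unfolding n using dist[OF j(2)] sdist_ge(2)[where a = x and y = y] j1 by linarith
        qed
        finally show ?thesis using j(2) unfolding S_def by simp
      next
        case False
        then have "(\<Sum>j\<in>{1..J}. ?u j * indicator (S j) y) = 0"
          by (intro sum.neutral) (auto simp: indicator_def)
        then show ?thesis by simp
      qed
      have "c / 6 * harm J = (\<Sum>j\<in>{1..J}. 1 / (6 * real j) * c)"
        unfolding harm_def by (simp add: sum_distrib_left field_simps)
      also have "ennreal \<dots> = (\<Sum>j\<in>{1..J}. ennreal (1 / (6 * real j) * c))"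
        by (rule sum_ennreal[symmetric]) (use c in auto)
      also have "\<dots> \<le> (\<Sum>j\<in>{1..J}. ?u j * emeasure lebesgue (S j))"
      proof (rule sum_mono)
        fix j assume j: "j \<in> {1..J}"
        have "ennreal (1 / (6 * real j) * c) = ?u j * ennreal c"
          using c by (intro ennreal_mult) auto
        also have "\<dots> \<le> ?u j * emeasure lebesgue (S j)"
          unfolding emeasure_eq_measure2[OF Sl] by (intro mult_left_mono ennreal_leI Sc j) simp
        finally show "ennreal (1 / (6 * real j) * c) \<le> ?u j * emeasure lebesgue (S j)" .
      qed
      also have "\<dots> = (\<Sum>j\<in>{1..J}. \<integral>\<^sup>+y. ?u j * indicator (S j) y \<partial>lebesgue)"
        by (intro sum.cong refl nn_integral_cmult_indicator[symmetric] Sm)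
      also have "\<dots> = (\<integral>\<^sup>+y. (\<Sum>j\<in>{1..J}. ?u j * indicator (S j) y) \<partial>lebesgue)"
        by (rule nn_integral_sum[symmetric]) measurable
      also have "\<dots> \<le> ?V x" by (intro nn_integral_mono ptw)
      finally show ?thesis .
    qed
    have H0: "harm J \<ge> (0::real)" by (rule harm_nonneg)
    have "ennreal (c / 6 * harm J * m) = ennreal (c / 6 * harm J) * emeasure lebesgue \<Omega>"
      unfolding \<Omega>(2) using c H0 m0 by (intro ennreal_mult) auto
    also have "\<dots> = (\<integral>\<^sup>+x. ennreal (c / 6 * harm J) * indicator \<Omega> x \<partial>lebesgue)"
      by (rule nn_integral_cmult_indicator[symmetric]) (rule \<Omega>)
    also have "\<dots> \<le> (\<integral>\<^sup>+x\<in>\<Omega>. ?V x \<partial>lebesgue)"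
    \<comment> \<open>The pointwise bound needs mass of \<Omega> near x, which is known only for
      almost every x.\<close>
    proof (rule nn_integral_mono_AE)
      show "AE x in lebesgue. ennreal (c / 6 * harm J) * indicator \<Omega> x \<le> ?V x * indicator \<Omega> x"
        using AE_ball_measure_pos[OF \<Omega>(1)]
      proof (rule eventually_mono)
        fix x assume pos: "x \<in> \<Omega> \<longrightarrow> 0 < emeasure lebesgue (\<Omega> \<inter> ball x 1)"
        show "ennreal (c / 6 * harm J) * indicator \<Omega> x \<le> ?V x * indicator \<Omega> x"
        proof (cases "x \<in> \<Omega>")
          case True
          show ?thesis by (intro mult_right_mono inner mp[OF pos True]) simp
        qed simp
      qed
    qed
    also have "\<dots> \<le> ennreal (4 * real DIM('a) * m)"
      by (rule nn_integral_first_moment[OF lam(1) min m0 fin[OF m\<mu>]])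
    finally have "c / 6 * harm J * m \<le> 4 * real DIM('a) * m"
      using m0 by (subst (asm) ennreal_le_iff) auto
    then have "c / 6 * harm J \<le> 4 * real DIM('a)" using m0 by simp
    then have "harm J \<le> 24 * real DIM('a) / c" using c by (simp add: field_simps)
    then show False using J by simp
  qed
  then show ?thesis by blast
qed

theorem theorem3:
  fixes lam :: real
  assumes "CARD('n::finite) \<ge> 2"
    and "0 < lam" and "lam < real CARD('n)" and "lam \<le> 2"
  shows "\<exists>m_c2 :: real. m_c2 \<ge> m_star TYPE(real ^ 'n) lam \<and>
    (\<forall>m > m_c2. \<not> (\<exists>\<Omega> :: (real ^ 'n) set. is_minimizer lam m \<Omega>))"
proof -
  have "\<exists>M. \<forall>m > M. \<not> (\<exists>\<Omega> :: (real ^ 'n) set. is_minimizer lam m \<Omega>)"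
    by (rule no_minimizer_large_mass) (use assms in simp_all)
  then obtain M where M: "\<forall>m > M. \<not> (\<exists>\<Omega> :: (real ^ 'n) set. is_minimizer lam m \<Omega>)" ..
  \<comment> \<open>Nonexistence above a threshold persists when the threshold is enlarged, so a
    maximum secures the bound by \<open>m_star\<close>.\<close>
  show ?thesis
    by (rule exI[of _ "max M (m_star TYPE(real ^ 'n) lam)"]) (simp add: M)
qed

end
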